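(* Let $\mathcal L=\Lambda+u+v\Lambda^{-1}$, with $u=\begin{bmatrix}u_0 & u_1 \\ u_1 & u_0\end{bmatrix}$, $v=\begin{bmatrix}v_0 & v_1 \\ v_1 & v_0\end{bmatrix}$, be the Lax operator of a solution of the strongly coupled extended Toda hierarchy (SCETH), and let $\phi=\begin{bmatrix}\phi_0 & \phi_1 \\ \phi_1 & \phi_0\end{bmatrix}$ be a (pointwise invertible) first wave function of the SCETH. Then the Darboux transformation operator $$W=I_2-\frac{\phi}{\Lambda^{-1}\phi}\Lambda^{-1}=\phi\circ(I_2-\Lambda^{-1})\circ\phi^{-1}$$ generates a new solution of the SCETH: $\mathcal L^{[1]}=W\mathcal LW^{-1}$ is again of the form $\Lambda+u^{[1]}+v^{[1]}\Lambda^{-1}$ with $u^{[1]}=\begin{bmatrix}u^{[1]}_0 & u^{[1]}_1 \\ u^{[1]}_1 & u^{[1]}_0\end{bmatrix}$, $v^{[1]}=\begin{bmatrix}v^{[1]}_0 & v^{[1]}_1 \\ v^{[1]}_1 & v^{[1]}_0\end{bmatrix}$, it satisfies the Lax equations $$\epsilon\partial_{t_j}\mathcal L^{[1]}=[(B_j^{[1]})_+,\mathcal L^{[1]}],\qquad \epsilon\partial_{y_j}\mathcal L^{[1]}=[(F_j^{[1]})_+,\mathcal L^{[1]}],\qquad j\ge0,$$ and $$u_0^{[1]}=u_0+(\Lambda-1)\frac{\phi_0(x)\phi_0(x-\epsilon)-\phi_1(x)\phi_1(x-\epsilon)}{\phi_0^2(x-\epsilon)-\phi_1^2(x-\epsilon)},$$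 $$u_1^{[1]}=u_1+(\Lambda-1)\frac{\phi_1(x)\phi_0(x-\epsilon)-\phi_0(x)\phi_1(x-\epsilon)}{\phi_0^2(x-\epsilon)-\phi_1^2(x-\epsilon)},$$ $$v_0^{[1]}=\frac{N_0D_0-N_1D_1}{D_0^2-D_1^2}\,v_0(x-\epsilon)+\frac{N_1D_0-N_0D_1}{D_0^2-D_1^2}\,v_1(x-\epsilon),$$ $$v_1^{[1]}=\frac{N_0D_0-N_1D_1}{D_0^2-D_1^2}\,v_1(x-\epsilon)+\frac{N_1D_0-N_0D_1}{D_0^2-D_1^2}\,v_0(x-\epsilon),$$ where $N_0=\phi_0(x)\phi_0(x-2\epsilon)+\phi_1(x)\phi_1(x-2\epsilon)$, $N_1=\phi_0(x)\phi_1(x-2\epsilon)+\phi_1(x)\phi_0(x-2\epsilon)$, $D_0=\phi_0^2(x-\epsilon)+\phi_1^2(x-\epsilon)$, $D_1=2\phi_0(x-\epsilon)\phi_1(x-\epsilon)$.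
   Context: Coefficient algebra: $S_2=\{aI_2+bJ: a,b\in\mathbb C\}$ with $J=\begin{bmatrix}0 & 1 \\ 1 & 0\end{bmatrix}$, a commutative subalgebra of $gl(2,\mathbb C)$. All coefficients are $S_2$-valued functions of $x$ and of the times $t=(t_j)_{j\ge0}$, $y=(y_j)_{j\ge 0}$; $\epsilon$ is a nonzero parameter, $\partial=\partial/\partial x$, and $\Lambda$ is the shift $(\Lambda f)(x)=f(x+\epsilon)$. In $\frac{\phi}{\Lambda^{-1}\phi}$ the denominator is the shifted function $\phi(x-\epsilon)$. For an operator $\sum_k A_k\Lambda^k$ (where $A_k$ is a function, or a function plus a function times $\epsilon\partial$), put $(\cdot)_+=\sum_{k\ge0}A_k\Lambda^k$ and $(\cdot)_-=\sum_{k<0}A_k\Lambda^k$. Dressing operators: $P=I_2+\omega_1(x)\Lambda^{-1}+\omega_2(x)\Lambda^{-2}+\cdots$ and $\bar P=\bar\omega_0(x)+\bar\omega_1(x)\Lambda+\bar\omega_2(x)\Lambda^2+\cdots$ with $\bar\omega_0$ invertible, subject to the constraint $\mathcal L:=P\Lambda P^{-1}=\bar P\Lambda^{-1}\bar P^{-1}$, so that $\mathcal L=\Lambda+u(x)+v(x)\Lambda^{-1}$. Logarithms: $\log_+\mathcal L=P\,\epsilon\partial\,P^{-1}$, $\log_-\mathcal L=-\bar P\,\epsilon\partial\,\bar P^{-1}$, $\log\mathcal L=\tfrac12(\log_+\mathcal L+\log_-\mathcal L)$. With $c_0=0$, $c_j=\sum_{i=1}^j\frac1i$, put for $j\ge0$: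 $B_j=\frac{\mathcal L^{j+1}}{(j+1)!}$ and $F_j=\frac{2\mathcal L^j}{j!}(\log\mathcal L-c_j)$. SCETH: the system of Sato equations, for all $j\ge0$, $\epsilon\partial_{t_j}P=-(B_j)_-P$, $\epsilon\partial_{t_j}\bar P=(B_j)_+\bar P$, $\epsilon\partial_{y_j}P=-(F_j)_-P$, $\epsilon\partial_{y_j}\bar P=(F_j)_+\bar P$; it implies the Lax equations $\epsilon\partial_{t_j}\mathcal L=[(B_j)_+,\mathcal L]$, $\epsilon\partial_{y_j}\mathcal L=[(F_j)_+,\mathcal L]$. First wave function: an $S_2$-valued function $\phi(x,t,y)$ with $\mathcal L\phi=\lambda\phi$ for a spectral parameter $\lambda$ and, for all $j\ge0$, $$\epsilon\partial_{t_j}\phi=(B_j)_+\phi,\qquad \epsilon\partial_{y_j}\phi=\Big(\frac{\mathcal L^j}{j!}(\log_+\mathcal L-c_j)-(F_j)_-\Big)\phi .$$ (The operator in the last equation equals $\big(\frac{\mathcal L^j}{j!}(\log_+\mathcal L-c_j)\big)_+-\big(\frac{\mathcal L^j}{j!}(\log_-\mathcal L-c_j)\big)_-$ and involves only finitely many powers of $\Lambda$.) Transformed quantities: $B_j^{[1]}=B_j(\mathcal L^{[1]})$ and $F_j^{[1]}=F_j(\mathcal L^{[1]})$ are built from $\mathcal L^{[1]}$ by the same formulas, with $\log_\pm\mathcal L^{[1]}=W(\log_\pm\mathcal L)W^{-1}$, where $W^{-1}$ is expanded in non-positive powers of $\Lambda$ for $\log_+$ and in positive powers of $\Lambda$ for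 $\log_-$ (equivalently, the new dressing operators are $WP$ and $W\bar P\Lambda$). *)

theory Defs
  imports "HOL-Analysis.Analysis" "HOL-Library.Function_Algebras"
begin

section \<open>The coefficient algebra\<close>

definition J2 :: "complex ^ 2 ^ 2" where
  "J2 = (\<chi> i k. if i = k then 0 else 1)"

(* Matrix multiplication is the double asterisk; the class operation times on vectors is
   componentwise. *)
definition S2 :: "(complex ^ 2 ^ 2) set" where
  "S2 = {mat a + mat b ** J2 | a b. True}"

lemma S2_iff: "M \<in> S2 \<longleftrightarrow> M $ 1 $ 1 = M $ 2 $ 2 \<and> M $ 1 $ 2 = M $ 2 $ 1"
proof
  assume "M \<in> S2"
  then show "M $ 1 $ 1 = M $ 2 $ 2 \<and> M $ 1 $ 2 = M $ 2 $ 1"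
    by (auto simp: S2_def J2_def mat_def matrix_matrix_mult_def sum_2)
next
  assume "M $ 1 $ 1 = M $ 2 $ 2 \<and> M $ 1 $ 2 = M $ 2 $ 1"
  then have "M = mat (M $ 1 $ 1) + mat (M $ 1 $ 2) ** J2"
    by (simp add: J2_def mat_def matrix_matrix_mult_def sum_2 vec_eq_iff forall_2)
  then show "M \<in> S2" unfolding S2_def by blast
qed

typedef s2 = S2
  morphisms to_mat of_mat
  by (rule exI[of _ 0]) (simp add: S2_iff)

setup_lifting type_definition_s2

lift_definition mk_s2 :: "complex \<Rightarrow> complex \<Rightarrow> s2" is "\<lambda>a b. mat a + mat b ** J2"
  by (auto simp: S2_def)

lift_definition ent0 :: "s2 \<Rightarrow> complex" is "\<lambda>M. M $ 1 $ 1" .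

lift_definition ent1 :: "s2 \<Rightarrow> complex" is "\<lambda>M. M $ 1 $ 2" .

instantiation s2 :: "{zero, one, plus, minus, uminus, times}"
begin
lift_definition zero_s2 :: s2 is 0 by (simp add: S2_iff)
lift_definition one_s2 :: s2 is "mat 1" by (simp add: S2_iff mat_def)
lift_definition plus_s2 :: "s2 \<Rightarrow> s2 \<Rightarrow> s2" is "(+)" by (simp add: S2_iff)
lift_definition minus_s2 :: "s2 \<Rightarrow> s2 \<Rightarrow> s2" is "(-)" by (simp add: S2_iff)
lift_definition uminus_s2 :: "s2 \<Rightarrow> s2" is uminus by (simp add: S2_iff)
lift_definition times_s2 :: "s2 \<Rightarrow> s2 \<Rightarrow> s2" is "(**)"
  by (simp add: S2_iff matrix_matrix_mult_def sum_2 mult.commute add.commute)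
instance ..
end

lemma s2_eq_iff: "x = y \<longleftrightarrow> ent0 x = ent0 y \<and> ent1 x = ent1 y"
  by transfer (auto simp: S2_iff vec_eq_iff forall_2)

lemma ent_simps [simp]:
  "ent0 (mk_s2 a b) = a" "ent1 (mk_s2 a b) = b"
  "ent0 0 = 0" "ent1 0 = 0" "ent0 1 = 1" "ent1 1 = 0"
  "ent0 (x + y) = ent0 x + ent0 y" "ent1 (x + y) = ent1 x + ent1 y"
  "ent0 (x - y) = ent0 x - ent0 y" "ent1 (x - y) = ent1 x - ent1 y"
  "ent0 (- x) = - ent0 x" "ent1 (- x) = - ent1 x"
  "ent0 (x * y) = ent0 x * ent0 y + ent1 x * ent1 y"
  "ent1 (x * y) = ent0 x * ent1 y + ent1 x * ent0 y"
  by (transfer, simp add: J2_def S2_iff mat_def matrix_matrix_mult_def sum_2)+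

instance s2 :: comm_ring_1
  by standard (simp_all add: s2_eq_iff algebra_simps)

definition scal :: "complex \<Rightarrow> s2" where
  "scal c = mk_s2 c 0"

(* Only used at invertible arguments; S2 is closed under inverses, see s2_inv_right. *)
definition s2_inv :: "s2 \<Rightarrow> s2" where
  "s2_inv x = of_mat (matrix_inv (to_mat x))"

lemma s2_inv_right:
  assumes "invertible (to_mat x)"
  shows "x * s2_inv x = 1"
proof -
  have D: "det (to_mat x) = ent0 x ^ 2 - ent1 x ^ 2"
    using to_mat[of x]
    by (simp add: det_2 S2_iff ent0.rep_eq ent1.rep_eq power2_eq_square)
  have nz: "ent0 x ^ 2 - ent1 x ^ 2 \<noteq> 0"
    using assms invertible_det_nz[of "to_mat x"] D by simp
  define y where "y = mk_s2 (ent0 x / (ent0 x ^ 2 - ent1 x ^ 2)) (- ent1 x / (ent0 x ^ 2 - ent1 x ^ 2))"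
  have xy: "x * y = 1"
    using nz by (simp add: s2_eq_iff y_def power2_eq_square flip: diff_divide_distrib)
  then have m: "to_mat x ** to_mat y = mat 1"
    by (metis one_s2.rep_eq times_s2.rep_eq)
  have "matrix_inv (to_mat x) ** to_mat x = mat 1"
    using assms unfolding invertible_def matrix_inv_def by (rule someI2_ex) simp
  then have "to_mat y = matrix_inv (to_mat x)"
    by (metis m matrix_mul_assoc matrix_mul_lid matrix_mul_rid)
  then have "s2_inv x = y"
    by (metis s2_inv_def to_mat_inverse)
  with xy show ?thesis by simp
qed


section \<open>Coefficient functions\<close>

datatype coord = X | T nat | Y nat

(* A point records x and all times t_j, y_j. *)
type_synonym pt = "coord \<Rightarrow> real"

definition partial :: "coord \<Rightarrow> (pt \<Rightarrow> complex) \<Rightarrow> pt \<Rightarrow> complex" where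
  "partial i f p = vector_derivative (\<lambda>s. f (p(i := s))) (at (p i))"

(* Continuity is required jointly in every finite set of variables, the others being frozen.
   Continuity for the product topology in all times would be too restrictive: it excludes
   functions with a nonzero constant derivative in infinitely many t_j, which occur as
   coefficients of P already when u = 0 and v = 1. *)
definition fin_continuous :: "(pt \<Rightarrow> complex) \<Rightarrow> bool" where
  "fin_continuous f \<longleftrightarrow>
     (\<forall>S p. finite S \<longrightarrow> continuous_on UNIV (\<lambda>q :: pt. f (override_on p q S)))"

primrec Ck :: "nat \<Rightarrow> (pt \<Rightarrow> complex) \<Rightarrow> bool" where
  "Ck 0 f \<longleftrightarrow> fin_continuous f"
| "Ck (Suc n) f \<longleftrightarrow> fin_continuous f \<and>
     (\<forall>i p. (\<lambda>s. f (p(i := s))) differentiable (at (p i))) \<and> (\<forall>i. Ck n (partial i f))"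

type_synonym sfun = "pt \<Rightarrow> s2"

definition mk_fun :: "(pt \<Rightarrow> complex) \<Rightarrow> (pt \<Rightarrow> complex) \<Rightarrow> sfun" where
  "mk_fun f0 f1 = (\<lambda>p. mk_s2 (f0 p) (f1 p))"

definition smooth_fun :: "sfun \<Rightarrow> bool" where
  "smooth_fun f \<longleftrightarrow> (\<forall>n. Ck n (ent0 \<circ> f) \<and> Ck n (ent1 \<circ> f))"

definition pointwise_invertible :: "sfun \<Rightarrow> bool" where
  "pointwise_invertible f \<longleftrightarrow> (\<forall>p. invertible (to_mat (f p)))"

(* (Lambda^k f)(x) = f (x + k * eps) *)
definition shift :: "real \<Rightarrow> int \<Rightarrow> (pt \<Rightarrow> 'a) \<Rightarrow> pt \<Rightarrow> 'a" where
  "shift \<epsilon> k f = (\<lambda>p. f (p(X := p X + of_int k * \<epsilon>)))"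

(* eps times the partial derivative in direction i, entry by entry *)
definition eder :: "real \<Rightarrow> coord \<Rightarrow> sfun \<Rightarrow> sfun" where
  "eder \<epsilon> i f = (\<lambda>p. scal (of_real \<epsilon>) * mk_s2 (partial i (ent0 \<circ> f) p) (partial i (ent1 \<circ> f) p))"


section \<open>Formal operators\<close>

(* An operator A stands for the formal sum of A k m (eps d/dx)^m Lambda^k over integers k and
   naturals m; the sum over k may be infinite in both directions.  Sums, differences and
   negatives of operators are the pointwise ones of Function_Algebras.  The pointwise product and
   1 are not the operator product and the identity: those are op_mult and op_id. *)
type_synonym op = "int \<Rightarrow> nat \<Rightarrow> sfun"

definition op_fun :: "sfun \<Rightarrow> op" where
  "op_fun f = (\<lambda>k m. if k = 0 \<and> m = 0 then f else 0)"

definition op_id :: op where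
  "op_id = op_fun 1"

definition Lam :: "int \<Rightarrow> op" where
  "Lam n = (\<lambda>k m. if k = n \<and> m = 0 then 1 else 0)"

definition op_edx :: op where
  "op_edx = (\<lambda>k m. if k = 0 \<and> m = 1 then 1 else 0)"

(* Composition, by the Leibniz rule
     a D^m Lambda^k o b D^s Lambda^l
       = sum over i <= m of (m choose i) a Lambda^k(D^i b) D^(m - i + s) Lambda^(k + l),
   with D = eps d/dx.  The coefficient of D^r Lambda^n collects l = n - k and s = r + i - m.  It
   is meaningful only if just finitely many terms contribute, which is the case for all
   products formed below. *)
definition op_mult :: "op \<Rightarrow> real \<Rightarrow> op \<Rightarrow> op" ("(_ \<odot>\<^bsub>_\<^esub> _)" [70, 0, 71] 70) where
  "A \<odot>\<^bsub>\<epsilon>\<^esub> B = (\<lambda>n r.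
     \<Sum>(k, m, i) \<in> {(k, m, i). i \<le> m \<and> m \<le> r + i \<and> A k m \<noteq> 0 \<and> B (n - k) (r + i - m) \<noteq> 0}.
       of_nat (m choose i) * A k m * shift \<epsilon> k ((eder \<epsilon> X ^^ i) (B (n - k) (r + i - m))))"

primrec op_pow :: "real \<Rightarrow> op \<Rightarrow> nat \<Rightarrow> op" where
  "op_pow \<epsilon> A 0 = op_id"
| "op_pow \<epsilon> A (Suc n) = A \<odot>\<^bsub>\<epsilon>\<^esub> op_pow \<epsilon> A n"

definition op_scale :: "complex \<Rightarrow> op \<Rightarrow> op" where
  "op_scale c A = (\<lambda>k m p. scal c * A k m p)"

definition op_plus :: "op \<Rightarrow> op" where
  "op_plus A = (\<lambda>k m. if k \<ge> 0 then A k m else 0)"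

definition op_minus :: "op \<Rightarrow> op" where
  "op_minus A = (\<lambda>k m. if k < 0 then A k m else 0)"

definition op_comm :: "real \<Rightarrow> op \<Rightarrow> op \<Rightarrow> op" where
  "op_comm \<epsilon> A B = A \<odot>\<^bsub>\<epsilon>\<^esub> B - B \<odot>\<^bsub>\<epsilon>\<^esub> A"

(* eps times the derivative of the coefficients, for a time variable i *)
definition op_eder :: "real \<Rightarrow> coord \<Rightarrow> op \<Rightarrow> op" where
  "op_eder \<epsilon> i A = (\<lambda>k m. eder \<epsilon> i (A k m))"

(* meaningful for operators with finitely many nonzero coefficients *)
definition op_apply :: "real \<Rightarrow> op \<Rightarrow> sfun \<Rightarrow> sfun" where
  "op_apply \<epsilon> A f = (\<Sum>(k, m) \<in> {(k, m). A k m \<noteq> 0}. A k m * shift \<epsilon> k ((eder \<epsilon> X ^^ m) f))"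

(* The inverse expanded towards negative, respectively positive, powers of Lambda.  In each case
   the inverse is unique where it is used: the leading coefficient is an invertible function. *)
definition inv_down :: "real \<Rightarrow> op \<Rightarrow> op" where
  "inv_down \<epsilon> A = (THE B. (\<exists>N. \<forall>k>N. \<forall>m. B k m = 0) \<and> A \<odot>\<^bsub>\<epsilon>\<^esub> B = op_id \<and> B \<odot>\<^bsub>\<epsilon>\<^esub> A = op_id)"

definition inv_up :: "real \<Rightarrow> op \<Rightarrow> op" where
  "inv_up \<epsilon> A = (THE B. (\<exists>N. \<forall>k<N. \<forall>m. B k m = 0) \<and> A \<odot>\<^bsub>\<epsilon>\<^esub> B = op_id \<and> B \<odot>\<^bsub>\<epsilon>\<^esub> A = op_id)"


section \<open>The hierarchy\<close>

definition dressing :: "op \<Rightarrow> bool" where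
  "dressing P \<longleftrightarrow> P 0 0 = 1 \<and> (\<forall>k m. k > 0 \<or> m > 0 \<longrightarrow> P k m = 0) \<and> (\<forall>k. smooth_fun (P k 0))"

definition dressing_bar :: "op \<Rightarrow> bool" where
  "dressing_bar Q \<longleftrightarrow> pointwise_invertible (Q 0 0) \<and>
     (\<forall>k m. k < 0 \<or> m > 0 \<longrightarrow> Q k m = 0) \<and> (\<forall>k. smooth_fun (Q k 0))"

definition lax :: "real \<Rightarrow> op \<Rightarrow> op" where
  "lax \<epsilon> P = P \<odot>\<^bsub>\<epsilon>\<^esub> Lam 1 \<odot>\<^bsub>\<epsilon>\<^esub> inv_down \<epsilon> P"

definition lax_bar :: "real \<Rightarrow> op \<Rightarrow> op" where
  "lax_bar \<epsilon> Q = Q \<odot>\<^bsub>\<epsilon>\<^esub> Lam (- 1) \<odot>\<^bsub>\<epsilon>\<^esub> inv_up \<epsilon> Q"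

definition log_plus :: "real \<Rightarrow> op \<Rightarrow> op" where
  "log_plus \<epsilon> P = P \<odot>\<^bsub>\<epsilon>\<^esub> op_edx \<odot>\<^bsub>\<epsilon>\<^esub> inv_down \<epsilon> P"

definition log_minus :: "real \<Rightarrow> op \<Rightarrow> op" where
  "log_minus \<epsilon> Q = - (Q \<odot>\<^bsub>\<epsilon>\<^esub> op_edx \<odot>\<^bsub>\<epsilon>\<^esub> inv_up \<epsilon> Q)"

definition B_op :: "real \<Rightarrow> op \<Rightarrow> nat \<Rightarrow> op" where
  "B_op \<epsilon> L j = op_scale (1 / fact (j + 1)) (op_pow \<epsilon> L (j + 1))"

(* lp and lm are the two logarithms; c_j is the harmonic number harm j *)
definition F_op :: "real \<Rightarrow> op \<Rightarrow> op \<Rightarrow> op \<Rightarrow> nat \<Rightarrow> op" where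
  "F_op \<epsilon> L lp lm j = op_scale (2 / fact j)
     (op_pow \<epsilon> L j \<odot>\<^bsub>\<epsilon>\<^esub> (op_scale (1 / 2) (lp + lm) - op_scale (harm j) op_id))"

definition sceth_solution :: "real \<Rightarrow> op \<Rightarrow> op \<Rightarrow> bool" where
  "sceth_solution \<epsilon> P Q \<longleftrightarrow>
     dressing P \<and> dressing_bar Q \<and> lax \<epsilon> P = lax_bar \<epsilon> Q \<and>
     (\<forall>j. let B = B_op \<epsilon> (lax \<epsilon> P) j;
              F = F_op \<epsilon> (lax \<epsilon> P) (log_plus \<epsilon> P) (log_minus \<epsilon> Q) j
          in op_eder \<epsilon> (T j) P = - (op_minus B \<odot>\<^bsub>\<epsilon>\<^esub> P) \<and>
             op_eder \<epsilon> (T j) Q = op_plus B \<odot>\<^bsub>\<epsilon>\<^esub> Q \<and>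
             op_eder \<epsilon> (Y j) P = - (op_minus F \<odot>\<^bsub>\<epsilon>\<^esub> P) \<and>
             op_eder \<epsilon> (Y j) Q = op_plus F \<odot>\<^bsub>\<epsilon>\<^esub> Q)"

definition first_wave :: "real \<Rightarrow> op \<Rightarrow> op \<Rightarrow> complex \<Rightarrow> sfun \<Rightarrow> bool" where
  "first_wave \<epsilon> P Q z \<phi> \<longleftrightarrow> smooth_fun \<phi> \<and>
     op_apply \<epsilon> (lax \<epsilon> P) \<phi> = (\<lambda>p. scal z * \<phi> p) \<and>
     (\<forall>j. let L = lax \<epsilon> P;
              F = F_op \<epsilon> L (log_plus \<epsilon> P) (log_minus \<epsilon> Q) j
          in eder \<epsilon> (T j) \<phi> = op_apply \<epsilon> (op_plus (B_op \<epsilon> L j)) \<phi> \<and>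
             eder \<epsilon> (Y j) \<phi> = op_apply \<epsilon>
               (op_scale (1 / fact j)
                  (op_pow \<epsilon> L j \<odot>\<^bsub>\<epsilon>\<^esub> (log_plus \<epsilon> P - op_scale (harm j) op_id))
                - op_minus F) \<phi>)"

definition darboux :: "real \<Rightarrow> sfun \<Rightarrow> op" where
  "darboux \<epsilon> \<phi> = op_id - op_fun (\<lambda>p. \<phi> p * s2_inv (shift \<epsilon> (- 1) \<phi> p)) \<odot>\<^bsub>\<epsilon>\<^esub> Lam (- 1)"

definition lax_form :: "real \<Rightarrow> sfun \<Rightarrow> sfun \<Rightarrow> op" where
  "lax_form \<epsilon> u v = Lam 1 + op_fun u + op_fun v \<odot>\<^bsub>\<epsilon>\<^esub> Lam (- 1)"

end

(* A difference operator that annihilates the invertible function phi is divisible on the right by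
   W = phi (1 - Lambda^(-1)) phi^(-1).  Applied to W L this gives L1 W = W L with L1 finite, so that
   both expansions of W^(-1) give the same L1.

   For a flow with generator G, everything reduces to dW + W G_+ = G1_+ W (equivalently
   dW - W G_- = - G1_- W), which is the Sato equation for W P and for W Q Lambda.  The wave equation
   reads d phi = M phi with M = E + g (eps d/dx).  Since W phi = 0, the operator
   dW + W E - g1 W_x, where g1 W = W g, annihilates phi and therefore equals C W.  Rewriting it with
   M = G^+ - G_- and with M = G_+ - G^-, where G = G^+ + G^- is the decomposition into the parts
   coming from log_+ and log_-, and multiplying by the two inverses of W determines the coefficients
   of C at nonnegative and at negative powers of Lambda. *)

theory Submission
  imports Defs
begin

section \<open>Smooth coefficient functions\<close>

text \<open>The obstacle is that the generators F_j of the y-flows are infinite in both directions: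
  log_+ L is expanded towards negative powers of Lambda, log_- L towards positive ones. Such a
  series cannot be multiplied with P or Q, and associativity fails where the two directions meet;
  the two expansions of W^(-1) are different operators. Hence the two halves of F_j are kept apart,
  every product with an infinite series is formed inside one direction, and only finite operators
  (W, L, L1, their powers, C) pass from one direction to the other.

  The logarithms contain eps d/dx with opposite signs, so F_j itself is a pure difference operator.
  In the wave equation eps d/dx survives, with g = L^j / j!, so that g1 = L1^j / j!. Moving eps d/dx
  past W costs W_x: the remaining parts of log_+ and log_- are intertwined by W only up to - W_x and
  + W_x. Multiplied by g1, these defects match the term g1 W_x subtracted in the equation for C W,
  and they cancel in the sum of the two halves.\<close>

lemma shift_shift [simp]: "shift \<epsilon> k (shift \<epsilon> l f) = shift \<epsilon> (k + l) f"
  by (simp add: shift_def algebra_simps)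

lemma shift_0 [simp]: "shift \<epsilon> 0 f = f"
  by (simp add: shift_def)

lemma shift_const: "shift \<epsilon> k (\<lambda>p. c) = (\<lambda>p. c)"
  by (simp add: shift_def)

lemma shift_hom [simp]:
  "shift \<epsilon> k 0 = 0" "shift \<epsilon> k 1 = 1"
  "shift \<epsilon> k (f + g) = shift \<epsilon> k f + shift \<epsilon> k g"
  "shift \<epsilon> k (f - g) = shift \<epsilon> k f - shift \<epsilon> k g"
  "shift \<epsilon> k (f * g) = shift \<epsilon> k f * shift \<epsilon> k g"
  "shift \<epsilon> k (- f) = - shift \<epsilon> k f"
  by (simp_all add: shift_def fun_eq_iff)

lemma shift_sum:
  fixes f :: "'b \<Rightarrow> pt \<Rightarrow> 'a :: comm_ring_1"
  shows "shift \<epsilon> k (sum f A) = (\<Sum>i\<in>A. shift \<epsilon> k (f i))"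
  by (induction A rule: infinite_finite_induct) (auto simp del: plus_fun_apply zero_fun_apply)

section \<open>Continuity in finitely many variables at a time\<close>

lemma fin_continuous_const: "fin_continuous (\<lambda>p. c)"
  by (simp add: fin_continuous_def)

lemma fin_continuous_add:
  assumes "fin_continuous f" "fin_continuous g"
  shows "fin_continuous (f + g)"
  using assms by (auto simp: fin_continuous_def intro!: continuous_on_add)

lemma fin_continuous_mult:
  assumes "fin_continuous f" "fin_continuous g"
  shows "fin_continuous (f * g)"
  using assms by (auto simp: fin_continuous_def intro!: continuous_on_mult)

lemma fin_continuous_inverse:
  assumes "fin_continuous f" "\<And>p. f p \<noteq> 0"
  shows "fin_continuous (\<lambda>p. inverse (f p))"
  using assms by (auto simp: fin_continuous_def intro!: continuous_on_inverse)

lemma fin_continuous_shift: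
  assumes "fin_continuous f"
  shows "fin_continuous (shift \<epsilon> k f)"
  unfolding fin_continuous_def
proof (intro allI impI)
  fix S :: "coord set" and p :: pt
  assume S: "finite S"
  let ?c = "of_int k * \<epsilon>"
  have cont: "continuous_on UNIV (\<lambda>q. f (override_on r q S))" for r
    using assms S by (simp add: fin_continuous_def)
  show "continuous_on UNIV (\<lambda>q. shift \<epsilon> k f (override_on p q S))"
  proof (cases "X \<in> S")
    case True
    have c: "continuous_on UNIV (\<lambda>q::pt. q(X := q X + ?c))"
    proof (rule continuous_on_coordinatewise_then_product)
      show "continuous_on UNIV (\<lambda>q::pt. (q(X := q X + ?c)) i)" for i
        by (cases "i = X") (auto intro!: continuous_intros)
    qed
    have "continuous_on UNIV ((\<lambda>q. f (override_on p q S)) \<circ> (\<lambda>q::pt. q(X := q X + ?c)))"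
      by (rule continuous_on_compose[OF c continuous_on_subset[OF cont]]) simp
    also have "(\<lambda>q. f (override_on p q S)) \<circ> (\<lambda>q::pt. q(X := q X + ?c))
        = (\<lambda>q. shift \<epsilon> k f (override_on p q S))"
      using True by (auto simp: shift_def fun_eq_iff override_on_def intro!: arg_cong[of _ _ f])
    finally show ?thesis .
  next
    case False
    then have "(\<lambda>q. shift \<epsilon> k f (override_on p q S))
        = (\<lambda>q. f (override_on (p(X := p X + ?c)) q S))"
      by (auto simp: shift_def fun_eq_iff override_on_def intro!: arg_cong[of _ _ f])
    then show ?thesis using cont[of "p(X := p X + ?c)"] by (simp only:)
  qed
qed

section \<open>Partial derivatives along one coordinate\<close>

definition differentiable_along :: "coord \<Rightarrow> (pt \<Rightarrow> complex) \<Rightarrow> bool" where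
  "differentiable_along i f \<longleftrightarrow> (\<forall>p. (\<lambda>s. f (p(i := s))) differentiable (at (p i)))"

lemma has_partial:
  "differentiable_along i f \<Longrightarrow>
    ((\<lambda>s. f (p(i := s))) has_vector_derivative partial i f p) (at (p i))"
  by (auto simp: differentiable_along_def partial_def vector_derivative_works)

lemma partialI:
  assumes "\<And>p. ((\<lambda>s. f (p(i := s))) has_vector_derivative f' p) (at (p i))"
  shows "differentiable_along i f" "partial i f = f'"
  using assms by (auto simp: differentiable_along_def partial_def fun_eq_iff
      intro: vector_derivative_at differentiableI_vector)

lemma partial_const: "differentiable_along i (\<lambda>p. c)" "partial i (\<lambda>p. c) = (\<lambda>p. 0)"
  using partialI[of "\<lambda>p. c" i "\<lambda>p. 0"] by simp_all

lemma partial_add: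
  assumes "differentiable_along i f" "differentiable_along i g"
  shows "differentiable_along i (f + g)" "partial i (f + g) = partial i f + partial i g"
proof -
  have "((\<lambda>s. (f + g) (p(i := s))) has_vector_derivative
      (partial i f + partial i g) p) (at (p i))" for p
    unfolding plus_fun_apply by (intro has_vector_derivative_add has_partial assms)
  then show "differentiable_along i (f + g)" "partial i (f + g) = partial i f + partial i g"
    by (rule partialI)+
qed

lemma partial_mult:
  assumes "differentiable_along i f" "differentiable_along i g"
  shows "differentiable_along i (f * g)" "partial i (f * g) = f * partial i g + partial i f * g"
proof -
  have "((\<lambda>s. (f * g) (p(i := s))) has_vector_derivative
      (f * partial i g + partial i f * g) p) (at (p i))" for p
    using has_vector_derivative_mult[OF has_partial[OF assms(1)] has_partial[OF assms(2)], of p p]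
    by simp
  then show "differentiable_along i (f * g)" "partial i (f * g) = f * partial i g + partial i f * g"
    by (rule partialI)+
qed

text \<open>The derivative is written as a product of functions, with a constant function for the
  sign, so that \<open>Ck_const\<close> and \<open>Ck_mult\<close> apply to it in
  \<open>Ck_inverse\<close>.\<close>

lemma partial_inverse:
  assumes "differentiable_along i f" "\<And>p. f p \<noteq> 0"
  shows "differentiable_along i (\<lambda>p. inverse (f p))"
    "partial i (\<lambda>p. inverse (f p)) = (\<lambda>p. - 1) * (partial i f * ((\<lambda>p. inverse (f p)) * (\<lambda>p. inverse
        (f p))))"
proof -
  have "((\<lambda>s. inverse (f (p(i := s)))) has_vector_derivative
      ((\<lambda>p. - 1) * (partial i f * ((\<lambda>p. inverse (f p)) * (\<lambda>p. inverse (f p))))) p) (at (p i))" for p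
  proof -
    have "(inverse has_field_derivative - (inverse (f p) ^ Suc (Suc 0)))
        (at (f (p(i := p i))))"
      using DERIV_inverse[of "f p" UNIV] assms(2)[of p] by simp
    from field_vector_diff_chain_at[OF has_partial[OF assms(1), of p] this]
    show ?thesis by (simp add: o_def fun_upd_def)
  qed
  then show "differentiable_along i (\<lambda>p. inverse (f p))"
    "partial i (\<lambda>p. inverse (f p)) = (\<lambda>p. - 1) * (partial i f * ((\<lambda>p. inverse (f p)) * (\<lambda>p. inverse
        (f p))))"
    by (rule partialI)+
qed

text \<open>For \<open>i = X\<close> this is the chain rule for a translation; for any other
  coordinate the two updates of the point commute.\<close>

lemma partial_shift:
  assumes "differentiable_along i f"
  shows "differentiable_along i (shift \<epsilon> k f)"
    "partial i (shift \<epsilon> k f) = shift \<epsilon> k (partial i f)"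
proof -
  let ?c = "of_int k * \<epsilon>"
  have "((\<lambda>s. shift \<epsilon> k f (p(i := s))) has_vector_derivative shift \<epsilon> k (partial i f) p) (at (p i))"
      for p
  proof (cases "i = X")
    case True
    have "((\<lambda>s. f (p(X := s))) has_vector_derivative partial X f (p(X := p X + ?c))) (at (p X +
        ?c))"
      using has_partial[OF assms, of "p(X := p X + ?c)"] True by simp
    moreover have "((\<lambda>s. s + ?c) has_vector_derivative 1) (at (p X))"
      by (auto intro!: derivative_eq_intros)
    ultimately have "((\<lambda>s. f (p(X := s))) \<circ> (\<lambda>s. s + ?c) has_vector_derivative
        1 *\<^sub>R partial X f (p(X := p X + ?c))) (at (p X))"
      by (intro vector_diff_chain_at) auto
    then show ?thesis using True by (simp add: shift_def o_def)
  next
    case False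
    then show ?thesis
      using has_partial[OF assms, of "p(X := p X + ?c)"] by (simp add: shift_def fun_upd_twist)
  qed
  then show "differentiable_along i (shift \<epsilon> k f)"
    "partial i (shift \<epsilon> k f) = shift \<epsilon> k (partial i f)"
    by (rule partialI)+
qed

section \<open>The classes C^k and smooth functions with values in the coefficient algebra\<close>

lemma Ck_Suc: "Ck (Suc n) f \<longleftrightarrow>
    fin_continuous f \<and> (\<forall>i. differentiable_along i f \<and> Ck n (partial i f))"
  by (auto simp: differentiable_along_def)

lemma Ck_SucD: "Ck (Suc n) f \<Longrightarrow> Ck n f"
proof (induction n arbitrary: f)
  case 0
  then show ?case by simp
next
  case (Suc n)
  then show ?case unfolding Ck_Suc[of "Suc n"] Ck_Suc[of n] by blast
qed

lemma Ck_const: "Ck n (\<lambda>p. c)"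
  by (induction n arbitrary: c)
     (auto simp del: Ck.simps(2) simp: Ck_Suc fin_continuous_const partial_const)

lemma Ck_add: "Ck n f \<Longrightarrow> Ck n g \<Longrightarrow> Ck n (f + g)"
  by (induction n arbitrary: f g)
     (auto simp del: Ck.simps(2) simp: Ck_Suc fin_continuous_add partial_add)

lemma Ck_mult: "Ck n f \<Longrightarrow> Ck n g \<Longrightarrow> Ck n (f * g)"
proof (induction n arbitrary: f g)
  case 0
  then show ?case by (simp add: fin_continuous_mult del: times_fun_apply)
next
  case (Suc n)
  then show ?case using Ck_SucD[OF Suc.prems(1)] Ck_SucD[OF Suc.prems(2)]
    unfolding Ck_Suc by (auto simp: fin_continuous_mult partial_mult intro!: Ck_add simp del:
        times_fun_apply)
qed

text \<open>The induction keeps \<open>f\<close> fixed: the derivative of 1/f involves only f' and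
  1/f, and 1/f is of class n by the induction hypothesis.\<close>

lemma Ck_inverse: "Ck n f \<Longrightarrow> (\<And>p. f p \<noteq> 0) \<Longrightarrow> Ck n (\<lambda>p. inverse (f p))"
proof (induction n)
  case 0
  then show ?case by (simp add: fin_continuous_inverse)
next
  case (Suc n)
  then show ?case using Ck_SucD[OF Suc.prems(1)]
    unfolding Ck_Suc
    by (auto simp: fin_continuous_inverse partial_inverse intro!: Ck_mult Ck_const)
qed

lemma Ck_shift: "Ck n f \<Longrightarrow> Ck n (shift \<epsilon> k f)"
  by (induction n arbitrary: f)
     (auto simp del: Ck.simps(2) simp: Ck_Suc fin_continuous_shift partial_shift)

lemma smooth_funD:
  assumes "smooth_fun f"
  shows "differentiable_along i (ent0 \<circ> f)" "differentiable_along i (ent1 \<circ> f)"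
  using assms unfolding smooth_fun_def by (meson Ck_Suc)+

lemma ent_comp:
  "ent0 \<circ> (f + g) = (ent0 \<circ> f) + (ent0 \<circ> g)"
  "ent1 \<circ> (f + g) = (ent1 \<circ> f) + (ent1 \<circ> g)"
  "ent0 \<circ> (f * g) = (ent0 \<circ> f) * (ent0 \<circ> g) + (ent1 \<circ> f) * (ent1 \<circ> g)"
  "ent1 \<circ> (f * g) = (ent0 \<circ> f) * (ent1 \<circ> g) + (ent1 \<circ> f) * (ent0 \<circ> g)"
  "ent0 \<circ> (\<lambda>p. c) = (\<lambda>p. ent0 c)" "ent1 \<circ> (\<lambda>p. c) = (\<lambda>p. ent1 c)"
  "ent0 \<circ> shift \<epsilon> k f = shift \<epsilon> k (ent0 \<circ> f)" "ent1 \<circ> shift \<epsilon> k f = shift \<epsilon> k (ent1 \<circ> f)"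
  by (auto simp: fun_eq_iff shift_def)

lemma smooth_fun_const: "smooth_fun (\<lambda>p. c)"
  by (simp add: smooth_fun_def ent_comp Ck_const)

lemma smooth_fun_add: "smooth_fun f \<Longrightarrow> smooth_fun g \<Longrightarrow> smooth_fun (f + g)"
  unfolding smooth_fun_def ent_comp by (auto intro!: Ck_add)

lemma smooth_fun_mult: "smooth_fun f \<Longrightarrow> smooth_fun g \<Longrightarrow> smooth_fun (f * g)"
  unfolding smooth_fun_def ent_comp by (auto intro!: Ck_add Ck_mult)

lemma smooth_fun_shift: "smooth_fun f \<Longrightarrow> smooth_fun (shift \<epsilon> k f)"
  unfolding smooth_fun_def ent_comp by (blast intro: Ck_shift)

lemma smooth_fun_0: "smooth_fun 0" and smooth_fun_1: "smooth_fun 1"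
  using smooth_fun_const[of 0] smooth_fun_const[of 1] by (simp_all add: zero_fun_def one_fun_def)

lemma smooth_fun_uminus: "smooth_fun f \<Longrightarrow> smooth_fun (- f)"
  using smooth_fun_mult[OF smooth_fun_const[of "- 1"], of f]
  by (simp add: fun_Compl_def times_fun_def)

lemma smooth_fun_diff: "smooth_fun f \<Longrightarrow> smooth_fun g \<Longrightarrow> smooth_fun (f - g)"
  using smooth_fun_add[OF _ smooth_fun_uminus, of f g] by simp

lemma smooth_fun_sum: "(\<And>i. i \<in> A \<Longrightarrow> smooth_fun (f i)) \<Longrightarrow> smooth_fun (sum f A)"
  by (induction A rule: infinite_finite_induct) (auto simp: smooth_fun_0 smooth_fun_add)

lemma smooth_fun_eder:
  assumes "smooth_fun f"
  shows "smooth_fun (eder \<epsilon> i f)"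
proof -
  have "Ck n (partial i (ent0 \<circ> f)) \<and> Ck n (partial i (ent1 \<circ> f))" for n
    using assms unfolding smooth_fun_def by (meson Ck_Suc)
  then have "smooth_fun (\<lambda>p. mk_s2 (partial i (ent0 \<circ> f) p) (partial i (ent1 \<circ> f) p))"
    by (simp add: smooth_fun_def o_def)
  from smooth_fun_mult[OF smooth_fun_const[of "scal (of_real \<epsilon>)"] this]
  show ?thesis by (simp add: eder_def times_fun_def)
qed

lemmas smooth_fun_intros = smooth_fun_0 smooth_fun_1 smooth_fun_const smooth_fun_add
  smooth_fun_mult smooth_fun_shift smooth_fun_uminus smooth_fun_diff smooth_fun_sum smooth_fun_eder

lemma eder_const [simp]: "eder \<epsilon> i (\<lambda>p. c) = 0"
  by (simp add: eder_def ent_comp partial_const fun_eq_iff s2_eq_iff scal_def)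

lemma eder_0 [simp]: "eder \<epsilon> i 0 = 0" and eder_1 [simp]: "eder \<epsilon> i 1 = 0"
  using eder_const[of \<epsilon> i 0] eder_const[of \<epsilon> i 1] by (simp_all add: zero_fun_def one_fun_def)

lemma eder_add: "smooth_fun f \<Longrightarrow> smooth_fun g \<Longrightarrow>
    eder \<epsilon> i (f + g) = eder \<epsilon> i f + eder \<epsilon> i g"
  unfolding eder_def ent_comp
  by (simp add: partial_add smooth_funD fun_eq_iff s2_eq_iff scal_def algebra_simps)

lemma eder_mult: "smooth_fun f \<Longrightarrow> smooth_fun g \<Longrightarrow>
    eder \<epsilon> i (f * g) = eder \<epsilon> i f * g + f * eder \<epsilon> i g"
  unfolding eder_def ent_comp
  by (simp add: partial_add partial_mult smooth_funD fun_eq_iff s2_eq_iff scal_def algebra_simps)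

lemma eder_shift: "smooth_fun f \<Longrightarrow> eder \<epsilon> i (shift \<epsilon> k f) = shift \<epsilon> k (eder \<epsilon> i f)"
  unfolding eder_def ent_comp
  by (simp add: partial_shift smooth_funD fun_eq_iff) (simp add: shift_def)

lemma eder_sum: "(\<And>k. k \<in> A \<Longrightarrow> smooth_fun (f k)) \<Longrightarrow>
    eder \<epsilon> i (sum f A) = (\<Sum>k\<in>A. eder \<epsilon> i (f k))"
  by (induction A rule: infinite_finite_induct) (auto simp: eder_add smooth_fun_sum)

section \<open>Inverses in the coefficient algebra and of its functions\<close>

lemma s2_inv_unique:
  assumes "x * y = 1"
  shows "s2_inv x = y" "invertible (to_mat x)"
proof -
  have "to_mat x ** to_mat y = mat 1" "to_mat y ** to_mat x = mat 1"
    using assms mult.commute[of x y] by (metis one_s2.rep_eq times_s2.rep_eq)+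
  then show inv: "invertible (to_mat x)" by (auto simp: invertible_def)
  show "s2_inv x = y"
    using assms s2_inv_right[OF inv] by (metis mult.assoc mult.commute mult_1)
qed

text \<open>The quantity on the right is the determinant. One direction uses its multiplicativity,
  written out as a polynomial identity, the other the adjugate divided by the determinant.\<close>

lemma invertible_to_mat_iff: "invertible (to_mat x) \<longleftrightarrow> ent0 x ^ 2 - ent1 x ^ 2 \<noteq> 0"
proof
  assume "invertible (to_mat x)"
  from s2_inv_right[OF this] obtain y where "x * y = 1" by blast
  then have e: "ent0 x * ent0 y + ent1 x * ent1 y = 1" "ent0 x * ent1 y + ent1 x * ent0 y = 0"
    by (auto simp: s2_eq_iff)
  have "(ent0 x ^ 2 - ent1 x ^ 2) * (ent0 y ^ 2 - ent1 y ^ 2) =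
      (ent0 x * ent0 y + ent1 x * ent1 y) ^ 2 - (ent0 x * ent1 y + ent1 x * ent0 y) ^ 2"
    by algebra
  with e show "ent0 x ^ 2 - ent1 x ^ 2 \<noteq> 0" by auto
next
  assume nz: "ent0 x ^ 2 - ent1 x ^ 2 \<noteq> 0"
  let ?d = "ent0 x ^ 2 - ent1 x ^ 2"
  have "x * mk_s2 (ent0 x / ?d) (- ent1 x / ?d) = 1"
    using nz by (simp add: s2_eq_iff power2_eq_square flip: diff_divide_distrib)
  then show "invertible (to_mat x)" by (rule s2_inv_unique)
qed

lemma s2_inv_eq:
  assumes "invertible (to_mat x)"
  shows "s2_inv x = mk_s2 (ent0 x * inverse (ent0 x ^ 2 - ent1 x ^ 2))
    (- ent1 x * inverse (ent0 x ^ 2 - ent1 x ^ 2))"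
proof (rule s2_inv_unique)
  show "x * mk_s2 (ent0 x * inverse (ent0 x ^ 2 - ent1 x ^ 2))
    (- ent1 x * inverse (ent0 x ^ 2 - ent1 x ^ 2)) = 1"
    using assms unfolding invertible_to_mat_iff
    by (simp add: s2_eq_iff power2_eq_square divide_inverse[symmetric] flip: diff_divide_distrib)
qed

definition fun_inv :: "sfun \<Rightarrow> sfun" where
  "fun_inv f = (\<lambda>p. s2_inv (f p))"

lemma fun_inv_right: "pointwise_invertible f \<Longrightarrow> f * fun_inv f = 1"
  by (simp add: fun_inv_def pointwise_invertible_def fun_eq_iff s2_inv_right)

lemma fun_inv_left: "pointwise_invertible f \<Longrightarrow> fun_inv f * f = 1"
  using fun_inv_right by (metis mult.commute)

lemma pointwise_invertibleI: "f * g = 1 \<Longrightarrow> pointwise_invertible f"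
  unfolding pointwise_invertible_def
  by (metis one_fun_apply s2_inv_unique(2) times_fun_apply)

lemma shift_fun_inv: "shift \<epsilon> k (fun_inv f) = fun_inv (shift \<epsilon> k f)"
  by (simp add: fun_inv_def shift_def)

lemma pointwise_invertible_shift: "pointwise_invertible f \<Longrightarrow> pointwise_invertible (shift \<epsilon> k f)"
  by (simp add: pointwise_invertible_def shift_def)

lemma smooth_fun_inv:
  assumes "smooth_fun f" "pointwise_invertible f"
  shows "smooth_fun (fun_inv f)"
proof -
  let ?a = "ent0 \<circ> f" and ?b = "ent1 \<circ> f"
  \<comment> \<open>The determinant is assembled from sums, products and a constant, the operations
    for which closure of \<open>Ck\<close> is available.\<close>
  let ?d = "?a * ?a + (\<lambda>p. - 1) * (?b * ?b)"
  have ab: "Ck n ?a" "Ck n ?b" for n using assms(1) by (auto simp: smooth_fun_def)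
  have d: "Ck n ?d" for n by (intro Ck_add Ck_mult Ck_const ab)
  have "?d p \<noteq> 0" for p
    using assms(2) by (simp add: pointwise_invertible_def invertible_to_mat_iff power2_eq_square)
  then have i: "Ck n (\<lambda>p. inverse (?d p))" for n by (intro Ck_inverse d)
  have "ent0 \<circ> fun_inv f = ?a * (\<lambda>p. inverse (?d p))"
    "ent1 \<circ> fun_inv f = (\<lambda>p. - 1) * ?b * (\<lambda>p. inverse (?d p))"
    using assms(2) by (auto simp: fun_inv_def pointwise_invertible_def s2_inv_eq fun_eq_iff
        power2_eq_square)
  then show ?thesis unfolding smooth_fun_def by (simp only:) (intro allI conjI Ck_mult Ck_const ab
      i)
qed

section \<open>Difference operators\<close>

text \<open>Operators free of eps d/dx. Everything in the hierarchy has order at most one in eps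
  d/dx, so the calculations take place here, where the product is a twisted convolution, and return
  to \<open>op\<close> through \<open>op1\<close>.\<close>

type_synonym dop = "int \<Rightarrow> sfun"

definition dmono :: "sfun \<Rightarrow> int \<Rightarrow> dop" where
  "dmono f n = (\<lambda>k. if k = n then f else 0)"

abbreviation lam :: "int \<Rightarrow> dop" where "lam n \<equiv> dmono 1 n"

abbreviation unit_op :: dop where "unit_op \<equiv> lam 0"

abbreviation dir_sign :: "bool \<Rightarrow> int" where "dir_sign d \<equiv> (if d then 1 else - 1)"

(* The exponents are at most N if d = True, at least - N if d = False. *)
definition bounded_by :: "bool \<Rightarrow> int \<Rightarrow> dop \<Rightarrow> bool" where
  "bounded_by d N a \<longleftrightarrow> (\<forall>k. a k \<noteq> 0 \<longrightarrow> dir_sign d * k \<le> N)"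

definition half_bounded :: "bool \<Rightarrow> dop \<Rightarrow> bool" where
  "half_bounded d a \<longleftrightarrow> (\<exists>N. bounded_by d N a)"

definition finite_op :: "dop \<Rightarrow> bool" where
  "finite_op a \<longleftrightarrow> half_bounded True a \<and> half_bounded False a"

definition dscale :: "complex \<Rightarrow> dop \<Rightarrow> dop" where
  "dscale c a = (\<lambda>k. (\<lambda>p. scal c) * a k)"

definition smooth_op :: "dop \<Rightarrow> bool" where
  "smooth_op a \<longleftrightarrow> (\<forall>k. smooth_fun (a k))"

text \<open>This guards the algebraic laws: a \<open>sum\<close> over an infinite index set is 0 by
  convention, and with such default values distributivity and the Leibniz rule would fail.\<close>

definition multipliable :: "dop \<Rightarrow> dop \<Rightarrow> bool" where
  "multipliable a b \<longleftrightarrow> (\<forall>n. finite {k. a k \<noteq> 0 \<and> b (n - k) \<noteq> 0})"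

section \<open>Bounds on the exponents\<close>

lemma bdI: "(\<And>k. N < dir_sign d * k \<Longrightarrow> a k = 0) \<Longrightarrow> bounded_by d N a"
  unfolding bounded_by_def by (meson not_le)

lemma bdD: "bounded_by d N a \<Longrightarrow> N < dir_sign d * k \<Longrightarrow> a k = 0"
  unfolding bounded_by_def by (meson not_le)

lemma bounded_by_half_bounded: "bounded_by d N a \<Longrightarrow> half_bounded d a"
  by (auto simp: half_bounded_def)

lemma bounded_by_mono: "bounded_by d M a \<Longrightarrow> M \<le> N \<Longrightarrow> bounded_by d N a"
  unfolding bounded_by_def by (meson order_trans)

text \<open>The reason why two series bounded in the same direction can be multiplied: only finitely
  many ways of splitting the exponent \<open>n\<close> respect both bounds.\<close>

lemma finite_bounds: "finite {k. dir_sign d * k \<le> M \<and> dir_sign d * (n - k) \<le> N}"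
proof (cases d)
  case True
  then have "{k. dir_sign d * k \<le> M \<and> dir_sign d * (n - k) \<le> N} \<subseteq> {n - N..M}" by auto
  then show ?thesis by (rule finite_subset) simp
next
  case False
  then have "{k. dir_sign d * k \<le> M \<and> dir_sign d * (n - k) \<le> N} \<subseteq> {- M..n + N}" by auto
  then show ?thesis by (rule finite_subset) simp
qed

lemma multipliable_half_bounded: assumes "half_bounded d a" "half_bounded d b" shows
    "multipliable a b"
proof -
  obtain M N where "bounded_by d M a" "bounded_by d N b" using assms
      by (auto simp: half_bounded_def)
  then have "{k. a k \<noteq> 0 \<and> b (n - k) \<noteq> 0} \<subseteq> {k. dir_sign d * k \<le> M \<and> dir_sign d * (n - k) \<le> N}"
      for n
    unfolding bounded_by_def by blast
  then show ?thesis unfolding multipliable_def by (blast intro: finite_subset[OF _ finite_bounds])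
qed

lemma finite_op_finite: assumes "finite_op a" shows "finite {k. a k \<noteq> 0}"
proof -
  obtain M N where "bounded_by True M a" "bounded_by False N a" using assms
      by (auto simp: half_bounded_def finite_op_def)
  then have "{k. a k \<noteq> 0} \<subseteq> {-N..M}" by (auto simp: bounded_by_def minus_le_iff)
  then show ?thesis by (rule finite_subset) simp
qed

lemma finite_finite_op: assumes "finite {k. a k \<noteq> 0}" shows "finite_op a"
proof -
  define N where "N = Max (abs ` {k. a k \<noteq> 0})"
  have "\<bar>k\<bar> \<le> N" if "a k \<noteq> 0" for k
    unfolding N_def using assms that by (intro Max_ge) auto
  then have "bounded_by True N a" "bounded_by False N a"
    unfolding bounded_by_def by (simp_all add: abs_le_iff)
  then show ?thesis by (auto simp: finite_op_def half_bounded_def)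
qed

lemma finite_op_half_bounded: "finite_op a \<Longrightarrow> half_bounded d a"
  by (cases d) (auto simp: finite_op_def)

text \<open>The second factor may be infinite in both directions. This covers powers of L acting on
  the sum of the two logarithms, and the constant families behind \<open>dapply\<close>.\<close>

lemma multipliable_finite_op: "finite_op a \<Longrightarrow> multipliable a b"
  by (auto simp: multipliable_def intro: finite_subset[OF _ finite_op_finite])

lemma bounded_by_0: "bounded_by d N 0"
  by (simp add: bounded_by_def)

lemma bounded_by_dmono: "dir_sign d * n \<le> N \<Longrightarrow> bounded_by d N (dmono f n)"
  by (auto simp: bounded_by_def dmono_def)

lemma bounded_by_add: "bounded_by d N a \<Longrightarrow> bounded_by d N b \<Longrightarrow> bounded_by d N (a + b)"
  unfolding bounded_by_def by (metis add_0 plus_fun_apply)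

lemma bounded_by_uminus: "bounded_by d N a \<Longrightarrow> bounded_by d N (- a)"
  by (simp add: bounded_by_def)

lemma bounded_by_diff: "bounded_by d N a \<Longrightarrow> bounded_by d N b \<Longrightarrow> bounded_by d N (a - b)"
  using bounded_by_add[OF _ bounded_by_uminus, of d N a b] by simp

lemma bounded_by_dscale: "bounded_by d N a \<Longrightarrow> bounded_by d N (dscale c a)"
  unfolding bounded_by_def dscale_def by (metis mult_zero_right)

lemma half_bounded_max:
  assumes "half_bounded d a" "half_bounded d b"
  obtains N where "bounded_by d N a" "bounded_by d N b"
proof -
  obtain M N where "bounded_by d M a" "bounded_by d N b" using assms
      by (auto simp: half_bounded_def)
  then have "bounded_by d (max M N) a" "bounded_by d (max M N) b" by (auto elim: bounded_by_mono)
  then show ?thesis by (rule that)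
qed

lemma half_bounded_0: "half_bounded d 0"
  by (rule bounded_by_half_bounded[OF bounded_by_0])

lemma half_bounded_dmono: "half_bounded d (dmono f n)"
  by (rule bounded_by_half_bounded[OF bounded_by_dmono[OF order_refl]])

lemma half_bounded_add: "half_bounded d a \<Longrightarrow> half_bounded d b \<Longrightarrow> half_bounded d (a + b)"
  by (erule (1) half_bounded_max) (rule bounded_by_half_bounded[OF bounded_by_add])

lemma half_bounded_uminus: "half_bounded d a \<Longrightarrow> half_bounded d (- a)"
  unfolding half_bounded_def using bounded_by_uminus by blast

lemma half_bounded_diff: "half_bounded d a \<Longrightarrow> half_bounded d b \<Longrightarrow> half_bounded d (a - b)"
  by (erule (1) half_bounded_max) (rule bounded_by_half_bounded[OF bounded_by_diff])

lemma half_bounded_dscale: "half_bounded d a \<Longrightarrow> half_bounded d (dscale c a)"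
  unfolding half_bounded_def using bounded_by_dscale by blast

lemma smooth_op_0: "smooth_op 0"
  by (simp add: smooth_op_def smooth_fun_0)

lemma smooth_op_dmono: "smooth_fun f \<Longrightarrow> smooth_op (dmono f n)"
  by (simp add: smooth_op_def dmono_def smooth_fun_0)

lemma smooth_op_add: "smooth_op a \<Longrightarrow> smooth_op b \<Longrightarrow> smooth_op (a + b)"
  by (simp add: smooth_op_def smooth_fun_add)

lemma smooth_op_uminus: "smooth_op a \<Longrightarrow> smooth_op (- a)"
  by (simp add: smooth_op_def smooth_fun_uminus)

lemma smooth_op_diff: "smooth_op a \<Longrightarrow> smooth_op b \<Longrightarrow> smooth_op (a - b)"
  by (simp add: smooth_op_def smooth_fun_diff)

lemma smooth_op_dscale: "smooth_op a \<Longrightarrow> smooth_op (dscale c a)"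
  by (simp add: smooth_op_def dscale_def smooth_fun_mult smooth_fun_const)

section \<open>The product of difference operators and their action on functions\<close>

context
  fixes \<epsilon> :: real
begin

definition dmul :: "dop \<Rightarrow> dop \<Rightarrow> dop" (infixl "\<star>" 70) where
  "a \<star> b = (\<lambda>n. \<Sum>k | a k \<noteq> 0 \<and> b (n - k) \<noteq> 0. a k * shift \<epsilon> k (b (n - k)))"

definition dderiv :: "coord \<Rightarrow> dop \<Rightarrow> dop" where
  "dderiv i a = (\<lambda>k. eder \<epsilon> i (a k))"

(* The product with a family that is constant in the exponent is again constant, so the action on
   functions inherits associativity and the Leibniz rule from the product. *)
definition dapply :: "dop \<Rightarrow> sfun \<Rightarrow> sfun" where
  "dapply a f = (a \<star> (\<lambda>_. f)) 0"

text \<open>Enlarging the index set beyond the support lets several products be compared over one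
  common finite set.\<close>

lemma dmul_eq_sum:
  assumes "finite K" "\<And>k. a k \<noteq> 0 \<Longrightarrow> b (n - k) \<noteq> 0 \<Longrightarrow> k \<in> K"
  shows "(a \<star> b) n = (\<Sum>k\<in>K. a k * shift \<epsilon> k (b (n - k)))"
  unfolding dmul_def by (rule sum.mono_neutral_left) (use assms in auto)

lemma dmul_nonzero:
  assumes "(a \<star> b) n \<noteq> 0"
  obtains k where "a k \<noteq> 0" "b (n - k) \<noteq> 0"
proof -
  have "{k. a k \<noteq> 0 \<and> b (n - k) \<noteq> 0} \<noteq> {}"
  proof
    assume "{k. a k \<noteq> 0 \<and> b (n - k) \<noteq> 0} = {}"
    then have "(a \<star> b) n = 0" unfolding dmul_def by (simp only: sum.empty)
    with assms show False by contradiction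
  qed
  then show ?thesis using that by blast
qed

text \<open>For one coefficient, associativity is an exchange of two finite sums. \<open>K\<close>
  has to contain the exponents of the first factor and \<open>P\<close> those of the product of the
  first two, as far as they occur in nonzero triple terms. Two different sources of finiteness are
  fed into this below.\<close>

lemma dmul_assoc_at:
  assumes "finite K" "finite P"
    and KP: "\<And>k p. a k \<noteq> 0 \<Longrightarrow> b (p - k) \<noteq> 0 \<Longrightarrow> c (n - p) \<noteq> 0 \<Longrightarrow> k \<in> K \<and> p \<in> P"
  shows "((a \<star> b) \<star> c) n = (a \<star> (b \<star> c)) n"
proof -
  let ?t = "\<lambda>k p. a k * shift \<epsilon> k (b (p - k)) * shift \<epsilon> p (c (n - p))"
  have "((a \<star> b) \<star> c) n = (\<Sum>p\<in>P. (a \<star> b) p * shift \<epsilon> p (c (n - p)))"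
    by (rule dmul_eq_sum[OF assms(2)]) (use KP in \<open>blast elim: dmul_nonzero\<close>)
  also have "\<dots> = (\<Sum>p\<in>P. \<Sum>k\<in>K. ?t k p)"
  proof (rule sum.cong[OF refl])
    fix p
    show "(a \<star> b) p * shift \<epsilon> p (c (n - p)) = (\<Sum>k\<in>K. ?t k p)"
    \<comment> \<open>The support of the inner sum is known to be finite only where the outer factor
      is nonzero; elsewhere both sides are 0.\<close>
    proof (cases "c (n - p) = 0")
      case False
      then have "(a \<star> b) p = (\<Sum>k\<in>K. a k * shift \<epsilon> k (b (p - k)))"
        by (intro dmul_eq_sum assms(1)) (use KP in blast)
      then show ?thesis by (simp add: sum_distrib_right)
    qed simp
  qed
  also have "\<dots> = (\<Sum>k\<in>K. \<Sum>p\<in>P. ?t k p)" by (rule sum.swap)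
  also have "\<dots> = (\<Sum>k\<in>K. a k * shift \<epsilon> k ((b \<star> c) (n - k)))"
  proof (rule sum.cong[OF refl])
    fix k
    show "(\<Sum>p\<in>P. ?t k p) = a k * shift \<epsilon> k ((b \<star> c) (n - k))"
    proof (cases "a k = 0")
      case False
      let ?L = "(\<lambda>p. p - k) ` P"
      have "(b \<star> c) (n - k) = (\<Sum>l\<in>?L. b l * shift \<epsilon> l (c (n - k - l)))"
      proof (rule dmul_eq_sum)
        fix l assume "b l \<noteq> 0" "c (n - k - l) \<noteq> 0"
        with KP[of k "k + l"] False have "k + l \<in> P" by (simp add: diff_diff_eq)
        then show "l \<in> ?L" by force
      qed (use assms(2) in simp)
      also have "\<dots> = (\<Sum>p\<in>P. b (p - k) * shift \<epsilon> (p - k) (c (n - p)))"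
        by (subst sum.reindex) (auto simp: inj_on_def)
      finally show ?thesis
        by (simp add: shift_sum sum_distrib_left mult.assoc)
    qed simp
  qed
  also have "\<dots> = (a \<star> (b \<star> c)) n"
  proof (rule dmul_eq_sum[OF assms(1), symmetric])
    fix k assume "a k \<noteq> 0" "(b \<star> c) (n - k) \<noteq> 0"
    then obtain l where "b l \<noteq> 0" "c (n - k - l) \<noteq> 0" by (blast elim: dmul_nonzero)
    with KP[of k "k + l"] \<open>a k \<noteq> 0\<close> show "k \<in> K" by (simp add: diff_diff_eq)
  qed
  finally show ?thesis .
qed

text \<open>The common direction \<open>d\<close> is essential. If \<open>wd\<close> and
  \<open>wu\<close> are the downward and the upward inverse of the Darboux operator
  \<open>w\<close>, then \<open>wd \<star> w \<star> wu\<close> is \<open>wu\<close> when bracketed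
  to the left and \<open>wd\<close> when bracketed to the right.\<close>

lemma dmul_assoc:
  assumes "half_bounded d a" "half_bounded d b" "half_bounded d c"
  shows "a \<star> b \<star> c = a \<star> (b \<star> c)"
proof
  fix n
  obtain A B C where bounded_by: "bounded_by d A a" "bounded_by d B b" "bounded_by d C c"
      using assms by (auto simp: half_bounded_def)
  have "k \<in> {k. dir_sign d * k \<le> A \<and> dir_sign d * (n - k) \<le> B + C} \<and>
      p \<in> {p. dir_sign d * p \<le> A + B \<and> dir_sign d * (n - p) \<le> C}"
    if "a k \<noteq> 0" "b (p - k) \<noteq> 0" "c (n - p) \<noteq> 0" for k p
  proof -
    have "dir_sign d * k \<le> A" "dir_sign d * (p - k) \<le> B" "dir_sign d * (n - p) \<le> C"
      using bounded_by that unfolding bounded_by_def by blast+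
    then show ?thesis by (auto simp: algebra_simps split: if_splits)
  qed
  then show "(a \<star> b \<star> c) n = (a \<star> (b \<star> c)) n"
    by (rule dmul_assoc_at[OF finite_bounds[of d A n "B + C"] finite_bounds[of d "A + B" n C]])
qed

text \<open>Here the third factor is unrestricted; applied to a constant family this becomes
  \<open>dapply_dmul\<close>.\<close>

lemma dmul_assoc_finite_op:
  assumes "finite_op a" "finite_op b"
  shows "a \<star> b \<star> c = a \<star> (b \<star> c)"
proof
  fix n
  have "finite ((\<lambda>(k, l). k + l) ` ({k. a k \<noteq> 0} \<times> {l. b l \<noteq> 0}))"
    using assms finite_op_finite by blast
  then show "(a \<star> b \<star> c) n = (a \<star> (b \<star> c)) n"
  proof (rule dmul_assoc_at[OF finite_op_finite[OF assms(1)]])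
    fix k p assume "a k \<noteq> 0" "b (p - k) \<noteq> 0"
    then have "p = k + (p - k)" "k \<in> {k. a k \<noteq> 0}" "p - k \<in> {l. b l \<noteq> 0}" by auto
    then show "k \<in> {k. a k \<noteq> 0} \<and>
        p \<in> (\<lambda>(k, l). k + l) ` ({k. a k \<noteq> 0} \<times> {l. b l \<noteq> 0})"
      by (metis (mono_tags, lifting) SigmaI case_prod_conv image_eqI)
  qed
qed

lemma bounded_by_dmul:
  assumes "bounded_by d M a" "bounded_by d N b"
  shows "bounded_by d (M + N) (a \<star> b)"
  unfolding bounded_by_def
proof (intro allI impI)
  fix n assume "(a \<star> b) n \<noteq> 0"
  then obtain k where "a k \<noteq> 0" "b (n - k) \<noteq> 0" by (rule dmul_nonzero)
  with assms have "dir_sign d * k \<le> M" "dir_sign d * (n - k) \<le> N" unfolding bounded_by_def by blast+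
  then show "dir_sign d * n \<le> M + N" by (auto simp: algebra_simps split: if_splits)
qed

lemma half_bounded_dmul: "half_bounded d a \<Longrightarrow> half_bounded d b \<Longrightarrow> half_bounded d (a \<star> b)"
  unfolding half_bounded_def using bounded_by_dmul by blast

lemma finite_op_dmul: "finite_op a \<Longrightarrow> finite_op b \<Longrightarrow> finite_op (a \<star> b)"
  by (simp add: finite_op_def half_bounded_dmul)

lemma dmul_add_right:
  assumes "multipliable a b" "multipliable a c"
  shows "a \<star> (b + c) = a \<star> b + a \<star> c"
proof
  fix n
  let ?K = "{k. a k \<noteq> 0 \<and> b (n - k) \<noteq> 0} \<union> {k. a k \<noteq> 0 \<and> c (n - k) \<noteq> 0}"
  have K: "finite ?K" using assms by (simp add: multipliable_def)
  have "(a \<star> (b + c)) n = (\<Sum>k\<in>?K. a k * shift \<epsilon> k ((b + c) (n - k)))"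
    "(a \<star> b) n = (\<Sum>k\<in>?K. a k * shift \<epsilon> k (b (n - k)))"
    "(a \<star> c) n = (\<Sum>k\<in>?K. a k * shift \<epsilon> k (c (n - k)))"
    by (rule dmul_eq_sum[OF K]; force)+
  then show "(a \<star> (b + c)) n = (a \<star> b + a \<star> c) n"
    by (simp add: sum.distrib distrib_left)
qed

lemma dmul_add_left:
  assumes "multipliable a c" "multipliable b c"
  shows "(a + b) \<star> c = a \<star> c + b \<star> c"
proof
  fix n
  let ?K = "{k. a k \<noteq> 0 \<and> c (n - k) \<noteq> 0} \<union> {k. b k \<noteq> 0 \<and> c (n - k) \<noteq> 0}"
  have K: "finite ?K" using assms by (simp add: multipliable_def)
  have "((a + b) \<star> c) n = (\<Sum>k\<in>?K. (a + b) k * shift \<epsilon> k (c (n - k)))"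
    "(a \<star> c) n = (\<Sum>k\<in>?K. a k * shift \<epsilon> k (c (n - k)))"
    "(b \<star> c) n = (\<Sum>k\<in>?K. b k * shift \<epsilon> k (c (n - k)))"
    by (rule dmul_eq_sum[OF K]; force)+
  then show "((a + b) \<star> c) n = (a \<star> c + b \<star> c) n"
    by (simp add: sum.distrib distrib_right)
qed

lemma dmul_uminus: "a \<star> (- b) = - (a \<star> b)" "(- a) \<star> b = - (a \<star> b)"
  by (simp_all add: dmul_def fun_Compl_def[where ?'a = int] sum_negf del: uminus_apply)

lemma multipliable_uminus: "multipliable a (- b) \<longleftrightarrow> multipliable a b" "multipliable (- a) b
    \<longleftrightarrow> multipliable a b"
  by (auto simp: multipliable_def)

lemma dmul_diff_right: "multipliable a b \<Longrightarrow> multipliable a c \<Longrightarrow> a \<star> (b - c) = a \<star> b - a \<star> c"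
  using dmul_add_right[of a b "- c"] by (simp add: multipliable_uminus dmul_uminus)

lemma dmul_diff_left: "multipliable a c \<Longrightarrow> multipliable b c \<Longrightarrow> (a - b) \<star> c = a \<star> c - b \<star> c"
  using dmul_add_left[of a c "- b"] by (simp add: multipliable_uminus dmul_uminus)

lemma dmul_0: "a \<star> 0 = 0" "0 \<star> a = 0"
  by (auto simp: dmul_def fun_eq_iff[where ?'a = int])

lemma dmono_dmul: "(dmono f n \<star> a) m = f * shift \<epsilon> n (a (m - n))"
  by (subst dmul_eq_sum[of "{n}"]) (auto simp: dmono_def split: if_splits)

lemma dmul_dmono: "(a \<star> dmono f n) m = a (m - n) * shift \<epsilon> (m - n) f"
  by (subst dmul_eq_sum[of "{m - n}"]) (auto simp: dmono_def split: if_splits)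

lemma dmul_unit: "unit_op \<star> a = a" "a \<star> unit_op = a"
  by (auto simp: dmono_dmul dmul_dmono fun_eq_iff[where ?'a = int])

lemma dmono_dmono: "dmono f m \<star> dmono g n = dmono (f * shift \<epsilon> m g) (m + n)"
  by (auto simp: dmono_dmul fun_eq_iff[where ?'a = int]) (auto simp: dmono_def)

lemma dmul_dscale_right: "multipliable a b \<Longrightarrow> a \<star> dscale c b = dscale c (a \<star> b)"
proof
  fix n assume "multipliable a b"
  then have K: "finite {k. a k \<noteq> 0 \<and> b (n - k) \<noteq> 0}" by (simp add: multipliable_def)
  have "(a \<star> dscale c b) n =
      (\<Sum>k | a k \<noteq> 0 \<and> b (n - k) \<noteq> 0. a k * shift \<epsilon> k (dscale c b (n - k)))"
    by (rule dmul_eq_sum[OF K]) (auto simp: dscale_def)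
  then show "(a \<star> dscale c b) n = dscale c (a \<star> b) n"
    by (simp add: dscale_def dmul_def sum_distrib_left mult_ac shift_const)
qed

lemma dmul_dscale_left: "multipliable a b \<Longrightarrow> dscale c a \<star> b = dscale c (a \<star> b)"
proof
  fix n assume "multipliable a b"
  then have K: "finite {k. a k \<noteq> 0 \<and> b (n - k) \<noteq> 0}" by (simp add: multipliable_def)
  have "(dscale c a \<star> b) n =
      (\<Sum>k | a k \<noteq> 0 \<and> b (n - k) \<noteq> 0. dscale c a k * shift \<epsilon> k (b (n - k)))"
    by (rule dmul_eq_sum[OF K]) (auto simp: dscale_def)
  then show "(dscale c a \<star> b) n = dscale c (a \<star> b) n"
    by (simp add: dscale_def dmul_def sum_distrib_left mult_ac)
qed

lemma smooth_op_dmul: "smooth_op a \<Longrightarrow> smooth_op b \<Longrightarrow> smooth_op (a \<star> b)"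
  by (auto simp: smooth_op_def dmul_def intro!: smooth_fun_intros)

lemma smooth_op_dderiv: "smooth_op a \<Longrightarrow> smooth_op (dderiv i a)"
  by (auto simp: smooth_op_def dderiv_def intro!: smooth_fun_intros)

lemma dderiv_nonzero: "dderiv i a k \<noteq> 0 \<Longrightarrow> a k \<noteq> 0"
  by (auto simp: dderiv_def)

lemma bounded_by_dderiv: "bounded_by d N a \<Longrightarrow> bounded_by d N (dderiv i a)"
  unfolding bounded_by_def using dderiv_nonzero by blast

lemma half_bounded_dderiv: "half_bounded d a \<Longrightarrow> half_bounded d (dderiv i a)"
  unfolding half_bounded_def using bounded_by_dderiv by blast

lemma dderiv_lam [simp]: "dderiv i (dmono 1 n) = 0"
  by (auto simp: dderiv_def dmono_def)

text \<open>\<open>eder\<close> is a derivation that commutes with shifts, and differentiation does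
  not enlarge supports, so all three products are sums over the same finite set.\<close>

lemma dderiv_dmul:
  assumes "smooth_op a" "smooth_op b" "multipliable a b"
  shows "dderiv i (a \<star> b) = dderiv i a \<star> b + a \<star> dderiv i b"
proof
  fix n
  let ?K = "{k. a k \<noteq> 0 \<and> b (n - k) \<noteq> 0}"
  have K: "finite ?K" using assms by (simp add: multipliable_def)
  have "(a \<star> b) n = (\<Sum>k\<in>?K. a k * shift \<epsilon> k (b (n - k)))"
    "(dderiv i a \<star> b) n = (\<Sum>k\<in>?K. dderiv i a k * shift \<epsilon> k (b (n - k)))"
    "(a \<star> dderiv i b) n = (\<Sum>k\<in>?K. a k * shift \<epsilon> k (dderiv i b (n - k)))"
    using dderiv_nonzero[of i] by (auto intro!: dmul_eq_sum[OF K])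
  then show "dderiv i (a \<star> b) n = (dderiv i a \<star> b + a \<star> dderiv i b) n"
    using assms(1,2)
    by (simp add: dderiv_def eder_sum eder_mult eder_shift smooth_fun_intros smooth_op_def
        sum.distrib)
qed

lemma dapply_const: "(a \<star> (\<lambda>_. f)) = (\<lambda>_. dapply a f)"
  by (simp add: dapply_def dmul_def)

lemma dapply_dmul: "finite_op a \<Longrightarrow> finite_op b \<Longrightarrow> dapply (a \<star> b) f = dapply a (dapply b f)"
  using dmul_assoc_finite_op[of a b "\<lambda>_. f"] by (simp add: dapply_const) (metis dapply_const)

lemma dapply_add: "finite_op a \<Longrightarrow> finite_op b \<Longrightarrow> dapply (a + b) f = dapply a f + dapply b f"
  using dmul_add_left[of a "\<lambda>_. f" b] by (simp add: multipliable_finite_op dapply_def)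

lemma dapply_diff: "finite_op a \<Longrightarrow> finite_op b \<Longrightarrow> dapply (a - b) f = dapply a f - dapply b f"
  using dmul_diff_left[of a "\<lambda>_. f" b] by (simp add: multipliable_finite_op dapply_def)

lemma dapply_add_arg: "finite_op a \<Longrightarrow> dapply a (f + g) = dapply a f + dapply a g"
  using dmul_add_right[of a "\<lambda>_. f" "\<lambda>_. g"]
      by (simp add: multipliable_finite_op dapply_def plus_fun_def)

lemma dapply_diff_arg: "finite_op a \<Longrightarrow> dapply a (f - g) = dapply a f - dapply a g"
  using dmul_diff_right[of a "\<lambda>_. f" "\<lambda>_. g"]
      by (simp add: multipliable_finite_op dapply_def fun_diff_def)

lemma dapply_scal_arg: "finite_op a \<Longrightarrow> dapply a ((\<lambda>p. scal c) * f) = (\<lambda>p. scal c) * dapply a f"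
  using dmul_dscale_right[of a "\<lambda>_. f" c]
      by (simp add: multipliable_finite_op dapply_def dscale_def)

lemma dapply_0: "dapply a 0 = 0"
  using dmul_0(1)[of a] by (simp add: dapply_def zero_fun_def)

lemma eder_dapply:
  assumes "finite_op a" "smooth_op a" "smooth_fun f"
  shows "eder \<epsilon> i (dapply a f) = dapply (dderiv i a) f + dapply a (eder \<epsilon> i f)"
  using dderiv_dmul[of a "\<lambda>_. f" i] assms
  by (simp add: multipliable_finite_op dapply_const fun_eq_iff[where ?'a
      = int] smooth_op_def dderiv_def[of _ "\<lambda>_. _"])

section \<open>Inverses\<close>

(* The coefficients of the right inverse, from the leading one on; dir_sign d * N is the leading
   exponent of a, whose coefficient must be invertible. *)
fun rinv_coeff :: "bool \<Rightarrow> int \<Rightarrow> dop \<Rightarrow> nat \<Rightarrow> sfun" where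
  "rinv_coeff d N a j = shift \<epsilon> (- (dir_sign d * N)) (fun_inv (a (dir_sign d * N)) *
     ((if j = 0 then 1 else 0) - (\<Sum>i<j. a (dir_sign d * (N - (int j - int i))) *
        shift \<epsilon> (dir_sign d * (N - (int j - int i))) (rinv_coeff d N a i))))"

declare rinv_coeff.simps [simp del]

text \<open>The inverse has leading exponent \<open>dir_sign d * (- N)\<close>, and its coefficient
  number \<open>j\<close> sits at distance \<open>j\<close> from there.\<close>

definition rinv :: "bool \<Rightarrow> int \<Rightarrow> dop \<Rightarrow> dop" where
  "rinv d N a = (\<lambda>k. if dir_sign d * k \<le> - N then rinv_coeff d N a (nat (- N - dir_sign d * k))
      else 0)"

lemma bounded_by_rinv: "bounded_by d (- N) (rinv d N a)"
  by (simp add: bounded_by_def rinv_def)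

text \<open>At distance \<open>j\<close> from the exponent 0, the product gives a triangular
  equation: coefficient \<open>j\<close> of the inverse occurs only with the invertible leading
  coefficient of \<open>a\<close>, next to coefficients of smaller index. The recursion
  \<open>rinv_coeff\<close> solves it.\<close>

lemma dmul_rinv:
  assumes a: "bounded_by d N a" and inv: "pointwise_invertible (a (dir_sign d * N))"
  shows "a \<star> rinv d N a = unit_op"
proof
  fix n
  let ?b = "rinv d N a" and ?c = "rinv_coeff d N a"
  have dir_sign: "dir_sign d * (dir_sign d * x) = x" for x by simp
  show "(a \<star> ?b) n = unit_op n"
  proof (cases "dir_sign d * n > 0")
    case True
    then have "n \<noteq> 0" by auto
    with bdD[OF bounded_by_dmul[OF a bounded_by_rinv[of d N a]], of n] True show ?thesis
        by (simp add: dmono_def)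
  next
    case False
    define j where "j = nat (- (dir_sign d * n))"
    have n: "n = - (dir_sign d * int j)" using False by (auto simp: j_def)
    have b: "?b (n - dir_sign d * (N - (int j - int i))) = ?c i" for i
    proof -
      have e: "dir_sign d * (n - dir_sign d * (N - (int j - int i))) = - N - int i"
        unfolding n by (simp add: algebra_simps)
      show ?thesis unfolding rinv_def e by simp
    qed
    let ?k = "\<lambda>i. dir_sign d * (N - (int j - int i))"
    have "(a \<star> ?b) n = (\<Sum>k\<in>?k ` {..j}. a k * shift \<epsilon> k (?b (n - k)))"
    proof (rule dmul_eq_sum)
      fix k assume "a k \<noteq> 0" "?b (n - k) \<noteq> 0"
      then have le: "dir_sign d * k \<le> N" "dir_sign d * (n - k) \<le> - N"
        using a bounded_by_rinv[of d N a] unfolding bounded_by_def by blast+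
      \<comment> \<open>\<open>i\<close> is the distance of the exponent \<open>n - k\<close> of the
        second factor from its leading exponent.\<close>
      define i where "i = nat (int j - N + dir_sign d * k)"
      have i: "int i = int j - N + dir_sign d * k" "i \<le> j"
        using le unfolding i_def n by (auto split: if_splits)
      have "k = ?k i" unfolding i by (simp add: algebra_simps)
      with i show "k \<in> ?k ` {..j}" by blast
    qed simp
    also have "\<dots> = (\<Sum>i\<le>j. a (?k i) * shift \<epsilon> (?k i) (?c i))"
      by (subst sum.reindex) (auto simp: inj_on_def b split: if_splits)
    also have "\<dots> = (\<Sum>i<j. a (?k i) * shift \<epsilon> (?k i) (?c i)) + a (dir_sign d * N) * shift \<epsilon>
        (dir_sign d * N) (?c j)"
      by (simp add: lessThan_Suc_atMost[symmetric])
    also have "a (dir_sign d * N) * shift \<epsilon> (dir_sign d * N) (?c j) =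
        (if j = 0 then 1 else 0) - (\<Sum>i<j. a (?k i) * shift \<epsilon> (?k i) (?c i))"
      by (subst rinv_coeff.simps, subst shift_shift)
        (simp only: add.right_inverse shift_0 mult.assoc[symmetric] fun_inv_right[OF inv] mult_1)
    also have "(\<Sum>i<j. a (?k i) * shift \<epsilon> (?k i) (?c i)) + \<dots> = (if j = 0 then 1 else 0)"
      by (subst add.commute) (rule diff_add_cancel)
    finally have "(a \<star> ?b) n = (if j = 0 then 1 else 0)" .
    then show ?thesis by (simp add: dmono_def n)
  qed
qed

lemma smooth_op_rinv:
  assumes "smooth_op a" "pointwise_invertible (a (dir_sign d * N))"
  shows "smooth_op (rinv d N a)"
proof -
  have "smooth_fun (rinv_coeff d N a j)" for j
  proof (induction j rule: less_induct)
    case (less j)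
    then show ?case using assms
      by (subst rinv_coeff.simps)
        (auto simp: smooth_op_def intro!: smooth_fun_intros smooth_fun_inv)
  qed
  then show ?thesis unfolding smooth_op_def rinv_def
      by (simp only: smooth_fun_0 split: if_split) simp
qed

lemma rinv_leading:
  assumes "pointwise_invertible (a (dir_sign d * N))"
  shows "pointwise_invertible (rinv d N a (dir_sign d * (- N)))"
proof -
  have "rinv d N a (dir_sign d * (- N)) = shift \<epsilon> (- (dir_sign d * N)) (fun_inv (a (dir_sign d *
      N)))"
    by (simp add: rinv_def rinv_coeff.simps[of _ _ _ 0])
  then show ?thesis
    using fun_inv_left[OF assms] by (simp add: pointwise_invertible_shift pointwise_invertibleI)
qed

text \<open>The right inverse b has an invertible leading coefficient, hence a right inverse c of
  its own, and c = (a b) c = a (b c) = a.\<close>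

lemma rinv_dmul:
  assumes a: "bounded_by d N a" and inv: "pointwise_invertible (a (dir_sign d * N))"
  shows "rinv d N a \<star> a = unit_op"
proof -
  let ?b = "rinv d N a"
  obtain c where c: "half_bounded d c" "?b \<star> c = unit_op"
    using dmul_rinv[OF bounded_by_rinv rinv_leading, of a d N] inv bounded_by_half_bounded[OF
        bounded_by_rinv] by blast
  have "c = (a \<star> ?b) \<star> c" by (simp add: dmul_rinv[OF assms] dmul_unit)
  also have "\<dots> = a"
    using dmul_assoc[OF bounded_by_half_bounded[OF a] bounded_by_half_bounded[OF bounded_by_rinv]
        c(1)] c(2) by (simp add: dmul_unit)
  finally show ?thesis using c(2) by simp
qed

section \<open>Embedding into differential-difference operators\<close>

(* op1 x y is x + y (eps d/dx). *)
definition op1 :: "dop \<Rightarrow> dop \<Rightarrow> op" where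
  "op1 x y = (\<lambda>k m. if m = 0 then x k else if m = 1 then y k else 0)"

abbreviation emb :: "dop \<Rightarrow> op" where "emb x \<equiv> op1 x 0"

lemma op1_simps:
  "op1 x y k 0 = x k" "op1 x y k (Suc 0) = y k" "m > 1 \<Longrightarrow> op1 x y k m = 0"
  by (auto simp: op1_def)

lemma op1_inject: "op1 x y = op1 x' y' \<longleftrightarrow> x = x' \<and> y = y'"
  by (metis op1_simps(1,2) ext)

text \<open>With order zero on the left only the triples (k, 0, 0) occur in \<open>op_mult\<close>.
  The index sets of both sides then correspond one to one, so the sums agree even where they are
  infinite.\<close>

lemma emb_op1_mult: "emb z \<odot>\<^bsub>\<epsilon>\<^esub> op1 x y = op1 (z \<star> x) (z \<star> y)"
proof (intro ext)
  fix n r p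
  let ?B = "op1 x y"
  have "(emb z \<odot>\<^bsub>\<epsilon>\<^esub> ?B) n r =
      (\<Sum>(k, m, i) \<in> (\<lambda>k. (k, 0, 0)) ` {k. z k \<noteq> 0 \<and> ?B (n - k) r \<noteq> 0}.
       of_nat (m choose i) * emb z k m * shift \<epsilon> k ((eder \<epsilon> X ^^ i) (?B (n - k) (r + i - m))))"
    unfolding op_mult_def by (rule sum.cong) (auto simp: op1_def image_def split: if_splits)
  also have "\<dots> = (\<Sum>k | z k \<noteq> 0 \<and> ?B (n - k) r \<noteq> 0. z k * shift \<epsilon> k (?B (n - k) r))"
    by (subst sum.reindex) (auto simp: inj_on_def op1_simps)
  also have "\<dots> = op1 (z \<star> x) (z \<star> y) n r"
    by (auto simp: op1_def dmul_def)
  finally show "(emb z \<odot>\<^bsub>\<epsilon>\<^esub> ?B) n r p = op1 (z \<star> x) (z \<star> y) n r p" by simp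
qed

lemma emb_mult: "emb x \<odot>\<^bsub>\<epsilon>\<^esub> emb y = emb (x \<star> y)"
  by (simp add: emb_op1_mult dmul_0)

text \<open>With D = eps d/dx this is (x + y D) z = x z + y z_x + (y z) D. The pairs (m, i) that can
  occur are (0, 0), (1, 0) and (1, 1); in the last one D hits \<open>z\<close>.\<close>

lemma op1_emb_mult:
  assumes x: "half_bounded d x" and y: "half_bounded d y" and z: "half_bounded d z"
  shows "op1 x y \<odot>\<^bsub>\<epsilon>\<^esub> emb z = op1 (x \<star> z + y \<star> dderiv X z) (y \<star> z)"
proof (intro ext)
  fix n r p
  let ?t = "\<lambda>(k, m, i). of_nat (m choose i) * op1 x y k m *
      shift \<epsilon> k ((eder \<epsilon> X ^^ i) (emb z (n - k) (r + i - m)))"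
  let ?K = "{k. x k \<noteq> 0 \<and> z (n - k) \<noteq> 0} \<union> {k. y k \<noteq> 0 \<and> z (n - k) \<noteq> 0}"
  have K: "finite ?K"
    using multipliable_half_bounded[OF x z] multipliable_half_bounded[OF y z]
        by (simp add: multipliable_def)
  let ?S = "{(k, m, i). i \<le> m \<and> m \<le> r + i \<and> op1 x y k m \<noteq> 0 \<and> emb z (n - k) (r + i - m) \<noteq> 0}"
  have S: "?S \<subseteq> ?K \<times> {(0, 0), (1, 0), (1, 1)}"
    by (auto simp: op1_def split: if_splits)
  have "(op1 x y \<odot>\<^bsub>\<epsilon>\<^esub> emb z) n r = (\<Sum>q\<in>?S. ?t q)"
    unfolding op_mult_def by (simp add: case_prod_unfold)
  \<comment> \<open>The condition m \<le> r + i must be kept: for r = 0 it excludes (1, 0), where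
    the truncated difference r + i - m would produce a spurious term.\<close>
  also have "\<dots> = (\<Sum>q\<in>?K \<times> {q \<in> {(0, 0), (1, 0), (1, 1)}. fst q \<le> r + snd q}. ?t q)"
  proof (rule sum.mono_neutral_left)
    show "?S \<subseteq> ?K \<times> {q \<in> {(0, 0), (1, 0), (1, 1)}. fst q \<le> r + snd q}" using S by auto
    have e0: "(eder \<epsilon> X ^^ i) 0 = 0" for i by (induction i) auto
    show "\<forall>q\<in>?K \<times> {q \<in> {(0, 0), (1, 0), (1, 1)}. fst q \<le> r + snd q} - ?S. ?t q = 0"
      by (auto simp: e0)
  qed (use K in auto)
  also have "\<dots> = op1 (x \<star> z + y \<star> dderiv X z) (y \<star> z) n r"
  proof -
    have X: "(x \<star> z) n = (\<Sum>k\<in>?K. x k * shift \<epsilon> k (z (n - k)))"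
      by (rule dmul_eq_sum[OF K]) auto
    have Y: "(y \<star> z) n = (\<Sum>k\<in>?K. y k * shift \<epsilon> k (z (n - k)))"
      by (rule dmul_eq_sum[OF K]) auto
    have Z: "(y \<star> dderiv X z) n = (\<Sum>k\<in>?K. y k * shift \<epsilon> k (eder \<epsilon> X (z (n - k))))"
      unfolding dderiv_def by (rule dmul_eq_sum[OF K]) auto
    have e0: "(eder \<epsilon> X ^^ i) 0 = 0" for i by (induction i) auto
    have z: "emb z m s = 0" if "s > 0" for m s using that by (simp add: op1_def)
    consider "r = 0" | "r = 1" | "r > 1" by linarith
    then show ?thesis
    proof cases
      case 1
      then have "{q \<in> {(0, 0), (1, 0), (1, 1)}. fst q \<le> r + snd q} = {(0, 0), (1, 1)}" by auto
      then show ?thesis using 1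
        by (simp add: sum.cartesian_product' op1_simps X Z sum.distrib fun_eq_iff)
    next
      case 2
      then have "{q \<in> {(0, 0), (1, 0), (1, 1)}. fst q \<le> r + snd q} = {(0, 0), (1, 0), (1, 1)}"
          by auto
      moreover have "(\<Sum>q\<in>{(0, 0), (1, 0), (1, 1)}. ?t (k, q)) = y k * shift \<epsilon> k (z (n - k))" for k
        using 2 by (simp add: z e0 op1_simps)
      ultimately show ?thesis
        using 2 by (simp only: sum.cartesian_product' Y op1_simps One_nat_def)
    next
      case 3
      have "?t q = 0" if "q \<in> ?K \<times> {q \<in> {(0, 0), (1, 0), (1, 1)}. fst q \<le> r + snd q}" for q
        using that 3 by (auto simp: z e0)
      then have "(\<Sum>q\<in>?K \<times> {q \<in> {(0, 0), (1, 0), (1, 1)}. fst q \<le> r + snd q}. ?t q) = 0"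
        by (rule sum.neutral[rule_format])
      then show ?thesis using op1_simps(3)[of r] 3 by (simp only:)
    qed
  qed
  finally show "(op1 x y \<odot>\<^bsub>\<epsilon>\<^esub> emb z) n r p = op1 (x \<star> z + y \<star> dderiv X z) (y \<star> z) n r p"
    by simp
qed

lemma op1_add: "op1 x y + op1 x' y' = op1 (x + x') (y + y')"
  and op1_diff: "op1 x y - op1 x' y' = op1 (x - x') (y - y')"
  and op1_uminus: "- op1 x y = op1 (- x) (- y)"
  and op_scale_op1: "op_scale c (op1 x y) = op1 (dscale c x) (dscale c y)"
  and op_id_emb: "op_id = emb unit_op"
  and op_fun_emb: "op_fun f = emb (dmono f 0)"
  and Lam_emb: "Lam n = emb (dmono 1 n)"
  and op_edx_op1: "op_edx = op1 0 unit_op"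
  and op_eder_emb: "op_eder \<epsilon> i (emb x) = emb (dderiv i x)"
  by (auto simp: fun_eq_iff op1_def op_scale_def dscale_def op_id_def op_fun_def dmono_def Lam_def
      op_edx_def op_eder_def dderiv_def)

definition pos_part :: "dop \<Rightarrow> dop" where "pos_part a = (\<lambda>k. if k \<ge> 0 then a k else 0)"
definition neg_part :: "dop \<Rightarrow> dop" where "neg_part a = (\<lambda>k. if k < 0 then a k else 0)"

lemma op_plus_emb: "op_plus (emb x) = emb (pos_part x)"
  and op_minus_emb: "op_minus (emb x) = emb (neg_part x)"
  by (auto simp: fun_eq_iff op1_def op_plus_def op_minus_def pos_part_def neg_part_def)

primrec dpow :: "dop \<Rightarrow> nat \<Rightarrow> dop" where
  "dpow a 0 = unit_op"
| "dpow a (Suc n) = a \<star> dpow a n"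

lemma op_pow_emb: "op_pow \<epsilon> (emb x) n = emb (dpow x n)"
  by (induction n) (auto simp: op_id_emb emb_mult simp del: zero_fun_apply)

lemma op_apply_op1:
  assumes "finite_op x" "finite_op y"
  shows "op_apply \<epsilon> (op1 x y) f = dapply x f + dapply y (eder \<epsilon> X f)"
proof -
  let ?t = "\<lambda>(k, m). op1 x y k m * shift \<epsilon> k ((eder \<epsilon> X ^^ m) f)"
  let ?K = "{k. x k \<noteq> 0} \<union> {k. y k \<noteq> 0}"
  have K: "finite ?K" using assms finite_op_finite by auto
  have "op_apply \<epsilon> (op1 x y) f = (\<Sum>q\<in>{(k, m). op1 x y k m \<noteq> 0}. ?t q)"
    by (simp add: op_apply_def)
  also have "\<dots> = (\<Sum>q\<in>?K \<times> {0, 1}. ?t q)"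
    by (rule sum.mono_neutral_left) (use K in \<open>auto simp: op1_def split: if_splits\<close>)
  also have "\<dots> = (\<Sum>k\<in>?K. x k * shift \<epsilon> k f) + (\<Sum>k\<in>?K. y k * shift \<epsilon> k (eder \<epsilon> X f))"
    by (simp add: sum.cartesian_product' op1_simps sum.distrib)
  also have "(\<Sum>k\<in>?K. x k * shift \<epsilon> k f) = dapply x f"
    unfolding dapply_def by (rule dmul_eq_sum[OF K, symmetric]) auto
  also have "(\<Sum>k\<in>?K. y k * shift \<epsilon> k (eder \<epsilon> X f)) = dapply y (eder \<epsilon> X f)"
    unfolding dapply_def by (rule dmul_eq_sum[OF K, symmetric]) auto
  finally show ?thesis .
qed

text \<open>A left factor free of eps d/dx acts on each power of eps d/dx separately, so statements
  about arbitrary operators \<open>B\<close> reduce to difference operators.\<close>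

lemma emb_mult_any: "(emb z \<odot>\<^bsub>\<epsilon>\<^esub> B) n r = (z \<star> (\<lambda>k. B k r)) n"
proof -
  have "(emb z \<odot>\<^bsub>\<epsilon>\<^esub> B) n r =
      (\<Sum>(k, m, i) \<in> (\<lambda>k. (k, 0, 0)) ` {k. z k \<noteq> 0 \<and> B (n - k) r \<noteq> 0}.
       of_nat (m choose i) * emb z k m * shift \<epsilon> k ((eder \<epsilon> X ^^ i) (B (n - k) (r + i - m))))"
    unfolding op_mult_def by (rule sum.cong) (auto simp: op1_def image_def split: if_splits)
  also have "\<dots> = (\<Sum>k | z k \<noteq> 0 \<and> B (n - k) r \<noteq> 0. z k * shift \<epsilon> k (B (n - k) r))"
    by (subst sum.reindex) (auto simp: inj_on_def op1_simps)
  finally show ?thesis by (simp add: dmul_def)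
qed

(* B may have any order in eps d/dx, even an unbounded one. *)
lemma right_inverse_unique:
  assumes a: "half_bounded d a" and b: "half_bounded d b" and ba: "b \<star> a = unit_op"
    and B: "\<exists>N. \<forall>k m. N < dir_sign d * k \<longrightarrow> B k m = 0" and aB: "emb a \<odot>\<^bsub>\<epsilon>\<^esub> B = op_id"
  shows "B = emb b"
proof (intro ext)
  fix n r p
  let ?c = "\<lambda>k. B k r"
  have c: "half_bounded d ?c" using B unfolding half_bounded_def by (meson bdI)
  have "B n r = ((b \<star> a) \<star> ?c) n" by (simp add: ba dmul_unit)
  also have "\<dots> = (b \<star> (a \<star> ?c)) n" using dmul_assoc[OF b a c] by simp
  also have "a \<star> ?c = (\<lambda>k. op_id k r)" using aB emb_mult_any[of a B] by metis
  also have "(b \<star> (\<lambda>k. op_id k r)) n = emb b n r"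
  proof (cases "r = 0")
    case True
    then have "(\<lambda>k. op_id k r) = unit_op" by (auto simp: op_id_emb op1_def)
    then show ?thesis using True by (simp add: dmul_unit op1_simps)
  next
    case False
    then have "(\<lambda>k. op_id k r) = 0" by (auto simp: op_id_emb op1_def)
    then show ?thesis using False by (simp only: dmul_0) (simp add: op1_def)
  qed
  finally show "B n r p = emb b n r p" by simp
qed

text \<open>The description in \<open>inv_down\<close> ranges over operators of every order in eps
  d/dx; \<open>right_inverse_unique\<close> excludes all competitors of
  \<open>emb b\<close>.\<close>

lemma inv_down_emb:
  assumes "half_bounded True a" "half_bounded True b" "a \<star> b = unit_op" "b \<star> a = unit_op"
  shows "inv_down \<epsilon> (emb a) = emb b"
  unfolding inv_down_def
proof (rule the_equality)
  obtain N where "bounded_by True N b" using assms(2) by (auto simp: half_bounded_def)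
  then have "\<forall>k>N. \<forall>m. emb b k m = 0" using bdD[of True N b] by (auto simp: op1_def)
  then show "(\<exists>N. \<forall>k>N. \<forall>m. emb b k m = 0) \<and>
      emb a \<odot>\<^bsub>\<epsilon>\<^esub> emb b = op_id \<and> emb b \<odot>\<^bsub>\<epsilon>\<^esub> emb a = op_id"
    using assms by (auto simp: emb_mult op_id_emb)
next
  fix B :: op
  assume B: "(\<exists>N. \<forall>k>N. \<forall>m. B k m = 0) \<and> emb a \<odot>\<^bsub>\<epsilon>\<^esub> B = op_id \<and> B \<odot>\<^bsub>\<epsilon>\<^esub> emb a = op_id"
  show "B = emb b"
    by (rule right_inverse_unique[OF assms(1,2,4)]) (use B in auto)
qed

lemma inv_up_emb:
  assumes "half_bounded False a" "half_bounded False b" "a \<star> b = unit_op" "b \<star> a = unit_op"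
  shows "inv_up \<epsilon> (emb a) = emb b"
  unfolding inv_up_def
proof (rule the_equality)
  obtain N where "bounded_by False N b" using assms(2) by (auto simp: half_bounded_def)
  then have "\<forall>k < - N. \<forall>m. emb b k m = 0" using bdD[of False N b] by (auto simp: op1_def)
  then show "(\<exists>N. \<forall>k<N. \<forall>m. emb b k m = 0) \<and>
      emb a \<odot>\<^bsub>\<epsilon>\<^esub> emb b = op_id \<and> emb b \<odot>\<^bsub>\<epsilon>\<^esub> emb a = op_id"
    using assms by (auto simp: emb_mult op_id_emb)
next
  fix B :: op
  assume B: "(\<exists>N. \<forall>k<N. \<forall>m. B k m = 0) \<and> emb a \<odot>\<^bsub>\<epsilon>\<^esub> B = op_id \<and> B \<odot>\<^bsub>\<epsilon>\<^esub> emb a = op_id"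
  then obtain N where "\<forall>k<N. \<forall>m. B k m = 0" by blast
  \<comment> \<open>A lower bound \<open>N\<close> on exponents is the upper bound
    \<open>- N\<close> on the negated ones, which is how direction \<open>False\<close> measures
    them.\<close>
  then have "\<forall>k m. - N < dir_sign False * k \<longrightarrow> B k m = 0" by auto
  then have "\<exists>N. \<forall>k m. N < dir_sign False * k \<longrightarrow> B k m = 0" by (rule exI)
  then show "B = emb b" using B
    by (intro right_inverse_unique[OF assms(1,2,4)]) blast+
qed

lemma dmul_algebra:
  assumes "half_bounded d a" "half_bounded d b" "half_bounded d c"
  shows "a \<star> b \<star> c = a \<star> (b \<star> c)"
    "a \<star> (b + c) = a \<star> b + a \<star> c" "(a + b) \<star> c = a \<star> c + b \<star> c"
    "a \<star> (b - c) = a \<star> b - a \<star> c" "(a - b) \<star> c = a \<star> c - b \<star> c"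
  using assms by (simp_all add: dmul_assoc[of d] dmul_add_left dmul_add_right dmul_diff_left
      dmul_diff_right multipliable_half_bounded[of d])

lemmas half_bounded_intros = half_bounded_0 half_bounded_dmono half_bounded_add half_bounded_uminus
    half_bounded_diff half_bounded_dscale half_bounded_dmul half_bounded_dderiv
lemmas smooth_op_intros = smooth_op_0 smooth_op_dmono smooth_op_add smooth_op_uminus smooth_op_diff
    smooth_op_dscale smooth_op_dmul smooth_op_dderiv

lemma finite_op_add: "finite_op a \<Longrightarrow> finite_op b \<Longrightarrow> finite_op (a + b)"
  and finite_op_diff: "finite_op a \<Longrightarrow> finite_op b \<Longrightarrow> finite_op (a - b)"
  and finite_op_dmono: "finite_op (dmono f n)"
  and finite_op_dscale: "finite_op a \<Longrightarrow> finite_op (dscale c a)"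
  and finite_op_dderiv: "finite_op a \<Longrightarrow> finite_op (dderiv i a)"
  by (auto simp: finite_op_def half_bounded_intros)

lemma finite_op_dpow: "finite_op a \<Longrightarrow> finite_op (dpow a n)"
  by (induction n) (auto simp: finite_op_dmono finite_op_dmul)

lemma half_bounded_pos_part: "half_bounded False (pos_part a)"
  and bounded_by_neg_part: "bounded_by True (- 1) (neg_part a)"
  by (auto simp: half_bounded_def bounded_by_def pos_part_def neg_part_def intro: exI[of _ 0])

lemma bounded_by_pos_part: "bounded_by False 0 (pos_part a)"
  by (auto simp: bounded_by_def pos_part_def)

lemma half_bounded_neg_part: "half_bounded True (neg_part a)"
  by (rule bounded_by_half_bounded[OF bounded_by_neg_part])

lemma pos_neg_part: "pos_part a + neg_part a = a"
  by (auto simp: pos_part_def neg_part_def fun_eq_iff[where ?'a = int])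

section \<open>The Darboux operator\<close>

definition darboux_coeff :: "sfun \<Rightarrow> sfun" where
  "darboux_coeff \<phi> = \<phi> * fun_inv (shift \<epsilon> (- 1) \<phi>)"

definition darboux_dop :: "sfun \<Rightarrow> dop" where
  "darboux_dop \<phi> = unit_op - dmono (darboux_coeff \<phi>) (- 1)"

lemma darboux_emb: "darboux \<epsilon> \<phi> = emb (darboux_dop \<phi>)"
proof -
  have "(\<lambda>p. \<phi> p * s2_inv (shift \<epsilon> (- 1) \<phi> p)) = darboux_coeff \<phi>"
    by (simp add: darboux_coeff_def fun_inv_def fun_eq_iff)
  then show ?thesis
    by (simp add: darboux_def darboux_dop_def op_id_emb op_fun_emb Lam_emb emb_mult dmono_dmono
        op1_diff)
qed

lemma bounded_by_darboux_dop: "bounded_by True 0 (darboux_dop \<phi>)"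
    "bounded_by False 1 (darboux_dop \<phi>)"
  unfolding darboux_dop_def by (intro bounded_by_diff bounded_by_dmono; simp)+

lemma finite_op_darboux_dop: "finite_op (darboux_dop \<phi>)"
  unfolding darboux_dop_def by (intro finite_op_diff finite_op_dmono)

lemma smooth_op_darboux_dop: "smooth_fun \<phi> \<Longrightarrow> pointwise_invertible \<phi> \<Longrightarrow> smooth_op (darboux_dop \<phi>)"
  unfolding darboux_dop_def darboux_coeff_def
  by (intro smooth_op_intros smooth_fun_intros smooth_fun_inv pointwise_invertible_shift)

text \<open>The leading coefficient 1 is constant, so the derivative has only negative exponents, as
  \<open>darboux_evolution\<close> requires.\<close>

lemma dderiv_darboux_dop: "dderiv i (darboux_dop \<phi>) = dmono (eder \<epsilon> i (- darboux_coeff \<phi>)) (- 1)"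
  by (auto simp: darboux_dop_def dderiv_def dmono_def fun_eq_iff[where ?'a = int])

text \<open>The sign is kept because \<open>- darboux_coeff \<phi>\<close> is the lowest coefficient
  of the Darboux operator, by which the upward inverse divides.\<close>

lemma pointwise_invertible_darboux_coeff:
  assumes "pointwise_invertible \<phi>"
  shows "pointwise_invertible (- darboux_coeff \<phi>)"
proof (rule pointwise_invertibleI)
  have "fun_inv (shift \<epsilon> (- 1) \<phi>) * shift \<epsilon> (- 1) \<phi> = 1" "\<phi> * fun_inv \<phi> = 1"
    by (simp_all add: fun_inv_left fun_inv_right pointwise_invertible_shift assms)
  then show "- darboux_coeff \<phi> * - (shift \<epsilon> (- 1) \<phi> * fun_inv \<phi>) = 1"
    unfolding darboux_coeff_def by (simp only: minus_mult_minus) (metis mult.assoc mult_1)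
qed

lemma dapply_dmono: "dapply (dmono f n) g = f * shift \<epsilon> n g"
  by (simp add: dapply_def dmono_dmul)

lemma dapply_darboux_dop:
  assumes "pointwise_invertible \<phi>"
  shows "dapply (darboux_dop \<phi>) \<phi> = 0"
proof -
  have "fun_inv (shift \<epsilon> (- 1) \<phi>) * shift \<epsilon> (- 1) \<phi> = 1"
    by (simp add: fun_inv_left pointwise_invertible_shift assms)
  then show ?thesis
    unfolding darboux_dop_def
    by (simp add: dapply_diff finite_op_dmono dapply_dmono darboux_coeff_def mult.assoc)
qed

text \<open>The Darboux operator has the exponents 0 and -1. Downwards it is led by Lambda^0, so
  \<open>wd\<close> starts at Lambda^0; upwards by Lambda^(-1), so \<open>wu\<close> starts at
  Lambda^1.\<close>

lemma darboux_dop_inverses: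
  assumes "smooth_fun \<phi>" "pointwise_invertible \<phi>"
  obtains wd wu where
    "bounded_by True 0 wd" "smooth_op wd" "darboux_dop \<phi> \<star> wd = unit_op" "wd \<star> darboux_dop \<phi>
        = unit_op"
    "bounded_by False (- 1) wu" "smooth_op wu" "darboux_dop \<phi> \<star> wu = unit_op" "wu \<star> darboux_dop \<phi>
        = unit_op"
proof
  have l: "pointwise_invertible (darboux_dop \<phi> (dir_sign True * 0))"
      "pointwise_invertible (darboux_dop \<phi> (dir_sign False * 1))"
    using pointwise_invertible_darboux_coeff[OF assms(2)] pointwise_invertibleI[of 1 1]
    by (simp_all add: darboux_dop_def dmono_def)
  show "bounded_by True 0 (rinv True 0 (darboux_dop \<phi>))"
    using bounded_by_rinv[of True 0 "darboux_dop \<phi>"] by simp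
  show "bounded_by False (- 1) (rinv False 1 (darboux_dop \<phi>))" by (rule bounded_by_rinv)
  show "smooth_op (rinv True 0 (darboux_dop \<phi>))" "smooth_op (rinv False 1 (darboux_dop \<phi>))"
    by (rule smooth_op_rinv[OF smooth_op_darboux_dop[OF assms] l(1)], rule smooth_op_rinv[OF
        smooth_op_darboux_dop[OF assms] l(2)])
  show "darboux_dop \<phi> \<star> rinv True 0 (darboux_dop \<phi>) = unit_op"
      "rinv True 0 (darboux_dop \<phi>) \<star> darboux_dop \<phi> = unit_op"
    by (rule dmul_rinv[OF bounded_by_darboux_dop(1) l(1)], rule rinv_dmul[OF
        bounded_by_darboux_dop(1) l(1)])
  show "darboux_dop \<phi> \<star> rinv False 1 (darboux_dop \<phi>) = unit_op"
      "rinv False 1 (darboux_dop \<phi>) \<star> darboux_dop \<phi> = unit_op"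
    by (rule dmul_rinv[OF bounded_by_darboux_dop(2) l(2)], rule rinv_dmul[OF
        bounded_by_darboux_dop(2) l(2)])
qed

(* Conjugation by phi turns the Darboux operator into 1 - Lambda^(-1) and the kernel condition into
   the vanishing of the sum of the coefficients of a; the quotient has the partial sums as
   coefficients. *)
lemma darboux_dop_right_factor:
  assumes a: "finite_op a" and inv: "pointwise_invertible \<phi>" and ker: "dapply a \<phi> = 0"
  obtains c where "finite_op c" "a = c \<star> darboux_dop \<phi>"
proof
  let ?S = "{k. a k \<noteq> 0}"
  define s where "s n = (\<Sum>k\<in>{k \<in> ?S. n \<le> k}. a k * shift \<epsilon> k \<phi>)" for n
  define c where "c n = fun_inv (shift \<epsilon> n \<phi>) * s n" for n
  have S: "finite ?S" by (rule finite_op_finite[OF a])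
  have total: "(\<Sum>k\<in>?S. a k * shift \<epsilon> k \<phi>) = 0"
    using ker dmul_eq_sum[OF S, of a "\<lambda>_. \<phi>" 0] by (simp add: dapply_def)
  \<comment> \<open>Finiteness of the quotient: above the largest exponent of \<open>a\<close> the
    tail sum \<open>s n\<close> is empty, and at or below the smallest one it is the full sum, zero
    by the kernel condition.\<close>
  have "{n. c n \<noteq> 0} \<subseteq> (\<Union>k\<in>?S. \<Union>k'\<in>?S. {k'..k})"
  proof
    fix n assume "n \<in> {n. c n \<noteq> 0}"
    then have n: "s n \<noteq> 0" by (auto simp: c_def)
    have "\<exists>k\<in>?S. n \<le> k"
    proof (rule ccontr)
      assume "\<not> (\<exists>k\<in>?S. n \<le> k)"
      then have e: "{k \<in> ?S. n \<le> k} = {}" by blast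
      have "s n = 0" unfolding s_def e by (rule sum.empty)
      with n show False by contradiction
    qed
    moreover have "\<exists>k\<in>?S. \<not> n \<le> k"
    proof (rule ccontr)
      assume "\<not> (\<exists>k\<in>?S. \<not> n \<le> k)"
      then have e: "{k \<in> ?S. n \<le> k} = ?S" by blast
      have "s n = 0" unfolding s_def e by (rule total)
      with n show False by contradiction
    qed
    ultimately show "n \<in> (\<Union>k\<in>?S. \<Union>k'\<in>?S. {k'..k})" by force
  qed
  moreover have "finite (\<Union>k\<in>?S. \<Union>k'\<in>?S. {k'..k})" using S by blast
  ultimately show c: "finite_op c" by (intro finite_finite_op) (rule finite_subset)
  have inv': "shift \<epsilon> n \<phi> * fun_inv (shift \<epsilon> n \<phi>) = 1" for n
    by (simp add: fun_inv_right pointwise_invertible_shift inv)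
  have step: "s n = a n * shift \<epsilon> n \<phi> + s (n + 1)" for n
  proof (cases "a n = 0")
    case True
    have e: "{k \<in> ?S. n \<le> k} = {k \<in> ?S. n + 1 \<le> k}"
    proof (intro Collect_cong)
      fix k show "(k \<in> ?S \<and> n \<le> k) = (k \<in> ?S \<and> n + 1 \<le> k)"
        using True by (cases "k = n") auto
    qed
    show ?thesis unfolding s_def e using True by simp
  next
    case False
    then have e: "{k \<in> ?S. n \<le> k} = insert n {k \<in> ?S. n + 1 \<le> k}" by auto
    show ?thesis unfolding s_def e by (rule sum.insert) (use S in auto)
  qed
  show "a = c \<star> darboux_dop \<phi>"
  proof
    fix n
    have "(c \<star> darboux_dop \<phi>) n = c n - c (n + 1) * shift \<epsilon> (n + 1) (darboux_coeff \<phi>)"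
      using c by (simp add: darboux_dop_def dmul_diff_right multipliable_finite_op dmul_dmono
          dmul_unit)
    also have "c (n + 1) * shift \<epsilon> (n + 1) (darboux_coeff \<phi>)
        = s (n + 1) * (shift \<epsilon> (n + 1) \<phi> * fun_inv (shift \<epsilon> (n + 1) \<phi>)) * fun_inv (shift \<epsilon> n \<phi>)"
      by (simp add: c_def darboux_coeff_def shift_fun_inv mult_ac)
    also have "c n - \<dots> = (s n - s (n + 1)) * fun_inv (shift \<epsilon> n \<phi>)"
      unfolding inv' by (simp add: c_def mult.commute right_diff_distrib)
    also have "\<dots> = a n"
      unfolding step[of n] by (simp add: mult.assoc inv')
    finally show "a n = (c \<star> darboux_dop \<phi>) n" by simp
  qed
qed

(* gamma is the coefficient of eps d/dx in the operator of the wave equation; beta = gamma = 0 gives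
   the t-flows. *)
lemma darboux_evolution:
  assumes phi: "smooth_fun \<phi>" "pointwise_invertible \<phi>"
    and w: "w = darboux_dop \<phi>"
    and al: "half_bounded True \<alpha>" "half_bounded True \<alpha>1" and be: "half_bounded False \<beta>"
        "half_bounded False \<beta>1"
    and ga: "finite_op \<gamma>" "finite_op \<gamma>1"
    and al_w: "\<alpha>1 \<star> w = w \<star> \<alpha> - \<gamma>1 \<star> dderiv X w"
    and be_w: "\<beta>1 \<star> w = w \<star> \<beta> + \<gamma>1 \<star> dderiv X w"
    and ga_w: "\<gamma>1 \<star> w = w \<star> \<gamma>"
    and wave: "eder \<epsilon> i \<phi> = dapply (\<alpha> - neg_part (\<alpha> + \<beta>)) \<phi> + dapply \<gamma> (eder \<epsilon> X \<phi>)"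
  shows "dderiv i w + w \<star> pos_part (\<alpha> + \<beta>) = pos_part (\<alpha>1 + \<beta>1) \<star> w"
    and "dderiv i w - w \<star> neg_part (\<alpha> + \<beta>) = - (neg_part (\<alpha>1 + \<beta>1) \<star> w)"
proof -
  define E where "E = \<alpha> - neg_part (\<alpha> + \<beta>)"
  let ?D = "dderiv i w" and ?X = "dderiv X w"
  have E': "E = pos_part (\<alpha> + \<beta>) - \<beta>"
    using pos_neg_part[of "\<alpha> + \<beta>"] unfolding E_def by (simp add: algebra_simps)
  have finw: "finite_op w" and smw: "smooth_op w" and dw: "finite_op ?D" "finite_op ?X"
    using finite_op_darboux_dop smooth_op_darboux_dop phi w by (auto simp: finite_op_dderiv)
  have wb: "half_bounded d w" "half_bounded d ?D" "half_bounded d ?X" "half_bounded d \<gamma>1" for d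
    using finw dw ga by (auto simp: finite_op_half_bounded)
  \<comment> \<open>The two expressions for \<open>E\<close> bound it from opposite sides: \<alpha>
    - G_- from above and G_+ - \<beta> from below.\<close>
  have finE: "finite_op E"
    unfolding finite_op_def using al be half_bounded_pos_part half_bounded_neg_part
    by (metis E_def E' half_bounded_diff)
  have Eb: "half_bounded d E" for d by (rule finite_op_half_bounded[OF finE])
  have w0: "dapply w \<phi> = 0" using dapply_darboux_dop phi w by simp
  have "dapply ?D \<phi> + dapply w (eder \<epsilon> i \<phi>) = 0"
    using eder_dapply[OF finw smw phi(1), of i] by (simp add: w0)
  then have Dphi: "dapply ?D \<phi> + dapply w (dapply E \<phi>) + dapply w (dapply \<gamma> (eder \<epsilon> X \<phi>)) = 0"
    using finw unfolding wave E_def[symmetric] by (simp add: dapply_add_arg add.assoc)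
  \<comment> \<open>Differentiating W \<phi> = 0 in x trades W \<phi>_x for - W_x \<phi>. This
    removes eps d/dx, so that a pure difference operator annihilates \<phi> and can be divided by
    W.\<close>
  have Xphi: "dapply w (eder \<epsilon> X \<phi>) = 0 - dapply ?X \<phi>"
    using eder_dapply[OF finw smw phi(1), of X] by (simp add: w0 eq_neg_iff_add_eq_0 add.commute)
  have "dapply w (dapply \<gamma> (eder \<epsilon> X \<phi>)) = dapply \<gamma>1 (dapply w (eder \<epsilon> X \<phi>))"
    using finw ga ga_w by (metis dapply_dmul)
  also have "\<dots> = - dapply \<gamma>1 (dapply ?X \<phi>)"
    unfolding Xphi using ga by (simp only: dapply_diff_arg dapply_0) simp
  finally have "dapply (?D + w \<star> E - \<gamma>1 \<star> ?X) \<phi> = 0"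
    using Dphi finw dw finE ga by (simp add: dapply_diff dapply_add dapply_dmul finite_op_add
        finite_op_dmul)
  then obtain c where c: "finite_op c" "?D + w \<star> E - \<gamma>1 \<star> ?X = c \<star> w"
    using darboux_dop_right_factor[of "?D + w \<star> E - \<gamma>1 \<star> ?X" \<phi>] phi finw dw finE ga w
    by (auto simp: finite_op_add finite_op_diff finite_op_dmul)
  have cb: "half_bounded d c" for d by (rule finite_op_half_bounded[OF c(1)])
  let ?N = "neg_part (\<alpha> + \<beta>)" and ?P = "pos_part (\<alpha> + \<beta>)"
  have R1: "(c - \<alpha>1) \<star> w = ?D - w \<star> ?N"
  proof -
    have e1: "w \<star> E = w \<star> \<alpha> - w \<star> ?N"
      unfolding E_def by (rule dmul_algebra(4)[of True]) (simp_all add: wb al half_bounded_neg_part)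
    have e2: "(c - \<alpha>1) \<star> w = c \<star> w - \<alpha>1 \<star> w"
      by (rule dmul_algebra(5)[of True]) (simp_all add: wb al cb)
    show ?thesis unfolding e2 c(2)[symmetric] al_w e1 by (simp add: algebra_simps)
  qed
  have R2: "(c + \<beta>1) \<star> w = ?D + w \<star> ?P"
  proof -
    have e1: "w \<star> E = w \<star> ?P - w \<star> \<beta>"
      unfolding E' by (rule dmul_algebra(4)[of False]) (simp_all add: wb be half_bounded_pos_part)
    have e2: "(c + \<beta>1) \<star> w = c \<star> w + \<beta>1 \<star> w"
      by (rule dmul_algebra(3)[of False]) (simp_all add: wb be cb)
    show ?thesis unfolding e2 c(2)[symmetric] be_w e1 by (simp add: algebra_simps)
  qed
  obtain wd wu where wd: "bounded_by True 0 wd" "w \<star> wd = unit_op" and wu: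
      "bounded_by False (- 1) wu" "w \<star> wu = unit_op"
    using darboux_dop_inverses[OF phi] w by metis
  \<comment> \<open>\<open>?D - w \<star> ?N\<close> has negative exponents only, and
    \<open>wd\<close> starts at Lambda^0, so \<open>c - \<alpha>1\<close> has negative exponents
    only.\<close>
  have e: "(c - \<alpha>1) \<star> w \<star> wd = c - \<alpha>1"
    by (subst dmul_algebra(1)[of True]) (simp_all add: wb al cb wd bounded_by_half_bounded[OF
        wd(1)] half_bounded_diff dmul_unit)
  have "bounded_by True (- 1 + 0) ((c - \<alpha>1) \<star> w \<star> wd)"
    unfolding R1
  proof (intro bounded_by_dmul bounded_by_diff wd(1))
    show "bounded_by True (- 1) ?D" unfolding w dderiv_darboux_dop by (rule bounded_by_dmono) simp
    show "bounded_by True (- 1) (w \<star> ?N)"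
      using bounded_by_dmul[OF bounded_by_darboux_dop(1) bounded_by_neg_part] w by fastforce
  qed
  then have neg: "c k = \<alpha>1 k" if "k \<ge> 0" for k
    using bdD[of True "- 1" "c - \<alpha>1" k] that unfolding e by simp
  \<comment> \<open>\<open>?D + w \<star> ?P\<close> reaches down to Lambda^(-1), but
    \<open>wu\<close> starts at Lambda^1. The offsets cancel, so \<open>c + \<beta>1\<close> has no
    negative exponents.\<close>
  have e: "(c + \<beta>1) \<star> w \<star> wu = c + \<beta>1"
    by (subst dmul_algebra(1)[of False]) (simp_all add: wb be cb wu bounded_by_half_bounded[OF
        wu(1)] half_bounded_add dmul_unit)
  have "bounded_by False (1 + - 1) ((c + \<beta>1) \<star> w \<star> wu)"
    unfolding R2
  proof (intro bounded_by_dmul bounded_by_add wu(1))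
    show "bounded_by False 1 ?D" unfolding w by (rule bounded_by_dderiv[OF
        bounded_by_darboux_dop(2)])
    show "bounded_by False 1 (w \<star> ?P)"
      using bounded_by_dmul[OF bounded_by_darboux_dop(2) bounded_by_pos_part] w by fastforce
  qed
  then have pos: "c k + \<beta>1 k = 0" if "k < 0" for k
    using bdD[of False 0 "c + \<beta>1" k] that unfolding e by simp
  have "pos_part (\<alpha>1 + \<beta>1) = c + \<beta>1"
    by (auto simp: pos_part_def neg pos fun_eq_iff[where ?'a = int])
  with R2 show "?D + w \<star> ?P = pos_part (\<alpha>1 + \<beta>1) \<star> w" by simp
  have "neg_part (\<alpha>1 + \<beta>1) = - (c - \<alpha>1)"
    using neg pos by (auto simp: neg_part_def fun_eq_iff[where ?'a
        = int] eq_neg_iff_add_eq_0 add.commute)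
  with R1 show "?D - w \<star> ?N = - (neg_part (\<alpha>1 + \<beta>1) \<star> w)"
    by (simp only: dmul_uminus minus_minus)
qed

section \<open>Solutions of the hierarchy\<close>

text \<open>The two inverses are carried as arguments, so that the descriptions in
  \<open>inv_down\<close> and \<open>inv_up\<close> are replaced by equations.\<close>

definition dressed :: "dop \<Rightarrow> dop \<Rightarrow> dop \<Rightarrow> dop \<Rightarrow> dop \<Rightarrow> bool" where
  "dressed p ip q iq l \<longleftrightarrow> smooth_op p \<and> smooth_op ip \<and> smooth_op q \<and> smooth_op iq \<and>
    bounded_by True 0 p \<and> bounded_by True 0 ip \<and> bounded_by False 0 q \<and> bounded_by False 0 iq \<and>
    p 0 = 1 \<and> pointwise_invertible (q 0) \<and>
    p \<star> ip = unit_op \<and> ip \<star> p = unit_op \<and> q \<star> iq = unit_op \<and> iq \<star> q = unit_op \<and>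
    l = p \<star> lam 1 \<star> ip \<and> l = q \<star> lam (- 1) \<star> iq"

lemma dressedD:
  assumes "dressed p ip q iq l"
  shows "smooth_op p" "smooth_op ip" "smooth_op q" "smooth_op iq" "bounded_by True 0 p"
      "bounded_by True 0 ip" "bounded_by False 0 q" "bounded_by False 0 iq"
    "p 0 = 1" "pointwise_invertible (q 0)"
    "p \<star> ip = unit_op" "ip \<star> p = unit_op" "q \<star> iq = unit_op" "iq \<star> q = unit_op"
    "l = p \<star> lam 1 \<star> ip" "l = q \<star> lam (- 1) \<star> iq"
    "half_bounded True p" "half_bounded True ip" "half_bounded False q" "half_bounded False iq"
  using assms bounded_by_half_bounded unfolding dressed_def by blast+

text \<open>The factorisation through \<open>p\<close> bounds the exponents from above by 1, the one
  through \<open>q\<close> from below by -1; their agreement makes \<open>l\<close> finite.\<close>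

lemma dressed_lax:
  assumes "dressed p ip q iq l"
  shows "bounded_by True 1 l" "bounded_by False 1 l" "finite_op l" "smooth_op l" "half_bounded d l"
proof -
  note D = dressedD[OF assms]
  have "bounded_by True (0 + 1 + 0) (p \<star> lam 1 \<star> ip)"
      by (intro bounded_by_dmul bounded_by_dmono D) simp
  with D(15) show 1: "bounded_by True 1 l" by simp
  have "bounded_by False (0 + 1 + 0) (q \<star> lam (- 1) \<star> iq)"
      by (intro bounded_by_dmul bounded_by_dmono D) simp
  with D(16) show 2: "bounded_by False 1 l" by simp
  show 3: "finite_op l" using bounded_by_half_bounded[OF 1] bounded_by_half_bounded[OF 2]
      by (simp add: finite_op_def)
  then show "half_bounded d l" by (rule finite_op_half_bounded)
  show "smooth_op l" unfolding D(15) by (intro smooth_op_intros smooth_fun_1 D)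
qed

lemma inv_dressed:
  assumes "dressed p ip q iq l"
  shows "inv_down \<epsilon> (emb p) = emb ip" "inv_up \<epsilon> (emb q) = emb iq"
  using dressedD[OF assms] by (simp_all add: inv_down_emb inv_up_emb)

lemma lax_dressed:
  assumes "dressed p ip q iq l"
  shows "lax \<epsilon> (emb p) = emb l" "lax_bar \<epsilon> (emb q) = emb l"
  using dressedD(15,16)[OF assms]
  by (simp_all add: lax_def lax_bar_def inv_dressed[OF assms] Lam_emb emb_mult)

text \<open>With D = eps d/dx, P D P^(-1) = D + P (P^(-1))_x, and in the same way for Q.\<close>

lemma log_dressed:
  assumes "dressed p ip q iq l"
  shows "log_plus \<epsilon> (emb p) = op1 (p \<star> dderiv X ip) unit_op"
    "log_minus \<epsilon> (emb q) = op1 (- (q \<star> dderiv X iq)) (- unit_op)"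
proof -
  note D = dressedD[OF assms]
  show "log_plus \<epsilon> (emb p) = op1 (p \<star> dderiv X ip) unit_op"
    unfolding log_plus_def inv_dressed[OF assms] op_edx_op1 emb_op1_mult
    by (subst op1_emb_mult[of True]) (simp_all add: half_bounded_intros D dmul_0 dmul_unit)
  show "log_minus \<epsilon> (emb q) = op1 (- (q \<star> dderiv X iq)) (- unit_op)"
    unfolding log_minus_def inv_dressed[OF assms] op_edx_op1 emb_op1_mult
    by (subst op1_emb_mult[of False]) (simp_all add: half_bounded_intros D dmul_0 dmul_unit
        op1_uminus)
qed

section \<open>The generators of the flows\<close>

definition B_dop :: "dop \<Rightarrow> nat \<Rightarrow> dop" where
  "B_dop l j = dscale (1 / fact (j + 1)) (dpow l (j + 1))"

(* For m the part of log_+ L or log_- L free of eps d/dx, this is the part of L^j (log L - c_j) / j!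
   free of eps d/dx. *)
definition A_dop :: "dop \<Rightarrow> dop \<Rightarrow> nat \<Rightarrow> dop" where
  "A_dop l m j = dscale (1 / fact j) (dpow l j \<star> (m - dscale (harm j) unit_op))"

lemma B_op_emb: "B_op \<epsilon> (emb l) j = emb (B_dop l j)"
  unfolding B_op_def B_dop_def op_pow_emb op_scale_op1 by (simp add: dscale_def fun_eq_iff op1_def)

lemma dscale_apply:
  "ent0 (dscale c a k p) = c * ent0 (a k p)" "ent1 (dscale c a k p) = c * ent1 (a k p)"
  by (simp_all add: dscale_def scal_def)

lemma dop_eqI: "(\<And>k p. a k p = b k p) \<Longrightarrow> (a :: dop) = b"
  by (intro ext)

text \<open>The terms eps d/dx cancel. The factor 2 turns the mean of the two logarithms into their
  sum and leaves each of them one copy of c_j.\<close>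

lemma F_op_emb:
  assumes "finite_op l"
  shows "F_op \<epsilon> (emb l) (op1 x unit_op) (op1 y (- unit_op)) j = emb (A_dop l x j + A_dop l y j)"
proof -
  let ?g = "dpow l j"
  have g: "multipliable ?g a" for a by (intro multipliable_finite_op finite_op_dpow assms)
  have 0: "dscale c 0 = 0" for c by (simp add: dscale_def fun_eq_iff)
  have "F_op \<epsilon> (emb l) (op1 x unit_op) (op1 y (- unit_op)) j =
      emb (dscale (2 / fact j) (?g \<star> (dscale (1 / 2) (x + y) - dscale (harm j) unit_op)))"
    unfolding F_op_def op_pow_emb op_id_emb op1_add op_scale_op1 op1_diff emb_op1_mult
    by (simp add: 0 dmul_0)
  also have "dscale (2 / fact j) (?g \<star> (dscale (1 / 2) (x + y) - dscale (harm j) unit_op))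
      = A_dop l x j + A_dop l y j"
    unfolding A_dop_def
    by (rule dop_eqI)
      (simp add: dmul_diff_right dmul_add_right dmul_dscale_right g dmul_unit s2_eq_iff dscale_apply
        algebra_simps)
  finally show ?thesis .
qed

text \<open>This displays the \<open>\<alpha>\<close> and the \<open>\<gamma>\<close> with which
  \<open>darboux_evolution\<close> is applied to the y-flows.\<close>

lemma wave_op_emb:
  "op_scale (1 / fact j) (op_pow \<epsilon> (emb l) j \<odot>\<^bsub>\<epsilon>\<^esub> (op1 x unit_op - op_scale (harm j) op_id))
     = op1 (A_dop l x j) (dscale (1 / fact j) (dpow l j))"
proof -
  have 0: "dscale c 0 = 0" for c by (simp add: dscale_def fun_eq_iff)
  show ?thesis
    unfolding op_pow_emb op_id_emb op_scale_op1 op1_diff emb_op1_mult A_dop_def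
    by (simp add: 0 dmul_unit)
qed

text \<open>One Sato flow with an arbitrary generator, so that the t-flows and the y-flows are
  treated alike.\<close>

definition evolves :: "coord \<Rightarrow> dop \<Rightarrow> dop \<Rightarrow> dop \<Rightarrow> bool" where
  "evolves i G p q \<longleftrightarrow> dderiv i p = - (neg_part G \<star> p) \<and> dderiv i q = pos_part G \<star> q"

definition F_dop :: "dop \<Rightarrow> dop \<Rightarrow> dop \<Rightarrow> dop \<Rightarrow> dop \<Rightarrow> nat \<Rightarrow> dop" where
  "F_dop p ip q iq l j = A_dop l (p \<star> dderiv X ip) j + A_dop l (- (q \<star> dderiv X iq)) j"

lemma F_op_dressed:
  assumes "dressed p ip q iq l"
  shows "F_op \<epsilon> (emb l) (log_plus \<epsilon> (emb p)) (log_minus \<epsilon> (emb q)) j = emb (F_dop p ip q iq l j)"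
  unfolding log_dressed[OF assms] F_dop_def
  by (rule F_op_emb[OF dressed_lax(3)[OF assms]])

lemma emb_eq_iff: "emb x = emb y \<longleftrightarrow> x = y"
  by (simp add: op1_inject)

lemma emb_uminus: "- emb x = emb (- x)"
  by (simp add: op1_uminus)

lemma sceth_solution_emb_iff:
  assumes "dressed p ip q iq l"
  shows "sceth_solution \<epsilon> (emb p) (emb q) \<longleftrightarrow>
    (\<forall>j. evolves (T j) (B_dop l j) p q \<and> evolves (Y j) (F_dop p ip q iq l j) p q)"
proof -
  note D = dressedD[OF assms]
  have "dressing (emb p)" "dressing_bar (emb q)"
    using D(1,3,9,10) bdD[OF D(5)] bdD[OF D(7)]
    by (auto simp: dressing_def dressing_bar_def op1_def smooth_op_def)
  then show ?thesis
    unfolding sceth_solution_def Let_def lax_dressed[OF assms] F_op_dressed[OF assms] B_op_emb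
      op_plus_emb op_minus_emb op_eder_emb emb_mult emb_uminus emb_eq_iff evolves_def
    by blast
qed

text \<open>The dressing conditions make the leading coefficients invertible (1 for P,
  \<open>Q 0 0\<close> for Q), so \<open>rinv\<close> supplies both inverses.\<close>

lemma sceth_solution_dressed:
  assumes "sceth_solution \<epsilon> P Q"
  obtains p ip q iq l where "P = emb p" "Q = emb q" "dressed p ip q iq l"
proof -
  define p where "p = (\<lambda>k. P k 0)"
  define q where "q = (\<lambda>k. Q k 0)"
  have P: "P 0 0 = 1" "\<And>k m. k > 0 \<or> m > 0 \<Longrightarrow> P k m = 0" "\<And>k. smooth_fun (P k 0)"
    and Q: "pointwise_invertible (Q 0 0)" "\<And>k m. k < 0 \<or> m > 0 \<Longrightarrow> Q k m = 0" "\<And>k. smooth_fun (Q k 0)"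
    and L: "lax \<epsilon> P = lax_bar \<epsilon> Q"
    using assms unfolding sceth_solution_def dressing_def dressing_bar_def by blast+
  have PQ: "P = emb p" "Q = emb q"
    using P(2) Q(2) by (auto simp: fun_eq_iff p_def q_def op1_def)
  have smooth_op: "smooth_op p" "smooth_op q" using P(3) Q(3)
      by (auto simp: smooth_op_def p_def q_def)
  have bounded_by: "bounded_by True 0 p" "bounded_by False 0 q"
    using P(2) Q(2) by (auto simp: p_def q_def intro!: bdI)
  have inv: "pointwise_invertible (p (dir_sign True * 0))"
      "pointwise_invertible (q (dir_sign False * 0))"
    using P(1) Q(1) pointwise_invertibleI[of 1 1] by (auto simp: p_def q_def)
  let ?ip = "rinv True 0 p" and ?iq = "rinv False 0 q"
  have bdi: "bounded_by True 0 ?ip" "bounded_by False 0 ?iq"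
    using bounded_by_rinv[of True 0 p] bounded_by_rinv[of False 0 q] by simp_all
  note I = dmul_rinv[OF bounded_by(1) inv(1)] rinv_dmul[OF bounded_by(1) inv(1)]
    dmul_rinv[OF bounded_by(2) inv(2)] rinv_dmul[OF bounded_by(2) inv(2)]
  have "inv_down \<epsilon> P = emb ?ip" "inv_up \<epsilon> Q = emb ?iq"
    unfolding PQ
    by (rule inv_down_emb[OF bounded_by_half_bounded[OF bounded_by(1)] bounded_by_half_bounded[OF
        bdi(1)] I(1,2)],
        rule inv_up_emb[OF bounded_by_half_bounded[OF bounded_by(2)] bounded_by_half_bounded[OF
            bdi(2)] I(3,4)])
  then have "p \<star> lam 1 \<star> ?ip = q \<star> lam (- 1) \<star> ?iq"
    using L by (simp add: lax_def lax_bar_def PQ Lam_emb emb_mult emb_eq_iff)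
  then have "dressed p ?ip q ?iq (p \<star> lam 1 \<star> ?ip)"
    unfolding dressed_def
    using smooth_op bounded_by bdi I smooth_op_rinv[OF smooth_op(1) inv(1)] smooth_op_rinv[OF
        smooth_op(2) inv(2)] P(1) Q(1)
    by (simp add: p_def q_def)
  with PQ that show ?thesis by blast
qed

(* For the y-flows G is infinite in both directions and [G, l] = 0 is not available, so the equation
   for q is used, which only involves the part of G bounded below. *)
lemma lax_equation:
  assumes dr: "dressed p ip q iq l" and ev: "dderiv i q = pos_part G \<star> q"
  shows "dderiv i l = pos_part G \<star> l - l \<star> pos_part G"
proof -
  note D = dressedD[OF dr]
  let ?G = "pos_part G"
  have b: "half_bounded False l" "half_bounded False (dderiv i l)" "half_bounded False ?G"
      "half_bounded False q" "half_bounded False iq" "half_bounded False (lam n)" for n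
    using dressed_lax(5)[OF dr] D by (simp_all add: half_bounded_intros half_bounded_pos_part)
  \<comment> \<open>Differentiating this relation instead of the factorisation of \<open>l\<close>
    avoids the derivative of \<open>iq\<close>.\<close>
  have lq: "l \<star> q = q \<star> lam (- 1)"
    unfolding D(16) by (simp add: dmul_algebra(1)[of False] b half_bounded_intros D dmul_unit)
  have "dderiv i (l \<star> q) = dderiv i l \<star> q + l \<star> dderiv i q"
    by (rule dderiv_dmul) (simp_all only: D(3) dressed_lax[OF dr] multipliable_finite_op)
  moreover have "dderiv i (q \<star> lam (- 1)) = dderiv i q \<star> lam (- 1)"
    by (subst dderiv_dmul) (simp_all add: D b multipliable_half_bounded[of False] smooth_op_dmono
        smooth_fun_1 dderiv_lam dmul_0)
  ultimately have "dderiv i l \<star> q + l \<star> (?G \<star> q) = ?G \<star> q \<star> lam (- 1)"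
    using lq ev by simp
  also have "\<dots> = ?G \<star> l \<star> q" by (simp add: dmul_algebra(1)[of False] b lq)
  finally have "(dderiv i l + l \<star> ?G) \<star> q = ?G \<star> l \<star> q"
    by (simp add: dmul_algebra[of False] b half_bounded_intros)
  then have "(dderiv i l + l \<star> ?G) \<star> q \<star> iq = ?G \<star> l \<star> q \<star> iq" by simp
  then have "dderiv i l + l \<star> ?G = ?G \<star> l"
    by (simp add: dmul_algebra(1)[of False] b half_bounded_intros D(13) dmul_unit)
  then show ?thesis by (simp add: algebra_simps)
qed

section \<open>The transformed solution\<close>

lemma dpow_intertwine:
  assumes "finite_op w" "finite_op l" "finite_op l1" "l1 \<star> w = w \<star> l"
  shows "dpow l1 n \<star> w = w \<star> dpow l n"
proof (induction n)
  case 0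
  show ?case by (simp add: dmul_unit)
next
  case (Suc n)
  have b: "half_bounded True w" "half_bounded True l" "half_bounded True l1"
      "half_bounded True (dpow l n)" "half_bounded True (dpow l1 n)"
    using assms by (simp_all add: finite_op_half_bounded finite_op_dpow)
  have "dpow l1 (Suc n) \<star> w = l1 \<star> w \<star> dpow l n"
    using Suc by (simp add: dmul_algebra(1)[of True] b)
  also have "\<dots> = w \<star> dpow l (Suc n)"
    unfolding assms(4) by (simp add: dmul_algebra(1)[of True] b)
  finally show ?case .
qed

text \<open>\<open>r\<close> is the defect of the intertwining relation: - W_x for log_+ and W_x for
  log_-, because W commutes with eps d/dx only up to W_x.\<close>

lemma A_dop_intertwine:
  assumes w: "finite_op w" "finite_op l" "finite_op l1" "l1 \<star> w = w \<star> l"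
    and m: "half_bounded d m" "half_bounded d m1" "half_bounded d r" "m1 \<star> w = w \<star> m + r"
  shows "A_dop l1 m1 j \<star> w = w \<star> A_dop l m j + dscale (1 / fact j) (dpow l1 j) \<star> r"
proof -
  let ?L = "dpow l j" and ?L1 = "dpow l1 j" and ?h = "dscale (harm j) unit_op"
  have b: "half_bounded d w" "half_bounded d ?L" "half_bounded d ?L1" "half_bounded d ?h"
      "half_bounded d m" "half_bounded d m1" "half_bounded d r"
    using w m by (simp_all add: finite_op_half_bounded finite_op_dpow half_bounded_intros)
  note mb = multipliable_half_bounded[of d]
  have h: "?h \<star> w = w \<star> ?h"
    by (simp add: dmul_dscale_left dmul_dscale_right mb b half_bounded_intros dmul_unit)
  have "?L1 \<star> (m1 - ?h) \<star> w = ?L1 \<star> (w \<star> m + r - w \<star> ?h)"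
    by (simp add: dmul_algebra(1,5)[of d] b half_bounded_intros m h)
  also have "w \<star> m + r - w \<star> ?h = w \<star> (m - ?h) + r"
    by (simp add: dmul_algebra(4)[of d] b)
  also have "?L1 \<star> (w \<star> (m - ?h) + r) = ?L1 \<star> w \<star> (m - ?h) + ?L1 \<star> r"
    by (simp add: dmul_algebra(1,2)[of d] b half_bounded_intros)
  also have "?L1 \<star> w \<star> (m - ?h) = w \<star> (?L \<star> (m - ?h))"
    unfolding dpow_intertwine[OF w] by (rule dmul_algebra(1)[of d]) (simp_all add: b
        half_bounded_intros)
  finally have "dscale (1 / fact j) (?L1 \<star> (m1 - ?h) \<star> w) =
      dscale (1 / fact j) (w \<star> (?L \<star> (m - ?h)) + ?L1 \<star> r)" by (simp only:)
  moreover have "dscale c (x + y) = dscale c x + dscale c y" for c x y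
    by (simp add: dscale_def fun_eq_iff distrib_left)
  ultimately show ?thesis
    unfolding A_dop_def by (simp add: dmul_dscale_left dmul_dscale_right mb b half_bounded_intros)
qed

lemma dderiv_inverse_dmul:
  assumes "half_bounded d a" "half_bounded d b" "smooth_op a" "smooth_op b" "b \<star> a = unit_op"
  shows "dderiv i b \<star> a = - (b \<star> dderiv i a)"
proof -
  have "dderiv i (b \<star> a) = dderiv i b \<star> a + b \<star> dderiv i a"
    by (rule dderiv_dmul) (simp_all add: assms multipliable_half_bounded[of d])
  then show ?thesis by (simp add: assms(5) dderiv_lam eq_neg_iff_add_eq_0)
qed

lemma first_wave_emb:
  assumes dr: "dressed p ip q iq l" and wave: "first_wave \<epsilon> (emb p) (emb q) z \<phi>"
  defines "\<alpha> \<equiv> \<lambda>j. A_dop l (p \<star> dderiv X ip) j"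
    and "\<beta> \<equiv> \<lambda>j. A_dop l (- (q \<star> dderiv X iq)) j"
  shows "smooth_fun \<phi>" "dapply l \<phi> = (\<lambda>p. scal z) * \<phi>"
    "eder \<epsilon> (T j) \<phi> = dapply (pos_part (B_dop l j)) \<phi>"
    "eder \<epsilon> (Y j) \<phi> = dapply (\<alpha> j - neg_part (\<alpha> j + \<beta> j)) \<phi>
       + dapply (dscale (1 / fact j) (dpow l j)) (eder \<epsilon> X \<phi>)"
proof -
  note D = dressedD[OF dr] and L = dressed_lax[OF dr]
  have z: "dapply 0 f = 0" for f by (simp add: dapply_def dmul_0)
  have f0: "finite_op 0" by (simp add: finite_op_def half_bounded_0)
  have eq: "op_apply \<epsilon> (emb x) f = dapply x f" if "finite_op x" for x f
    using op_apply_op1[OF that f0, of f] by (simp add: z)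
  from wave have w: "smooth_fun \<phi>" "op_apply \<epsilon> (emb l) \<phi> = (\<lambda>p. scal z * \<phi> p)"
    "\<And>j. eder \<epsilon> (T j) \<phi> = op_apply \<epsilon> (emb (pos_part (B_dop l j))) \<phi>"
    "\<And>j. eder \<epsilon> (Y j) \<phi> = op_apply \<epsilon> (op1 (\<alpha> j - neg_part (\<alpha> j + \<beta> j))
        (dscale (1 / fact j) (dpow l j))) \<phi>"
    unfolding first_wave_def Let_def lax_dressed[OF dr] log_dressed[OF dr] F_op_emb[OF L(3)]
      wave_op_emb B_op_emb op_plus_emb op_minus_emb op1_diff \<alpha>_def \<beta>_def
    by simp_all
  show "smooth_fun \<phi>" by (rule w(1))
  show "dapply l \<phi> = (\<lambda>p. scal z) * \<phi>"
    using w(2) L(3) by (simp add: eq times_fun_def)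
  have "finite_op (B_dop l j)" unfolding B_dop_def by (intro finite_op_dscale finite_op_dpow L)
  then have "finite {k. pos_part (B_dop l j) k \<noteq> 0}"
    by (auto simp: pos_part_def intro: finite_subset[OF _ finite_op_finite])
  then show "eder \<epsilon> (T j) \<phi> = dapply (pos_part (B_dop l j)) \<phi>"
    using w(3) by (simp add: eq finite_finite_op)
  have g: "finite_op (dpow l j)" "finite_op (dscale (1 / fact j) (dpow l j))"
    by (intro finite_op_dscale finite_op_dpow L)+
  have a: "half_bounded True (\<alpha> j)" "half_bounded False (\<beta> j)"
    unfolding \<alpha>_def \<beta>_def A_dop_def using g D
        by (simp_all add: half_bounded_intros finite_op_half_bounded)
  have "\<alpha> j - neg_part (\<alpha> j + \<beta> j) = pos_part (\<alpha> j + \<beta> j) - \<beta> j"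
    using pos_neg_part[of "\<alpha> j + \<beta> j"] by (simp add: algebra_simps)
  with a have "finite_op (\<alpha> j - neg_part (\<alpha> j + \<beta> j))"
    unfolding finite_op_def by (metis half_bounded_diff half_bounded_neg_part half_bounded_pos_part)
  with w(4)[of j] show "eder \<epsilon> (Y j) \<phi> = dapply (\<alpha> j - neg_part (\<alpha> j + \<beta> j)) \<phi>
       + dapply (dscale (1 / fact j) (dpow l j)) (eder \<epsilon> X \<phi>)"
    by (simp add: op_apply_op1 g)
qed

text \<open>\<open>w \<star> q\<close> starts at Lambda^(-1). The factor Lambda on its right moves
  the lowest exponent back to 0; since it commutes with Lambda^(-1), it does not change the dressed
  operator \<open>l1\<close>.\<close>

lemma dressed_transform:
  assumes dr: "dressed p ip q iq l"
    and w: "bounded_by True 0 w" "bounded_by False 1 w" "smooth_op w" "w 0 = 1"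
        "pointwise_invertible (w (- 1))"
    and wd: "bounded_by True 0 wd" "smooth_op wd" "w \<star> wd = unit_op" "wd \<star> w = unit_op"
    and wu: "bounded_by False (- 1) wu" "smooth_op wu" "w \<star> wu = unit_op" "wu \<star> w = unit_op"
    and l1: "finite_op l1" "l1 \<star> w = w \<star> l"
  shows "dressed (w \<star> p) (ip \<star> wd) (w \<star> q \<star> lam 1) (lam (- 1) \<star> (iq \<star> wu)) l1"
proof -
  note D = dressedD[OF dr] and L = dressed_lax[OF dr]
  note W = bounded_by_half_bounded[OF w(1)] bounded_by_half_bounded[OF w(2)]
      bounded_by_half_bounded[OF wd(1)] bounded_by_half_bounded[OF wu(1)]
  have LL: "lam m \<star> lam n = lam (m + n)" for m n by (simp add: dmono_dmono)
  have cancelT: "a \<star> (b \<star> c) = c" if "a \<star> b = unit_op" "half_bounded True a" "half_bounded True b"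
      "half_bounded True c" for a b c
    using dmul_algebra(1)[OF that(2-4), symmetric] that(1) by (simp add: dmul_unit)
  have cancelF: "a \<star> (b \<star> c) = c" if "a \<star> b = unit_op" "half_bounded False a"
      "half_bounded False b" "half_bounded False c" for a b c
    using dmul_algebra(1)[OF that(2-4), symmetric] that(1) by (simp add: dmul_unit)
  have l1b: "half_bounded d l1" for d by (rule finite_op_half_bounded[OF l1(1)])
  have "l1 = l1 \<star> w \<star> wd"
    by (simp add: dmul_algebra(1)[of True] l1b W wd dmul_unit)
  also have "\<dots> = w \<star> p \<star> lam 1 \<star> (ip \<star> wd)"
    unfolding l1(2) D(15) by (simp add: dmul_algebra(1)[of True] W D(17,18) half_bounded_intros)
  finally have 1: "l1 = w \<star> p \<star> lam 1 \<star> (ip \<star> wd)" .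
  have "l1 = l1 \<star> w \<star> wu"
    by (simp add: dmul_algebra(1)[of False] l1b W wu dmul_unit)
  also have "\<dots> = w \<star> q \<star> lam (- 1) \<star> (iq \<star> wu)"
    unfolding l1(2) D(16) by (simp add: dmul_algebra(1)[of False] W D(19,20) half_bounded_intros)
  also have "lam (- 1) = lam 1 \<star> lam (- 1) \<star> lam (- 1)" by (simp add: LL)
  also have "w \<star> q \<star> (lam 1 \<star> lam (- 1) \<star> lam (- 1)) \<star> (iq \<star> wu) =
      w \<star> q \<star> lam 1 \<star> lam (- 1) \<star> (lam (- 1) \<star> (iq \<star> wu))"
    by (simp add: dmul_algebra(1)[of False] W D(19,20) half_bounded_intros)
  finally have 2: "l1 = w \<star> q \<star> lam 1 \<star> lam (- 1) \<star> (lam (- 1) \<star> (iq \<star> wu))" .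
  have p0: "bounded_by True (0 + 0) (w \<star> p)" "bounded_by True (0 + 0) (ip \<star> wd)"
    "bounded_by False (1 + 0 + - 1) (w \<star> q \<star> lam 1)"
        "bounded_by False (1 + (0 + - 1)) (lam (- 1) \<star> (iq \<star> wu))"
    by (intro bounded_by_dmul w D wd wu; rule bounded_by_dmono; simp)+
  have e1: "(w \<star> p) 0 = 1"
  proof -
    have "(w \<star> p) 0 = (\<Sum>k\<in>{0}. w k * shift \<epsilon> k (p (0 - k)))"
    proof (rule dmul_eq_sum)
      fix k assume "w k \<noteq> 0" "p (0 - k) \<noteq> 0"
      with w(1) D(5) have "k \<le> 0" "0 - k \<le> 0" unfolding bounded_by_def by fastforce+
      then show "k \<in> {0}" by simp
    qed simp
    then show ?thesis by (simp add: w D(9))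
  qed
  \<comment> \<open>This is the lowest coefficient of \<open>w \<star> q\<close>, moved from
    exponent -1 to 0, so only the lowest coefficients of the factors contribute.\<close>
  have e2: "(w \<star> q \<star> lam 1) 0 = w (- 1) * shift \<epsilon> (- 1) (q 0)"
  proof -
    have "(w \<star> q) (- 1) = (\<Sum>k\<in>{- 1}. w k * shift \<epsilon> k (q (- 1 - k)))"
    proof (rule dmul_eq_sum)
      fix k assume "w k \<noteq> 0" "q (- 1 - k) \<noteq> 0"
      with w(2) D(7) have "- k \<le> 1" "- (- 1 - k) \<le> 0" unfolding bounded_by_def by fastforce+
      then show "k \<in> {- 1}" by simp
    qed simp
    then show ?thesis by (simp add: dmul_dmono)
  qed
  have "w (- 1) * shift \<epsilon> (- 1) (q 0) * (fun_inv (shift \<epsilon> (- 1) (q 0)) * fun_inv (w (- 1))) = 1"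
  proof -
    have "w (- 1) * shift \<epsilon> (- 1) (q 0) * (fun_inv (shift \<epsilon> (- 1) (q 0)) * fun_inv (w (- 1)))
        = (w (- 1) * fun_inv (w (- 1))) * (shift \<epsilon> (- 1) (q 0) * fun_inv (shift \<epsilon> (- 1) (q 0)))"
      by (simp only: mult_ac)
    then show ?thesis
      unfolding fun_inv_right[OF w(5)] fun_inv_right[OF pointwise_invertible_shift[OF D(10)]]
          by simp
  qed
  then have e3: "pointwise_invertible ((w \<star> q \<star> lam 1) 0)"
    unfolding e2 by (rule pointwise_invertibleI)
  have i1: "w \<star> p \<star> (ip \<star> wd) = unit_op" "ip \<star> wd \<star> (w \<star> p) = unit_op"
    by (simp_all add: dmul_algebra(1)[of True] W D(17,18) half_bounded_intros
        cancelT[OF D(11)] cancelT[OF D(12)] cancelT[OF wd(3)] cancelT[OF wd(4)] wd D(12))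
  have i2: "w \<star> q \<star> lam 1 \<star> (lam (- 1) \<star> (iq \<star> wu)) = unit_op"
    "lam (- 1) \<star> (iq \<star> wu) \<star> (w \<star> q \<star> lam 1) = unit_op"
    by (simp_all add: dmul_algebra(1)[of False] W D(19,20) half_bounded_intros LL cancelF[of
        "lam 1" "lam (- 1)"]
        cancelF[OF D(13)] cancelF[OF D(14)] cancelF[OF wu(3)] cancelF[OF wu(4)] wu D(14))
  show ?thesis
    unfolding dressed_def
    using 1 2 p0 e1 e3 i1 i2 by (simp add: smooth_op_intros smooth_op_dmono smooth_fun_1 w wd wu
        D(1-4))
qed

text \<open>The right-hand sides are the parts free of eps d/dx of W log_+ W^(-1) and W log_-
  W^(-1): conjugating the logarithms agrees with dressing by W P and W Q Lambda. The powers of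
  Lambda have constant coefficients and cancel.\<close>

lemma transformed_logs:
  assumes dr: "dressed p ip q iq l"
    and w: "half_bounded True w" "half_bounded False w" "smooth_op w"
    and wd: "half_bounded True wd" "smooth_op wd" and wu: "half_bounded False wu" "smooth_op wu"
  shows "w \<star> p \<star> dderiv X (ip \<star> wd) = w \<star> (p \<star> dderiv X ip) \<star> wd + w \<star> dderiv X wd"
    and "- (w \<star> q \<star> lam 1 \<star> dderiv X (lam (- 1) \<star> (iq \<star> wu)))
      = w \<star> (- (q \<star> dderiv X iq)) \<star> wu + - (w \<star> dderiv X wu)"
proof -
  note D = dressedD[OF dr]
  have 1: "dderiv X (ip \<star> wd) = dderiv X ip \<star> wd + ip \<star> dderiv X wd"
    by (rule dderiv_dmul) (simp_all add: D(2,18) wd multipliable_half_bounded[of True])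
  have c: "p \<star> (ip \<star> dderiv X wd) = dderiv X wd"
    using dmul_algebra(1)[of True p ip "dderiv X wd", symmetric]
    by (simp add: D(11,17,18) wd half_bounded_intros dmul_unit)
  show "w \<star> p \<star> dderiv X (ip \<star> wd) = w \<star> (p \<star> dderiv X ip) \<star> wd + w \<star> dderiv X wd"
    unfolding 1 by (simp add: dmul_algebra(1,2)[of True] w wd D(17,18) half_bounded_intros c)
  have 2: "dderiv X (lam (- 1) \<star> (iq \<star> wu)) =
      lam (- 1) \<star> (dderiv X iq \<star> wu + iq \<star> dderiv X wu)"
    by (simp add: dderiv_dmul D(4,20) wu multipliable_half_bounded[of False] half_bounded_intros
        smooth_op_intros smooth_fun_1
        dderiv_lam dmul_0)
  have c: "q \<star> (iq \<star> dderiv X wu) = dderiv X wu"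
    using dmul_algebra(1)[of False q iq "dderiv X wu", symmetric]
    by (simp add: D(13,19,20) wu half_bounded_intros dmul_unit)
  have cl: "lam 1 \<star> (lam (- 1) \<star> a) = a" if "half_bounded False a" for a
    using dmul_algebra(1)[of False "lam 1" "lam (- 1)" a, symmetric] that
    by (simp add: half_bounded_intros dmono_dmono dmul_unit)
  show "- (w \<star> q \<star> lam 1 \<star> dderiv X (lam (- 1) \<star> (iq \<star> wu)))
      = w \<star> (- (q \<star> dderiv X iq)) \<star> wu + - (w \<star> dderiv X wu)"
    unfolding 2 dmul_uminus
    by (simp add: dmul_algebra(1,2)[of False] w wu D(19,20) half_bounded_intros c cl)
qed

text \<open>Two gauge equations are taken because each is multiplied in one direction only:
  \<open>neg\<close> by \<open>p\<close>, whose series goes down, and \<open>pos\<close> by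
  \<open>q\<close>, whose series goes up.\<close>

lemma evolves_transform:
  assumes dr: "dressed p ip q iq l"
    and w: "finite_op w" "smooth_op w"
    and ev: "evolves i G p q"
    and pos: "dderiv i w + w \<star> pos_part G = pos_part G1 \<star> w"
    and neg: "dderiv i w - w \<star> neg_part G = - (neg_part G1 \<star> w)"
  shows "evolves i G1 (w \<star> p) (w \<star> q \<star> lam 1)"
  unfolding evolves_def
proof
  note D = dressedD[OF dr]
  have wb: "half_bounded d w" for d by (rule finite_op_half_bounded[OF w(1)])
  note bs = wb D(17-20) half_bounded_intros half_bounded_pos_part half_bounded_neg_part
  have "dderiv i (w \<star> p) = dderiv i w \<star> p + w \<star> dderiv i p"
    by (rule dderiv_dmul) (simp_all add: w D(1) multipliable_finite_op)
  also have "\<dots> = (dderiv i w - w \<star> neg_part G) \<star> p"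
    using ev by (simp add: evolves_def dmul_uminus dmul_algebra(1,5)[of True] bs)
  also have "\<dots> = - (neg_part G1 \<star> (w \<star> p))"
    unfolding neg dmul_uminus by (simp add: dmul_algebra(1)[of True] bs)
  finally show "dderiv i (w \<star> p) = - (neg_part G1 \<star> (w \<star> p))" .
  have "dderiv i (w \<star> q) = dderiv i w \<star> q + w \<star> dderiv i q"
    by (rule dderiv_dmul) (simp_all add: w D(3) multipliable_finite_op)
  also have "\<dots> = (dderiv i w + w \<star> pos_part G) \<star> q"
    using ev by (simp add: evolves_def dmul_algebra(1,3)[of False] bs)
  finally have "dderiv i (w \<star> q) = pos_part G1 \<star> w \<star> q" unfolding pos .
  moreover have "dderiv i (w \<star> q \<star> lam 1) = dderiv i (w \<star> q) \<star> lam 1"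
    by (subst dderiv_dmul) (simp_all add: w D(3) smooth_op_intros smooth_fun_1
        multipliable_half_bounded[of False] bs
        dderiv_lam dmul_0)
  ultimately show "dderiv i (w \<star> q \<star> lam 1) = pos_part G1 \<star> (w \<star> q \<star> lam 1)"
    by (simp add: dmul_algebra(1)[of False] bs)
qed

lemma sceth_darboux:
  assumes dr: "dressed p ip q iq l" and sol: "sceth_solution \<epsilon> (emb p) (emb q)"
    and wave: "first_wave \<epsilon> (emb p) (emb q) z \<phi>" and inv: "pointwise_invertible \<phi>"
    and w: "w = darboux_dop \<phi>"
    and wd: "bounded_by True 0 wd" "smooth_op wd" "w \<star> wd = unit_op" "wd \<star> w = unit_op"
    and wu: "bounded_by False (- 1) wu" "smooth_op wu" "w \<star> wu = unit_op" "wu \<star> w = unit_op"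
  obtains l1 where
    "dressed (w \<star> p) (ip \<star> wd) (w \<star> q \<star> lam 1) (lam (- 1) \<star> (iq \<star> wu)) l1"
    "l1 \<star> w = w \<star> l" "sceth_solution \<epsilon> (emb (w \<star> p)) (emb (w \<star> q \<star> lam 1))"
proof -
  note D = dressedD[OF dr] and L = dressed_lax[OF dr] and F = first_wave_emb[OF dr wave]
  have finw: "finite_op w" and smw: "smooth_op w" and wbd: "bounded_by True 0 w"
      "bounded_by False 1 w"
    unfolding w using finite_op_darboux_dop smooth_op_darboux_dop[OF F(1) inv]
        bounded_by_darboux_dop by auto
  have w0: "w 0 = 1" "w (- 1) = - darboux_coeff \<phi>"
    by (simp_all add: w darboux_dop_def dmono_def)
  have wb: "half_bounded d w" for d by (rule finite_op_half_bounded[OF finw])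
  have wdb: "half_bounded True wd" and wub: "half_bounded False wu"
      by (rule bounded_by_half_bounded[OF wd(1)], rule bounded_by_half_bounded[OF wu(1)])
  \<comment> \<open>The eigenvalue equation gives W L \<phi> = z W \<phi> = 0, so W L is divisible
    by W on the right.\<close>
  have "dapply (w \<star> l) \<phi> = 0"
    using dapply_darboux_dop[OF inv] by (simp add: dapply_dmul finw L F(2) dapply_scal_arg
        w[symmetric])
  with darboux_dop_right_factor[of "w \<star> l" \<phi>] obtain l1 where l1: "finite_op l1" "l1 \<star> w = w \<star> l"
    using finw L(3) inv w by (metis finite_op_dmul)
  have dr1: "dressed (w \<star> p) (ip \<star> wd) (w \<star> q \<star> lam 1) (lam (- 1) \<star> (iq \<star> wu)) l1"
    by (rule dressed_transform[OF dr wbd smw w0(1) _ wd wu l1])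
      (simp add: w0 pointwise_invertible_darboux_coeff inv)
  let ?m = "p \<star> dderiv X ip" and ?n = "- (q \<star> dderiv X iq)"
  let ?m1 = "w \<star> ?m \<star> wd + w \<star> dderiv X wd" and ?n1 = "w \<star> ?n \<star> wu + - (w \<star> dderiv X wu)"
  let ?X = "dderiv X w"
  note bs = wb wdb wub D(17-20) half_bounded_intros
  have c: "w \<star> (wd \<star> a) = a" if "half_bounded True a" for a
    using dmul_algebra(1)[of True w wd a, symmetric] that wd(3) by (simp add: bs dmul_unit)
  \<comment> \<open>Differentiating \<open>wd \<star> w = unit_op\<close> gives
    \<open>dderiv X wd \<star> w = - (wd \<star> ?X)\<close>, so the second summand of
    \<open>?m1\<close> produces the defect \<open>- ?X\<close>. The upward case \<open>n1\<close> is
    the same with the opposite sign.\<close>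
  have m1: "?m1 \<star> w = w \<star> ?m + - ?X"
    using dderiv_inverse_dmul[of True w wd X] wd(4)
    by (simp add: dmul_algebra(1,3)[of True] bs smw wd(2) dmul_unit dmul_uminus c)
  have c: "w \<star> (wu \<star> a) = a" if "half_bounded False a" for a
    using dmul_algebra(1)[of False w wu a, symmetric] that wu(3) by (simp add: bs dmul_unit)
  have n1: "?n1 \<star> w = w \<star> ?n + ?X"
    using dderiv_inverse_dmul[of False w wu X] wu(4)
    by (simp add: dmul_algebra(1,3,5)[of False] bs smw wu(2) dmul_unit dmul_uminus c)
  have ev1: "evolves (T j) (B_dop l1 j) (w \<star> p) (w \<star> q \<star> lam 1)" for j
  proof -
    let ?B = "B_dop l j" and ?B1 = "B_dop l1 j"
    have fB: "finite_op ?B" "finite_op ?B1" unfolding B_dop_def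
        by (intro finite_op_dscale finite_op_dpow L l1)+
    have B: "?B1 \<star> w = w \<star> ?B"
      unfolding B_dop_def
      by (simp only: dmul_dscale_left dmul_dscale_right multipliable_finite_op finw finite_op_dpow
          L l1
          dpow_intertwine[OF finw L(3) l1])
    have pn: "?B - neg_part ?B = pos_part ?B"
      using pos_neg_part[of ?B] by (metis add_diff_cancel_right')
    have f0: "finite_op 0" by (simp add: finite_op_def half_bounded_0)
    have z: "dapply 0 f = 0" for f by (simp add: dapply_def dmul_0)
    \<comment> \<open>A power of L is finite, so the whole generator can play the role of
      \<open>\<alpha>\<close>.\<close>
    have "dderiv (T j) w + w \<star> pos_part (?B + 0) = pos_part (?B1 + 0) \<star> w"
      "dderiv (T j) w - w \<star> neg_part (?B + 0) = - (neg_part (?B1 + 0) \<star> w)"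
      by (rule darboux_evolution[OF F(1) inv w, where \<gamma> = 0 and ?\<gamma>1.0 = 0];
          simp add: fB finite_op_half_bounded half_bounded_0 f0 B dmul_0 F(3) pn z)+
    then show ?thesis
      using sol unfolding sceth_solution_emb_iff[OF dr]
      by (intro evolves_transform[OF dr finw smw]) (simp_all only: add_0_right)
  qed
  have ev2: "evolves (Y j) (F_dop (w \<star> p) (ip \<star> wd) (w \<star> q \<star> lam 1) (lam (- 1) \<star> (iq \<star> wu)) l1 j)
      (w \<star> p) (w \<star> q \<star> lam 1)" for j
  proof -
    let ?a = "A_dop l ?m j" and ?b = "A_dop l ?n j" and ?a1 = "A_dop l1 ?m1 j" and ?b1 =
        "A_dop l1 ?n1 j"
    let ?g = "dscale (1 / fact j) (dpow l j)" and ?g1 = "dscale (1 / fact j) (dpow l1 j)"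
    have fg: "finite_op (dpow l j)" "finite_op (dpow l1 j)" "finite_op ?g" "finite_op ?g1"
      by (intro finite_op_dscale finite_op_dpow L l1)+
    have ab: "half_bounded True ?a" "half_bounded True ?a1" "half_bounded False ?b"
        "half_bounded False ?b1"
      unfolding A_dop_def using fg by (simp_all add: bs finite_op_half_bounded)
    have A: "?a1 \<star> w = w \<star> ?a - ?g1 \<star> ?X"
      using A_dop_intertwine[OF finw L(3) l1, of True ?m ?m1 "- ?X" j] m1
      by (simp add: bs dmul_uminus)
    have B: "?b1 \<star> w = w \<star> ?b + ?g1 \<star> ?X"
      by (rule A_dop_intertwine[OF finw L(3) l1, of False ?n ?n1 ?X j])
        (simp_all only: n1 bs)
    have G: "?g1 \<star> w = w \<star> ?g"
      by (simp only: dmul_dscale_left dmul_dscale_right multipliable_finite_op finw fg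
          dpow_intertwine[OF finw L(3) l1])
    have F1: "F_dop (w \<star> p) (ip \<star> wd) (w \<star> q \<star> lam 1) (lam (- 1) \<star> (iq \<star> wu)) l1 j = ?a1 + ?b1"
      unfolding F_dop_def transformed_logs[OF dr wb wb smw wdb wd(2) wub wu(2)] ..
    have "dderiv (Y j) w + w \<star> pos_part (?a + ?b) = pos_part (?a1 + ?b1) \<star> w"
      "dderiv (Y j) w - w \<star> neg_part (?a + ?b) = - (neg_part (?a1 + ?b1) \<star> w)"
      by (rule darboux_evolution[OF F(1) inv w ab fg(3,4) A B G F(4)])+
    moreover have "evolves (Y j) (?a + ?b) p q"
      using sol unfolding sceth_solution_emb_iff[OF dr] F_dop_def by blast
    ultimately show ?thesis
      unfolding F1 by (intro evolves_transform[OF dr finw smw])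
  qed
  have "sceth_solution \<epsilon> (emb (w \<star> p)) (emb (w \<star> q \<star> lam 1))"
    unfolding sceth_solution_emb_iff[OF dr1] using ev1 ev2 by blast
  with that dr1 l1(2) show ?thesis by blast
qed

section \<open>The coefficients of the transformed Lax operator\<close>

lemma lax_form_emb: "lax_form \<epsilon> u v = emb (lam 1 + dmono u 0 + dmono v (- 1))"
  by (simp add: lax_form_def Lam_emb op_fun_emb emb_mult op1_add dmono_dmono)

text \<open>Coefficients of L1 W = W L are compared at the exponents 1, 0 and -2. The last is chosen
  because there \<open>l1 (- 1)\<close> is the only surviving coefficient of \<open>l1\<close>, so
  v^[1] follows without u^[1].\<close>

lemma darboux_dop_lax_form:
  assumes l: "l = lam 1 + dmono u 0 + dmono v (- 1)" and inv: "pointwise_invertible \<phi>"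
    and l1: "bounded_by True 1 l1" "bounded_by False 1 l1" "l1 \<star> darboux_dop \<phi> = darboux_dop \<phi> \<star> l"
  defines "\<omega> \<equiv> darboux_coeff \<phi>"
  shows "l1 0 = u + (shift \<epsilon> 1 \<omega> - \<omega>)"
    "l1 (- 1) = \<omega> * fun_inv (shift \<epsilon> (- 1) \<omega>) * shift \<epsilon> (- 1) v"
    "l1 = lam 1 + dmono (l1 0) 0 + dmono (l1 (- 1)) (- 1)"
proof -
  have fl: "finite_op l1" "finite_op l"
    using bounded_by_half_bounded[OF l1(1)] bounded_by_half_bounded[OF l1(2)] unfolding l
        by (simp_all add: finite_op_def half_bounded_intros)
  have l1w: "(l1 \<star> darboux_dop \<phi>) n = l1 n - l1 (n + 1) * shift \<epsilon> (n + 1) \<omega>" for n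
    using fl by (simp add: darboux_dop_def dmul_diff_right multipliable_finite_op dmul_dmono
        dmul_unit \<omega>_def)
  have wl: "(darboux_dop \<phi> \<star> l) n = l n - \<omega> * shift \<epsilon> (- 1) (l (n + 1))" for n
    by (simp add: darboux_dop_def dmul_diff_left multipliable_finite_op finite_op_dmono dmono_dmul
        dmul_unit \<omega>_def)
  have e: "l1 n - l1 (n + 1) * shift \<epsilon> (n + 1) \<omega> = l n - \<omega> * shift \<epsilon> (- 1) (l (n + 1))" for n
    using l1(3) l1w wl by metis
  have z: "l1 n = 0" if "n > 1 \<or> n < - 1" for n
    using bdD[OF l1(1), of n] bdD[OF l1(2), of n] that by auto
  have lv: "l 2 = 0" "l 1 = 1" "l 0 = u" "l (- 1) = v" "l (- 2) = 0"
    unfolding l by (simp_all add: dmono_def)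
  have 1: "l1 1 = 1" using e[of 1] by (simp add: z lv)
  show 0: "l1 0 = u + (shift \<epsilon> 1 \<omega> - \<omega>)"
    using e[of 0] by (simp add: 1 lv algebra_simps)
  have "pointwise_invertible (- \<omega>)" unfolding \<omega>_def
      by (rule pointwise_invertible_darboux_coeff[OF inv])
  then have "- \<omega> * fun_inv (- \<omega>) = 1" by (rule fun_inv_right)
  then have "\<omega> * - fun_inv (- \<omega>) = 1" by simp
  then have "pointwise_invertible \<omega>" by (rule pointwise_invertibleI)
  then have i: "shift \<epsilon> (- 1) \<omega> * fun_inv (shift \<epsilon> (- 1) \<omega>) = 1"
    by (simp add: fun_inv_right pointwise_invertible_shift)
  have "l1 (- 1) * shift \<epsilon> (- 1) \<omega> = \<omega> * shift \<epsilon> (- 1) v"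
    using e[of "- 2"] by (simp add: z lv)
  then have "l1 (- 1) * shift \<epsilon> (- 1) \<omega> * fun_inv (shift \<epsilon> (- 1) \<omega>) =
      \<omega> * shift \<epsilon> (- 1) v * fun_inv (shift \<epsilon> (- 1) \<omega>)" by simp
  then show "l1 (- 1) = \<omega> * fun_inv (shift \<epsilon> (- 1) \<omega>) * shift \<epsilon> (- 1) v"
    by (simp only: mult.assoc i mult_1_right) (simp only: mult_ac)
  show "l1 = lam 1 + dmono (l1 0) 0 + dmono (l1 (- 1)) (- 1)"
  proof
    fix n :: int
    have "n = 1 \<or> n = 0 \<or> n = - 1 \<or> n > 1 \<or> n < - 1" by presburger
    then consider "n = 1" | "n = 0" | "n = - 1" | "n > 1 \<or> n < - 1" by blast
    then show "l1 n = (lam 1 + dmono (l1 0) 0 + dmono (l1 (- 1)) (- 1)) n"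
      by cases (auto simp: 1 z dmono_def)
  qed
qed

lemma darboux_dop_conjugation:
  assumes "pointwise_invertible \<phi>"
  shows "darboux_dop \<phi> = dmono \<phi> 0 \<star> (unit_op - lam (- 1)) \<star> dmono (fun_inv \<phi>) 0"
proof
  fix n
  have "(dmono \<phi> 0 \<star> (unit_op - lam (- 1)) \<star> dmono (fun_inv \<phi>) 0) n =
      \<phi> * (unit_op n - lam (- 1) n) * shift \<epsilon> n (fun_inv \<phi>)"
    by (simp add: dmul_dmono dmono_dmul)
  then show "darboux_dop \<phi> n = (dmono \<phi> 0 \<star> (unit_op - lam (- 1)) \<star> dmono (fun_inv \<phi>) 0) n"
    using fun_inv_right[OF assms]
    by (auto simp: darboux_dop_def darboux_coeff_def dmono_def shift_fun_inv)
qed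

end

lemma ent_mult_s2_inv:
  assumes "invertible (to_mat y)"
  shows "ent0 (x * s2_inv y) = (ent0 x * ent0 y - ent1 x * ent1 y) / (ent0 y ^ 2 - ent1 y ^ 2)"
    "ent1 (x * s2_inv y) = (ent1 x * ent0 y - ent0 x * ent1 y) / (ent0 y ^ 2 - ent1 y ^ 2)"
  using assms by (simp_all add: s2_inv_eq divide_inverse algebra_simps)

theorem theorem6p1:
  fixes \<epsilon> :: real and z :: complex
    and P Q W L L1 lp1 lm1 :: op
    and u0 u1 v0 v1 \<phi>0 \<phi>1 :: "pt \<Rightarrow> complex" and \<phi> :: sfun
  assumes eps: "\<epsilon> \<noteq> 0"
    and sol: "sceth_solution \<epsilon> P Q"
    and L: "L = lax \<epsilon> P"
    and L_form: "L = lax_form \<epsilon> (mk_fun u0 u1) (mk_fun v0 v1)"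
    and phi: "\<phi> = mk_fun \<phi>0 \<phi>1"
    and phi_inv: "pointwise_invertible \<phi>"
    and wave: "first_wave \<epsilon> P Q z \<phi>"
    and W: "W = darboux \<epsilon> \<phi>"
    and L1: "L1 = W \<odot>\<^bsub>\<epsilon>\<^esub> L \<odot>\<^bsub>\<epsilon>\<^esub> inv_down \<epsilon> W"
    and lp1: "lp1 = W \<odot>\<^bsub>\<epsilon>\<^esub> log_plus \<epsilon> P \<odot>\<^bsub>\<epsilon>\<^esub> inv_down \<epsilon> W"
    and lm1: "lm1 = W \<odot>\<^bsub>\<epsilon>\<^esub> log_minus \<epsilon> Q \<odot>\<^bsub>\<epsilon>\<^esub> inv_up \<epsilon> W"
  shows "W = op_fun \<phi> \<odot>\<^bsub>\<epsilon>\<^esub> (op_id - Lam (- 1)) \<odot>\<^bsub>\<epsilon>\<^esub> op_fun (\<lambda>p. s2_inv (\<phi> p))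
    \<and> sceth_solution \<epsilon> (W \<odot>\<^bsub>\<epsilon>\<^esub> P) (W \<odot>\<^bsub>\<epsilon>\<^esub> Q \<odot>\<^bsub>\<epsilon>\<^esub> Lam 1)
    \<and> L1 = lax \<epsilon> (W \<odot>\<^bsub>\<epsilon>\<^esub> P)
    \<and> L1 = W \<odot>\<^bsub>\<epsilon>\<^esub> L \<odot>\<^bsub>\<epsilon>\<^esub> inv_up \<epsilon> W
    \<and> (\<forall>j. op_eder \<epsilon> (T j) L1 = op_comm \<epsilon> (op_plus (B_op \<epsilon> L1 j)) L1
          \<and> op_eder \<epsilon> (Y j) L1 = op_comm \<epsilon> (op_plus (F_op \<epsilon> L1 lp1 lm1 j)) L1)
    \<and> (\<exists>u0' u1' v0' v1' :: pt \<Rightarrow> complex.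
          L1 = lax_form \<epsilon> (mk_fun u0' u1') (mk_fun v0' v1')
        \<and> smooth_fun (mk_fun u0' u1') \<and> smooth_fun (mk_fun v0' v1')
        \<and> (let a0 = \<phi>0; a1 = \<phi>1;
               b0 = shift \<epsilon> (- 1) \<phi>0; b1 = shift \<epsilon> (- 1) \<phi>1;
               c0 = shift \<epsilon> (- 2) \<phi>0; c1 = shift \<epsilon> (- 2) \<phi>1;
               r0 = (\<lambda>p. (a0 p * b0 p - a1 p * b1 p) / (b0 p ^ 2 - b1 p ^ 2));
               r1 = (\<lambda>p. (a1 p * b0 p - a0 p * b1 p) / (b0 p ^ 2 - b1 p ^ 2));
               N0 = (\<lambda>p. a0 p * c0 p + a1 p * c1 p);
               N1 = (\<lambda>p. a0 p * c1 p + a1 p * c0 p);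
               D0 = (\<lambda>p. b0 p ^ 2 + b1 p ^ 2);
               D1 = (\<lambda>p. 2 * b0 p * b1 p);
               w0 = shift \<epsilon> (- 1) v0; w1 = shift \<epsilon> (- 1) v1
           in \<forall>p.
             u0' p = u0 p + (shift \<epsilon> 1 r0 p - r0 p)
           \<and> u1' p = u1 p + (shift \<epsilon> 1 r1 p - r1 p)
           \<and> v0' p = (N0 p * D0 p - N1 p * D1 p) / (D0 p ^ 2 - D1 p ^ 2) * w0 p
                   + (N1 p * D0 p - N0 p * D1 p) / (D0 p ^ 2 - D1 p ^ 2) * w1 p
           \<and> v1' p = (N0 p * D0 p - N1 p * D1 p) / (D0 p ^ 2 - D1 p ^ 2) * w1 p
                   + (N1 p * D0 p - N0 p * D1 p) / (D0 p ^ 2 - D1 p ^ 2) * w0 p))"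
proof -
  obtain p ip q iq l where PQ: "P = emb p" "Q = emb q" and dr: "dressed \<epsilon> p ip q iq l"
    by (rule sceth_solution_dressed[OF sol]) (rule that)
  have Ll: "L = emb l" unfolding L PQ by (rule lax_dressed(1)[OF dr])
  note sol' = sol[unfolded PQ] and wave' = wave[unfolded PQ]
  have sphi: "smooth_fun \<phi>" by (rule first_wave_emb(1)[OF dr wave'])
  define w where "w = darboux_dop \<epsilon> \<phi>"
  have Ww: "W = emb w" unfolding W w_def by (rule darboux_emb)
  obtain wd wu where wd: "bounded_by True 0 wd" "smooth_op wd" "dmul \<epsilon> w wd = unit_op" "dmul \<epsilon> wd w
      = unit_op"
    and wu: "bounded_by False (- 1) wu" "smooth_op wu" "dmul \<epsilon> w wu = unit_op" "dmul \<epsilon> wu w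
        = unit_op"
    by (rule darboux_dop_inverses[where \<epsilon> = \<epsilon>, OF sphi phi_inv, folded w_def]) (rule that)
  let ?p = "dmul \<epsilon> w p" and ?q = "dmul \<epsilon> (dmul \<epsilon> w q) (lam 1)"
    and ?ip = "dmul \<epsilon> ip wd" and ?iq = "dmul \<epsilon> (lam (- 1)) (dmul \<epsilon> iq wu)"
  obtain l1 where dr1: "dressed \<epsilon> ?p ?ip ?q ?iq l1" and l1: "dmul \<epsilon> l1 w = dmul \<epsilon> w l"
    and sol1: "sceth_solution \<epsilon> (emb ?p) (emb ?q)"
    by (rule sceth_darboux[OF dr sol' wave' phi_inv w_def wd wu]) (rule that)
  have wb: "half_bounded d w" for d unfolding w_def
      by (rule finite_op_half_bounded[OF finite_op_darboux_dop])
  have wdb: "half_bounded True wd" and wub: "half_bounded False wu"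
    by (rule bounded_by_half_bounded[OF wd(1)], rule bounded_by_half_bounded[OF wu(1)])
  have iW: "inv_down \<epsilon> W = emb wd" "inv_up \<epsilon> W = emb wu"
    unfolding Ww by (rule inv_down_emb[OF wb wdb wd(3,4)], rule inv_up_emb[OF wb wub wu(3,4)])
  have WP: "W \<odot>\<^bsub>\<epsilon>\<^esub> P = emb ?p" "W \<odot>\<^bsub>\<epsilon>\<^esub> Q \<odot>\<^bsub>\<epsilon>\<^esub> Lam 1 = emb ?q"
    unfolding Ww PQ Lam_emb emb_mult by (rule refl)+
  have L1d: "L1 = emb l1" and L1u: "L1 = W \<odot>\<^bsub>\<epsilon>\<^esub> L \<odot>\<^bsub>\<epsilon>\<^esub> inv_up \<epsilon> W"
  proof -
    have "dmul \<epsilon> (dmul \<epsilon> w l) wd = l1" "dmul \<epsilon> (dmul \<epsilon> w l) wu = l1"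
      unfolding l1[symmetric]
      by (simp_all add: dmul_assoc[of True l1 w wd] dmul_assoc[of False l1 w wu]
          dressed_lax(5)[OF dr1] wb wdb wub wd(3) wu(3) dmul_unit)
    then show "L1 = emb l1" "L1 = W \<odot>\<^bsub>\<epsilon>\<^esub> L \<odot>\<^bsub>\<epsilon>\<^esub> inv_up \<epsilon> W"
      unfolding L1 iW unfolding Ww Ll emb_mult by simp_all
  qed
  have W_conj: "W = op_fun \<phi> \<odot>\<^bsub>\<epsilon>\<^esub> (op_id - Lam (- 1)) \<odot>\<^bsub>\<epsilon>\<^esub> op_fun (\<lambda>p. s2_inv (\<phi> p))"
    unfolding Ww w_def darboux_dop_conjugation[OF phi_inv] fun_inv_def
    by (simp add: op_fun_emb op_id_emb Lam_emb op1_diff emb_mult)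
  \<comment> \<open>The Lax equations use the conjugated logarithms, the new Sato equations those of
    the new dressing operators; both have to be identified.\<close>
  have logs: "lp1 = log_plus \<epsilon> (emb ?p)" "lm1 = log_minus \<epsilon> (emb ?q)"
  proof -
    note D = dressedD[OF dr]
    note tl = transformed_logs[OF dr wb wb _ wdb wd(2) wub wu(2)]
    have smw: "smooth_op w" unfolding w_def by (rule smooth_op_darboux_dop[OF sphi phi_inv])
    show "lp1 = log_plus \<epsilon> (emb ?p)"
      unfolding lp1 iW log_dressed[OF dr1] tl(1)[OF smw]
          unfolding Ww PQ log_dressed[OF dr] emb_op1_mult
      by (subst op1_emb_mult[of True]) (simp_all add: half_bounded_intros D(17,18) wb wdb dmul_unit
          wd(3))
    show "lm1 = log_minus \<epsilon> (emb ?q)"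
      unfolding lm1 iW log_dressed[OF dr1] tl(2)[OF smw]
          unfolding Ww PQ log_dressed[OF dr] emb_op1_mult
      by (subst op1_emb_mult[of False])
        (simp_all add: half_bounded_intros D(19,20) wb wub dmul_unit wu(3) dmul_uminus)
  qed
  have comm: "op_comm \<epsilon> (op_plus (emb G)) (emb l1) =
      emb (dmul \<epsilon> (pos_part G) l1 - dmul \<epsilon> l1 (pos_part G))" for G
    by (simp add: op_comm_def op_plus_emb emb_mult op1_diff)
  have lax_eqs: "op_eder \<epsilon> (T j) L1 = op_comm \<epsilon> (op_plus (B_op \<epsilon> L1 j)) L1
      \<and> op_eder \<epsilon> (Y j) L1 = op_comm \<epsilon> (op_plus (F_op \<epsilon> L1 lp1 lm1 j)) L1" for j
    using sol1[unfolded sceth_solution_emb_iff[OF dr1] evolves_def]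
    unfolding L1d logs B_op_emb F_op_dressed[OF dr1] comm op_eder_emb emb_eq_iff
    by (auto intro!: lax_equation[OF dr1])
  define u where "u = mk_fun u0 u1"
  define v where "v = mk_fun v0 v1"
  let ?\<omega> = "darboux_coeff \<epsilon> \<phi>"
  have l: "l = lam 1 + dmono u 0 + dmono v (- 1)"
    using L_form unfolding Ll lax_form_emb emb_eq_iff u_def v_def .
  note form = darboux_dop_lax_form[OF l phi_inv dressed_lax(1,2)[OF dr1] l1[unfolded w_def]]
  have mk: "mk_fun (ent0 \<circ> f) (ent1 \<circ> f) = f" for f
    by (simp add: mk_fun_def fun_eq_iff s2_eq_iff)
  have om: "ent0 (?\<omega> p) = (\<phi>0 p * shift \<epsilon> (- 1) \<phi>0 p - \<phi>1 p * shift \<epsilon> (- 1) \<phi>1 p) /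
        (shift \<epsilon> (- 1) \<phi>0 p ^ 2 - shift \<epsilon> (- 1) \<phi>1 p ^ 2)"
    "ent1 (?\<omega> p) = (\<phi>1 p * shift \<epsilon> (- 1) \<phi>0 p - \<phi>0 p * shift \<epsilon> (- 1) \<phi>1 p) /
        (shift \<epsilon> (- 1) \<phi>0 p ^ 2 - shift \<epsilon> (- 1) \<phi>1 p ^ 2)" for p
  proof -
    have "invertible (to_mat (shift \<epsilon> (- 1) \<phi> p))"
      using pointwise_invertible_shift[OF phi_inv] by (simp add: pointwise_invertible_def)
    from ent_mult_s2_inv[OF this, of "\<phi> p"]
    show "ent0 (?\<omega> p) = (\<phi>0 p * shift \<epsilon> (- 1) \<phi>0 p - \<phi>1 p * shift \<epsilon> (- 1) \<phi>1 p) /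
        (shift \<epsilon> (- 1) \<phi>0 p ^ 2 - shift \<epsilon> (- 1) \<phi>1 p ^ 2)"
      "ent1 (?\<omega> p) = (\<phi>1 p * shift \<epsilon> (- 1) \<phi>0 p - \<phi>0 p * shift \<epsilon> (- 1) \<phi>1 p) /
        (shift \<epsilon> (- 1) \<phi>0 p ^ 2 - shift \<epsilon> (- 1) \<phi>1 p ^ 2)"
      by (simp_all add: darboux_coeff_def fun_inv_def phi mk_fun_def shift_def)
  qed
  \<comment> \<open>The factor \<omega> / \<omega>(x - eps) in v^[1], with \<omega> = \<phi> / b and
    \<omega>(x - eps) = b / c, equals \<phi> c / b^2. The entries of \<phi> c are N0 and N1, those
    of b^2 are D0 and D1.\<close>
  define b where "b = shift \<epsilon> (- 1) \<phi>"
  define c where "c = shift \<epsilon> (- 2) \<phi>"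
  have inv_b: "b * fun_inv b = 1" and inv_c: "c * fun_inv c = 1"
    unfolding b_def c_def by (simp_all add: fun_inv_right pointwise_invertible_shift phi_inv)
  have om': "?\<omega> = \<phi> * fun_inv b" "shift \<epsilon> (- 1) ?\<omega> = b * fun_inv c"
    by (simp_all add: darboux_coeff_def b_def c_def shift_fun_inv)
  have bb: "(b * b) * (fun_inv b * fun_inv b) = 1"
  proof -
    have "(b * b) * (fun_inv b * fun_inv b) = (b * fun_inv b) * (b * fun_inv b)"
      by (simp only: mult_ac)
    then show ?thesis unfolding inv_b by simp
  qed
  have inv_bb: "fun_inv (b * b) = fun_inv b * fun_inv b"
    using bb by (auto simp: fun_eq_iff fun_inv_def intro: s2_inv_unique)
  have "(b * fun_inv c) * (fun_inv b * c) = 1"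
  proof -
    have "(b * fun_inv c) * (fun_inv b * c) = (b * fun_inv b) * (c * fun_inv c)"
      by (simp only: mult_ac)
    then show ?thesis unfolding inv_b inv_c by simp
  qed
  then have e: "fun_inv (b * fun_inv c) = fun_inv b * c"
    by (auto simp: fun_eq_iff fun_inv_def intro: s2_inv_unique)
  have v1: "l1 (- 1) = (\<phi> * c) * fun_inv (b * b) * shift \<epsilon> (- 1) v"
    unfolding form(2) om'(2) e unfolding om'(1) inv_bb by (simp only: mult_ac)
  have ibb: "invertible (to_mat ((b * b) p))" for p
    using pointwise_invertibleI[OF bb] by (simp add: pointwise_invertible_def)
  have vform: "l1 (- 1) p = (\<phi> * c) p * s2_inv ((b * b) p) * shift \<epsilon> (- 1) v p" for p
    unfolding v1 by (simp add: fun_inv_def)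
  show ?thesis
  proof (intro conjI allI)
    show "W = op_fun \<phi> \<odot>\<^bsub>\<epsilon>\<^esub> (op_id - Lam (- 1)) \<odot>\<^bsub>\<epsilon>\<^esub> op_fun (\<lambda>p. s2_inv (\<phi> p))"
      by (rule W_conj)
    show "sceth_solution \<epsilon> (W \<odot>\<^bsub>\<epsilon>\<^esub> P) (W \<odot>\<^bsub>\<epsilon>\<^esub> Q \<odot>\<^bsub>\<epsilon>\<^esub> Lam 1)"
      unfolding WP by (rule sol1)
    show "L1 = lax \<epsilon> (W \<odot>\<^bsub>\<epsilon>\<^esub> P)"
      unfolding WP L1d by (rule lax_dressed(1)[OF dr1, symmetric])
    show "L1 = W \<odot>\<^bsub>\<epsilon>\<^esub> L \<odot>\<^bsub>\<epsilon>\<^esub> inv_up \<epsilon> W" by (rule L1u)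
    show "op_eder \<epsilon> (T j) L1 = op_comm \<epsilon> (op_plus (B_op \<epsilon> L1 j)) L1"
      "op_eder \<epsilon> (Y j) L1 = op_comm \<epsilon> (op_plus (F_op \<epsilon> L1 lp1 lm1 j)) L1" for j
      using lax_eqs[of j] by simp_all
    have sml: "smooth_fun (l1 k)" for k
      using dressed_lax(4)[OF dr1] by (simp add: smooth_op_def)
    have "L1 = lax_form \<epsilon> (mk_fun (ent0 \<circ> l1 0) (ent1 \<circ> l1 0))
        (mk_fun (ent0 \<circ> l1 (- 1)) (ent1 \<circ> l1 (- 1)))"
      unfolding mk lax_form_emb form(3)[symmetric] by (rule L1d)
    then show "\<exists>u0' u1' v0' v1' :: pt \<Rightarrow> complex.
          L1 = lax_form \<epsilon> (mk_fun u0' u1') (mk_fun v0' v1')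
        \<and> smooth_fun (mk_fun u0' u1') \<and> smooth_fun (mk_fun v0' v1')
        \<and> (let a0 = \<phi>0; a1 = \<phi>1;
               b0 = shift \<epsilon> (- 1) \<phi>0; b1 = shift \<epsilon> (- 1) \<phi>1;
               c0 = shift \<epsilon> (- 2) \<phi>0; c1 = shift \<epsilon> (- 2) \<phi>1;
               r0 = (\<lambda>p. (a0 p * b0 p - a1 p * b1 p) / (b0 p ^ 2 - b1 p ^ 2));
               r1 = (\<lambda>p. (a1 p * b0 p - a0 p * b1 p) / (b0 p ^ 2 - b1 p ^ 2));
               N0 = (\<lambda>p. a0 p * c0 p + a1 p * c1 p);
               N1 = (\<lambda>p. a0 p * c1 p + a1 p * c0 p);
               D0 = (\<lambda>p. b0 p ^ 2 + b1 p ^ 2);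
               D1 = (\<lambda>p. 2 * b0 p * b1 p);
               w0 = shift \<epsilon> (- 1) v0; w1 = shift \<epsilon> (- 1) v1
           in \<forall>p.
             u0' p = u0 p + (shift \<epsilon> 1 r0 p - r0 p)
           \<and> u1' p = u1 p + (shift \<epsilon> 1 r1 p - r1 p)
           \<and> v0' p = (N0 p * D0 p - N1 p * D1 p) / (D0 p ^ 2 - D1 p ^ 2) * w0 p
                   + (N1 p * D0 p - N0 p * D1 p) / (D0 p ^ 2 - D1 p ^ 2) * w1 p
           \<and> v1' p = (N0 p * D0 p - N1 p * D1 p) / (D0 p ^ 2 - D1 p ^ 2) * w1 p
                   + (N1 p * D0 p - N0 p * D1 p) / (D0 p ^ 2 - D1 p ^ 2) * w0 p)"
    proof (intro exI conjI)
      show "smooth_fun (mk_fun (ent0 \<circ> l1 0) (ent1 \<circ> l1 0))"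
        "smooth_fun (mk_fun (ent0 \<circ> l1 (- 1)) (ent1 \<circ> l1 (- 1)))"
        unfolding mk by (rule sml)+
    next
      have ent_b: "ent0 ((b * b) p) = shift \<epsilon> (- 1) \<phi>0 p ^ 2 + shift \<epsilon> (- 1) \<phi>1 p ^ 2"
        "ent1 ((b * b) p) = 2 * shift \<epsilon> (- 1) \<phi>0 p * shift \<epsilon> (- 1) \<phi>1 p" for p
        by (simp_all add: b_def phi mk_fun_def shift_def power2_eq_square)
      have ent_c: "ent0 ((\<phi> * c) p) = \<phi>0 p * shift \<epsilon> (- 2) \<phi>0 p + \<phi>1 p * shift \<epsilon> (- 2) \<phi>1 p"
        "ent1 ((\<phi> * c) p) = \<phi>0 p * shift \<epsilon> (- 2) \<phi>1 p + \<phi>1 p * shift \<epsilon> (- 2) \<phi>0 p" for p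
        by (simp_all add: c_def phi mk_fun_def shift_def)
      have ent_v: "ent0 (shift \<epsilon> (- 1) v p) = shift \<epsilon> (- 1) v0 p"
        "ent1 (shift \<epsilon> (- 1) v p) = shift \<epsilon> (- 1) v1 p" for p
        by (simp_all add: v_def mk_fun_def shift_def)
      have sh: "ent0 (shift \<epsilon> 1 ?\<omega> p) = shift \<epsilon> 1 (\<lambda>p. ent0 (?\<omega> p)) p"
        "ent1 (shift \<epsilon> 1 ?\<omega> p) = shift \<epsilon> 1 (\<lambda>p. ent1 (?\<omega> p)) p" for p
        by (simp_all add: shift_def)
      have ent_u: "ent0 (u p) = u0 p" "ent1 (u p) = u1 p" for p
        by (simp_all add: u_def mk_fun_def)
      have "(ent0 \<circ> l1 0) p = u0 p + (shift \<epsilon> 1 (\<lambda>p. ent0 (?\<omega> p)) p - ent0 (?\<omega> p))"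
        "(ent1 \<circ> l1 0) p = u1 p + (shift \<epsilon> 1 (\<lambda>p. ent1 (?\<omega> p)) p - ent1 (?\<omega> p))" for p
        unfolding form(1) by (simp_all add: ent_u sh)
      moreover have "(ent0 \<circ> l1 (- 1)) p = ent0 ((\<phi> * c) p * s2_inv ((b * b) p)) * shift \<epsilon> (- 1) v0
          p
          + ent1 ((\<phi> * c) p * s2_inv ((b * b) p)) * shift \<epsilon> (- 1) v1 p"
        "(ent1 \<circ> l1 (- 1)) p = ent0 ((\<phi> * c) p * s2_inv ((b * b) p)) * shift \<epsilon> (- 1) v1 p
          + ent1 ((\<phi> * c) p * s2_inv ((b * b) p)) * shift \<epsilon> (- 1) v0 p" for p
        unfolding comp_apply vform ent_simps(13,14)[of _ "shift \<epsilon> (- 1) v p"] ent_v by (rule refl)+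
      ultimately show "let a0 = \<phi>0; a1 = \<phi>1;
               b0 = shift \<epsilon> (- 1) \<phi>0; b1 = shift \<epsilon> (- 1) \<phi>1;
               c0 = shift \<epsilon> (- 2) \<phi>0; c1 = shift \<epsilon> (- 2) \<phi>1;
               r0 = (\<lambda>p. (a0 p * b0 p - a1 p * b1 p) / (b0 p ^ 2 - b1 p ^ 2));
               r1 = (\<lambda>p. (a1 p * b0 p - a0 p * b1 p) / (b0 p ^ 2 - b1 p ^ 2));
               N0 = (\<lambda>p. a0 p * c0 p + a1 p * c1 p);
               N1 = (\<lambda>p. a0 p * c1 p + a1 p * c0 p);
               D0 = (\<lambda>p. b0 p ^ 2 + b1 p ^ 2);
               D1 = (\<lambda>p. 2 * b0 p * b1 p);
               w0 = shift \<epsilon> (- 1) v0; w1 = shift \<epsilon> (- 1) v1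
           in \<forall>p.
             (ent0 \<circ> l1 0) p = u0 p + (shift \<epsilon> 1 r0 p - r0 p)
           \<and> (ent1 \<circ> l1 0) p = u1 p + (shift \<epsilon> 1 r1 p - r1 p)
           \<and> (ent0 \<circ> l1 (- 1)) p = (N0 p * D0 p - N1 p * D1 p) / (D0 p ^ 2 - D1 p ^ 2) * w0 p
                   + (N1 p * D0 p - N0 p * D1 p) / (D0 p ^ 2 - D1 p ^ 2) * w1 p
           \<and> (ent1 \<circ> l1 (- 1)) p = (N0 p * D0 p - N1 p * D1 p) / (D0 p ^ 2 - D1 p ^ 2) * w1 p
                   + (N1 p * D0 p - N0 p * D1 p) / (D0 p ^ 2 - D1 p ^ 2) * w0 p"
        unfolding Let_def ent_mult_s2_inv[OF ibb] ent_b ent_c om by blast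
    qed
  qed
qed

end
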